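(* There is an absolute constant $C>0$ such that for every integer $n>0$, every $\delta\in(0,2^{-n-1})$ and $\gamma\in(0,1/2)$, every $a\in C^\infty(\mathbb{T}^2)$ with support in $\mathcal{D}_{n,\delta,\gamma}$, every even integer $N\ge2$ and every $\sigma\in[\frac{4^n}{N},N]$, $$\big\|\hat B_N^n\,\mathrm{Op}^{\mathrm W}_N(a)\,\hat B_N^{-n}-\mathrm{Op}^{\mathrm W}_N(a\circ B^{-n})\big\|\leq C\bigg[\|a\|_{C^0}\,N^{5/4}\,\sigma^{1/4}\,e^{-\pi N\theta}+\frac1N\Big(\max(\sigma,\sigma^{-1})\,\|a\|_{C^5}+\max\Big(\frac{\sigma}{4^n},\frac{4^n}{\sigma}\Big)\|a\circ B^{-n}\|_{C^5}\Big)\bigg],$$ where $\theta:=\min(\sigma\delta^2,\gamma^2/\sigma)$.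
   Context: $\mathbb{T}^2=\mathbb{R}^2/\mathbb{Z}^2\cong[0,1)^2$, with points $\mathbf{x}=(q,p)$. Classical baker's map: the bijection $B:\mathbb{T}^2\to\mathbb{T}^2$, $B(q,p)=(2q,p/2)$ if $q\in[0,1/2)$, and $B(q,p)=(2q-1,(p+1)/2)$ if $q\in[1/2,1)$. $\mathcal{D}_{n,\delta,\gamma}:=\{(q,p)\in\mathbb{T}^2:\ |q-\frac{k}{2^n}|>\delta\ \ \forall k\in\mathbb{Z},\ p\in(\gamma,1-\gamma)\}$ (a set on which $B^n$ is continuous; for $a$ supported there $a\circ B^{-n}$ is smooth). Norms: $\|f\|_{C^0}$ is the sup norm, $\|f\|_{C^j}:=\sum_{|\gamma|\le j}\|\partial^{\gamma}f\|_{C^0}$ over multiindices in $\mathbb{N}_0^2$; $\|\cdot\|$ is the operator norm on $\mathcal{H}_N$. For an integer $N\ge1$, $\mathcal{H}_N$ is an $N$-dimensional complex Hilbert space identified with $\mathbb{C}^N$ through an orthonormal "position" basis $\{\mathbf{q}_j\}_{j=0}^{N-1}$ (indices understood mod $N$). $\hat F_N$ is the unitary matrix $(\hat F_N)_{kj}=N^{-1/2}e^{-2\pi i kj/N}$, $0\le k,j\le N-1$. For $N$ even, the quantum baker's map is, in the basis $\{\mathbf{q}_j\}$, $$\hat B_N:=\hat F_N^{-1}\begin{pmatrix}\hat F_{N/2}&0\\0&\hat F_{N/2}\end{pmatrix}.$$ Weyl quantisation: for $\mathbf{k}=(k_1,k_2)\in\mathbb{Z}^2$ let $T(\mathbf{k})\mathbf{q}_j=e^{i\pi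 k_1k_2/N}e^{2\pi i k_2 j/N}\,\mathbf{q}_{j+k_1}$. For $f\in C^\infty(\mathbb{T}^2)$ with Fourier expansion $f(q,p)=\sum_{\mathbf{k}}\tilde f(\mathbf{k})e^{2\pi i(qk_2-pk_1)}$, $\mathrm{Op}^{\mathrm W}_N(f):=\sum_{\mathbf{k}\in\mathbb{Z}^2}\tilde f(\mathbf{k})\,T(\mathbf{k})$. *)

theory Defs
  imports "HOL-Analysis.Analysis" "Jordan_Normal_Form.Gauss_Jordan_Elimination"
begin

unbundle no vec_syntax

section \<open>Functions on the torus\<close>

text \<open>A function on the torus $\mathbb{R}^2/\mathbb{Z}^2$ is represented by its
  $\mathbb{Z}^2$-periodic lift to the plane.\<close>

type_synonym plane_fun = "real \<times> real \<Rightarrow> complex"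

definition torus_periodic :: "plane_fun \<Rightarrow> bool" where
  "torus_periodic f \<longleftrightarrow>
     (\<forall>q p. \<forall>m n :: int. f (q + of_int m, p + of_int n) = f (q, p))"

definition partial_q :: "plane_fun \<Rightarrow> plane_fun" where
  "partial_q f = (\<lambda>(q, p). vector_derivative (\<lambda>t. f (t, p)) (at q))"

definition partial_p :: "plane_fun \<Rightarrow> plane_fun" where
  "partial_p f = (\<lambda>(q, p). vector_derivative (\<lambda>t. f (q, t)) (at p))"

primrec C_class :: "nat \<Rightarrow> plane_fun \<Rightarrow> bool" where
  "C_class 0 f \<longleftrightarrow> continuous_on UNIV f"
| "C_class (Suc k) f \<longleftrightarrow>
     continuous_on UNIV f \<and>
     (\<forall>q p. (\<lambda>t. f (t, p)) differentiable (at q) \<and> (\<lambda>t. f (q, t)) differentiable (at p)) \<and>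
     C_class k (partial_q f) \<and> C_class k (partial_p f)"

definition torus_smooth :: "plane_fun \<Rightarrow> bool" where
  "torus_smooth f \<longleftrightarrow> torus_periodic f \<and> (\<forall>k. C_class k f)"

definition C0_norm :: "plane_fun \<Rightarrow> real" where
  "C0_norm f = (SUP x. cmod (f x))"

definition C_norm :: "nat \<Rightarrow> plane_fun \<Rightarrow> real" where
  "C_norm m f = (\<Sum>(i, j) \<in> {(i, j). i + j \<le> m}. C0_norm ((partial_q ^^ i) ((partial_p ^^ j) f)))"

text \<open>For a periodic lift, this closure is the full preimage in the plane of the
  (closed) support on the torus.\<close>

definition plane_support :: "plane_fun \<Rightarrow> (real \<times> real) set" where
  "plane_support f = closure {x. f x \<noteq> 0}"

section \<open>The classical baker's map\<close>

definition unit_square :: "(real \<times> real) set" where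
  "unit_square = {0..<1} \<times> {0..<1}"

definition torus_rep :: "real \<times> real \<Rightarrow> real \<times> real" where
  "torus_rep = (\<lambda>(q, p). (frac q, frac p))"

text \<open>The values of this function matter on \<^term>\<open>unit_square\<close> only.\<close>

definition baker :: "real \<times> real \<Rightarrow> real \<times> real" where
  "baker = (\<lambda>(q, p). if q < 1 / 2 then (2 * q, p / 2) else (2 * q - 1, (p + 1) / 2))"

lemma bij_betw_baker: "bij_betw baker unit_square unit_square"
proof (rule bij_betw_byWitness[where f' =
    "\<lambda>(q, p). if p < 1 / 2 then (q / 2, 2 * p) else ((q + 1) / 2, 2 * p - 1)"])
qed (auto simp: baker_def unit_square_def field_simps split: if_splits)

lemma bij_betw_baker_funpow: "bij_betw (baker ^^ n) unit_square unit_square"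
  by (rule bij_betw_funpow[OF bij_betw_baker])

text \<open>The periodic lift of $f \circ B^{-n}$.\<close>

definition comp_baker_inv :: "plane_fun \<Rightarrow> nat \<Rightarrow> plane_fun" where
  "comp_baker_inv f n = (\<lambda>x. f (inv_into unit_square (baker ^^ n) (torus_rep x)))"

text \<open>The periodic preimage in the plane of $\mathcal{D}_{n,\delta,\gamma}$.\<close>

definition good_set :: "nat \<Rightarrow> real \<Rightarrow> real \<Rightarrow> (real \<times> real) set" where
  "good_set n \<delta> \<gamma> =
     {(q, p). (\<forall>k :: int. \<bar>q - of_int k / 2 ^ n\<bar> > \<delta>) \<and> \<gamma> < frac p \<and> frac p < 1 - \<gamma>}"

section \<open>Quantum side\<close>

definition vec_l2_norm :: "complex vec \<Rightarrow> real" where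
  "vec_l2_norm v = L2_set (\<lambda>i. cmod (v $ i)) {..<dim_vec v}"

definition op_norm :: "complex mat \<Rightarrow> real" where
  "op_norm A = (SUP v \<in> {v \<in> carrier_vec (dim_col A). vec_l2_norm v \<le> 1}. vec_l2_norm (A *\<^sub>v v))"

text \<open>\<^const>\<open>mat_inverse\<close> returns \<^const>\<open>None\<close> only on non-invertible matrices; here it is
  applied to unitary ones.\<close>

definition mat_inv :: "complex mat \<Rightarrow> complex mat" where
  "mat_inv A = the (mat_inverse A)"

definition fourier_mat :: "nat \<Rightarrow> complex mat" where
  "fourier_mat N = Matrix.mat N N
     (\<lambda>(k, j). complex_of_real (1 / sqrt (real N)) * cis (- 2 * pi * real k * real j / real N))"

definition quantum_baker :: "nat \<Rightarrow> complex mat" where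
  "quantum_baker N = (let M = N div 2 in
     mat_inv (fourier_mat N) *
     four_block_mat (fourier_mat M) (0\<^sub>m M M) (0\<^sub>m M M) (fourier_mat M))"

definition weyl_translation :: "nat \<Rightarrow> int \<times> int \<Rightarrow> complex mat" where
  "weyl_translation N = (\<lambda>(k1, k2). Matrix.mat N N (\<lambda>(i, j).
     if int i = (int j + k1) mod int N
     then cis (pi * of_int k1 * of_int k2 / real N) * cis (2 * pi * of_int k2 * real j / real N)
     else 0))"

text \<open>The coefficients of the expansion
  $f(q,p) = \sum_{k} \tilde f(k)\, e^{2\pi i (q k_2 - p k_1)}$.\<close>

definition fourier_coeff :: "plane_fun \<Rightarrow> int \<times> int \<Rightarrow> complex" where
  "fourier_coeff f = (\<lambda>(k1, k2). integral (cbox (0, 0) (1, 1))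
     (\<lambda>(q, p). f (q, p) * cis (- 2 * pi * (q * of_int k2 - p * of_int k1))))"

text \<open>The operator-valued series is summed entrywise, which is the same as norm convergence
  since the dimension is finite.\<close>

definition weyl_op :: "nat \<Rightarrow> plane_fun \<Rightarrow> complex mat" where
  "weyl_op N f = Matrix.mat N N
     (\<lambda>(i, j). \<Sum>\<^sub>\<infinity>k\<in>UNIV. fourier_coeff f k * weyl_translation N k $$ (i, j))"

end

theory Submission
  imports Defs "Jordan_Normal_Form.Determinant"
begin

text \<open>In the position basis the matrix entry \<open>(i, j)\<close> of a Weyl operator is the sum, over
  \<open>k \<equiv> i - j\<close> modulo \<open>N\<close>, of the \<open>k\<close>-th momentum Fourier coefficient of the symbol at the midpoint
  \<open>(j + k/2)/N\<close>; in the momentum basis the same holds with the roles of \<open>q\<close> and \<open>p\<close> exchanged. On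
  states supported in one half of the position interval the block Fourier transform of the baker's
  map is \<open>\<surd>2\<close> times the full Fourier transform restricted to even frequencies. Hence for a symbol
  supported in one half strip the terms \<open>k = 2(r - s)\<close> of the evolved operator and the terms
  \<open>k = r - s\<close> of the quantised evolved symbol agree exactly. In every remaining term the path from
  \<open>j\<close> to \<open>j + k\<close> meets a line on which the symbol vanishes, at distance at most \<open>\<bar>k\<bar>/(2N)\<close> from the
  midpoint. One derivative across this line and three integrations by parts bound the term by
  \<open>O(1/(N k\<^sup>2))\<close>, and Schur's test gives \<open>O(1/N)\<close> for one step, with fourth order derivatives
  \<open>\<partial>\<^sub>q \<partial>\<^sub>p\<^sup>3\<close> and \<open>\<partial>\<^sub>q\<^sup>3 \<partial>\<^sub>p\<close> only. The step multiplies the norms of these by \<open>4\<close> and \<open>1/4\<close>,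
  so \<open>n\<close> steps add up geometrically to \<open>O(1/N)\<close> times the norms of \<open>a\<close> and \<open>a \<circ> B\<^bsup>-n\<^esup>\<close>. The exponential
  term of the bound is simply dropped.\<close>

section \<open>Fourier series in one variable\<close>

text \<open>Fourier coefficients in momentum meet the cut of the position axis, coefficients in
  position meet the cut of the momentum axis; this is the origin of the two derivatives. That they
  are unbalanced is essential: a balanced one, second order in each variable, keeps its norm under
  the step, and n steps would cost a factor n. The obstacle is that the exact identity between the
  block transform and the full one holds only after truncating the matrix to one half of the
  indices, and the momentum matrix of the truncation is not explicit. So the truncation is inserted,
  the identity applied, and the truncation removed again, each time at the price O(1/N). Every step
  also uses up one dyadic level: to be cut along q = 1/2 at each of n steps, the symbol has to
  vanish near all lines q in 2^(-n) Z, and near p in Z for paths that wrap around in momentum.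
  Vanishing in neighbourhoods, and not just on the lines, passes to derivatives and keeps the symbol
  smooth after a cut.\<close>

definition fourier1 :: "(real \<Rightarrow> complex) \<Rightarrow> int \<Rightarrow> complex" where
  "fourier1 h k = integral {0..1} (\<lambda>x. h x * cis (- 2 * pi * of_int k * x))"

lemma has_vector_derivative_imp_continuous_on:
  "(\<And>x. (f has_vector_derivative f' x) (at x)) \<Longrightarrow> continuous_on A f"
  by (meson continuous_on_eq_continuous_within continuous_within_subset has_vector_derivative_continuous
      subset_UNIV)

lemma has_vector_derivative_cis_linear:
  "((\<lambda>x. cis (c * x)) has_vector_derivative (\<i> * of_real c * cis (c * x))) (at x within A)"
  unfolding has_vector_derivative_def
  by (rule derivative_eq_intros refl | simp add: scaleR_conv_of_real algebra_simps)+

lemma fourier1_integrable: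
  assumes "continuous_on UNIV h"
  shows "(\<lambda>x. h x * cis (c * x)) integrable_on {0..1}"
  by (intro integrable_continuous_real continuous_intros continuous_on_subset[OF assms]) auto

lemma fourier1_has_integral:
  assumes "continuous_on UNIV h"
  shows "((\<lambda>x. h x * cis (- 2 * pi * of_int k * x)) has_integral fourier1 h k) {0..1}"
  unfolding fourier1_def by (intro integrable_integral fourier1_integrable assms)

text \<open>Integration by parts over one period: the boundary values cancel because
  \<open>h 1 = h 0\<close> and the exponential is 1 at both ends.\<close>

lemma fourier1_deriv:
  assumes "\<And>x. (h has_vector_derivative h' x) (at x)" and "continuous_on UNIV h'" and "h 1 = h 0"
  shows "fourier1 h' k = 2 * pi * \<i> * of_int k * fourier1 h k"
proof -
  have ch: "continuous_on UNIV h"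
    using assms(1) by (rule has_vector_derivative_imp_continuous_on)
  let ?c = "- 2 * pi * of_int k"
  let ?E = "\<lambda>x. cis (?c * x)"
  have "((\<lambda>x. h x * (\<i> * of_real ?c * ?E x) + h' x * ?E x) has_integral (h 1 * ?E 1 - h 0 * ?E 0)) {0..1}"
  proof (rule fundamental_theorem_of_calculus)
    fix x :: real
    show "((\<lambda>x. h x * ?E x) has_vector_derivative h x * (\<i> * of_real ?c * ?E x) + h' x * ?E x) (at x within {0..1})"
      by (intro has_vector_derivative_mult has_vector_derivative_at_within[OF assms(1)]
          has_vector_derivative_cis_linear)
  qed simp
  moreover have "?E 1 = 1"
    by (metis cis_multiple_2pi mult.assoc mult.commute mult.right_neutral mult_minus_left mult_minus_right
        of_int_minus Ints_of_int)
  ultimately have *: "((\<lambda>x. h x * (\<i> * of_real ?c * ?E x) + h' x * ?E x) has_integral 0) {0..1}"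
    using assms(3) by simp
  have 1: "((\<lambda>x. h x * ?E x) has_integral fourier1 h k) {0..1}"
    unfolding fourier1_def by (intro integrable_integral fourier1_integrable ch)
  have 2: "((\<lambda>x. h' x * ?E x) has_integral fourier1 h' k) {0..1}"
    unfolding fourier1_def by (intro integrable_integral fourier1_integrable assms(2))
  have "((\<lambda>x. (\<i> * of_real ?c) * (h x * ?E x) + h' x * ?E x)
      has_integral ((\<i> * of_real ?c) * fourier1 h k + fourier1 h' k)) {0..1}"
    by (intro has_integral_add has_integral_mult_right 1 2)
  then have "(\<i> * of_real ?c) * fourier1 h k + fourier1 h' k = 0"
    using * by (auto simp: algebra_simps dest: has_integral_unique)
  then show ?thesis by (simp add: algebra_simps)
qed

lemma norm_fourier1_le:
  assumes "continuous_on UNIV h" "\<And>x. norm (h x) \<le> B"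
  shows "norm (fourier1 h k) \<le> B"
proof -
  have "norm (fourier1 h k) \<le> B * measure lborel (cbox (0::real) 1)"
    unfolding fourier1_def cbox_interval[symmetric]
    by (rule integrable_bound[OF _ fourier1_integrable[OF assms(1), unfolded cbox_interval[symmetric]]])
       (auto simp: norm_mult assms intro: order_trans[OF norm_ge_zero assms(2)[of 0]])
  then show ?thesis by simp
qed

text \<open>A constant has derivative 0, so the rule for derivatives makes \<open>k\<close> times
  its coefficient 0; no integral of an exponential has to be computed.\<close>

lemma fourier1_const: "fourier1 (\<lambda>x. c) k = (if k = 0 then c else 0)"
proof -
  have "fourier1 (\<lambda>x. 0) k = 2 * pi * \<i> * of_int k * fourier1 (\<lambda>x. c) k"
    by (rule fourier1_deriv) auto
  moreover have "fourier1 (\<lambda>x. 0) k = 0" "fourier1 (\<lambda>x. c) 0 = c"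
    by (simp_all add: fourier1_def)
  ultimately show ?thesis by auto
qed

section \<open>Bessel's inequality and pointwise inversion\<close>

lemma integral_cis_int:
  "integral {0..1} (\<lambda>x. cis (2 * pi * of_int k * x)) = (if k = 0 then 1 else 0)"
  using fourier1_const[of 1 "-k"] by (simp add: fourier1_def)

text \<open>The right side minus the left side is the integral of the squared modulus of
  \<open>g\<close> minus its partial Fourier sum. Continuity is the only regularity asked for,
  because the quotient in \<open>fourier_inversion\<close> provides no more.\<close>

lemma bessel:
  assumes "continuous_on UNIV g" "finite K"
  shows "(\<Sum>k\<in>K. (cmod (fourier1 g k))\<^sup>2) \<le> integral {0..1} (\<lambda>x. (cmod (g x))\<^sup>2)"
proof -
  let ?c = "fourier1 g"
  let ?e = "\<lambda>k x. cis (2 * pi * of_int k * x)"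
  let ?S = "\<lambda>x. \<Sum>k\<in>K. ?c k * ?e k x"
  have gi: "((\<lambda>x. g x * cnj (?e k x)) has_integral ?c k) {0..1}" for k
    unfolding fourier1_def using integrable_integral[OF fourier1_integrable[OF assms(1), of "- 2 * pi * of_int k"]]
    by (simp add: cis_cnj)
  have gi': "((\<lambda>x. cnj (g x) * ?e k x) has_integral cnj (?c k)) {0..1}" for k
    using gi[of k] has_integral_cnj[of "\<lambda>x. g x * cnj (?e k x)" "?c k" "{0..1}"] by (simp add: o_def)
  have ee: "((\<lambda>x. ?e k x * cnj (?e l x)) has_integral (if k = l then 1 else 0)) {0..1}" for k l
  proof -
    have "((\<lambda>x. ?e (k - l) x) has_integral (if k - l = 0 then 1 else 0)) {0..1}"
      unfolding integral_cis_int[of "k-l", symmetric]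
      by (intro integrable_integral integrable_continuous_real continuous_intros)
    then show ?thesis by (simp add: cis_cnj cis_mult algebra_simps)
  qed
  have gg: "((\<lambda>x. g x * cnj (g x)) has_integral of_real (integral {0..1} (\<lambda>x. (cmod (g x))\<^sup>2))) {0..1}"
  proof -
    have "((\<lambda>x. (cmod (g x))\<^sup>2) has_integral (integral {0..1} (\<lambda>x. (cmod (g x))\<^sup>2))) {0..1}"
      by (intro integrable_integral integrable_continuous_real continuous_intros continuous_on_subset[OF assms(1)]) auto
    then have "((\<lambda>x. complex_of_real ((cmod (g x))\<^sup>2)) has_integral of_real (integral {0..1} (\<lambda>x. (cmod (g x))\<^sup>2))) {0..1}"
      by (rule has_integral_of_real)
    then show ?thesis by (simp add: complex_norm_square[symmetric] del: of_real_power)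
  qed
  have "((\<lambda>x. g x * cnj (g x) - (\<Sum>k\<in>K. cnj (?c k) * (g x * cnj (?e k x))) - (\<Sum>k\<in>K. ?c k * (cnj (g x) * ?e k x))
      + (\<Sum>k\<in>K. \<Sum>l\<in>K. ?c k * cnj (?c l) * (?e k x * cnj (?e l x)))) has_integral
      (of_real (integral {0..1} (\<lambda>x. (cmod (g x))\<^sup>2)) - (\<Sum>k\<in>K. cnj (?c k) * ?c k) - (\<Sum>k\<in>K. ?c k * cnj (?c k))
      + (\<Sum>k\<in>K. \<Sum>l\<in>K. ?c k * cnj (?c l) * (if k = l then 1 else 0)))) {0..1}"
    by (intro has_integral_add has_integral_diff has_integral_sum has_integral_mult_right gi gi' ee gg assms(2))
  moreover have "(\<Sum>k\<in>K. \<Sum>l\<in>K. ?c k * cnj (?c l) * (if k = l then 1 else 0)) = (\<Sum>k\<in>K. ?c k * cnj (?c k))"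
    using assms(2) by (simp add: sum.delta if_distrib cong: if_cong)
  moreover have "g x * cnj (g x) - (\<Sum>k\<in>K. cnj (?c k) * (g x * cnj (?e k x))) - (\<Sum>k\<in>K. ?c k * (cnj (g x) * ?e k x))
      + (\<Sum>k\<in>K. \<Sum>l\<in>K. ?c k * cnj (?c l) * (?e k x * cnj (?e l x))) = of_real ((cmod (g x - ?S x))\<^sup>2)" for x
  proof -
    have "of_real ((cmod (g x - ?S x))\<^sup>2) = (g x - ?S x) * cnj (g x - ?S x)"
      by (simp add: complex_norm_square del: of_real_power)
    also have "\<dots> = g x * cnj (g x) - g x * cnj (?S x) - cnj (g x) * ?S x + ?S x * cnj (?S x)"
      by (simp add: algebra_simps)
    also have "g x * cnj (?S x) = (\<Sum>k\<in>K. cnj (?c k) * (g x * cnj (?e k x)))"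
      by (simp add: sum_distrib_left algebra_simps)
    also have "cnj (g x) * ?S x = (\<Sum>k\<in>K. ?c k * (cnj (g x) * ?e k x))"
      by (simp add: sum_distrib_left algebra_simps)
    also have "?S x * cnj (?S x) = (\<Sum>k\<in>K. \<Sum>l\<in>K. ?c k * cnj (?c l) * (?e k x * cnj (?e l x)))"
      by (simp add: sum_product algebra_simps)
    finally show ?thesis by simp
  qed
  ultimately have "((\<lambda>x. of_real ((cmod (g x - ?S x))\<^sup>2)) has_integral
      (of_real (integral {0..1} (\<lambda>x. (cmod (g x))\<^sup>2)) - (\<Sum>k\<in>K. cnj (?c k) * ?c k))) {0..1}"
    by simp
  then have "((\<lambda>x. Re (of_real ((cmod (g x - ?S x))\<^sup>2))) has_integral
      Re (of_real (integral {0..1} (\<lambda>x. (cmod (g x))\<^sup>2)) - (\<Sum>k\<in>K. cnj (?c k) * ?c k))) {0..1}"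
    by (rule has_integral_Re)
  then have "0 \<le> Re (of_real (integral {0..1} (\<lambda>x. (cmod (g x))\<^sup>2)) - (\<Sum>k\<in>K. cnj (?c k) * ?c k))"
    by (rule has_integral_nonneg) auto
  moreover have "Re (cnj z * z) = (cmod z)\<^sup>2" for z
    by (simp add: cmod_power2) (simp add: power2_eq_square)
  ultimately show ?thesis by (simp add: Re_sum)
qed

text \<open>By Bessel's inequality the squared coefficients along distinct frequencies are summable,
  hence tend to 0. The injection lets one statement serve both ends of the frequency axis.\<close>

lemma riemann_lebesgue:
  assumes "continuous_on UNIV g" "inj (\<phi> :: nat \<Rightarrow> int)"
  shows "(\<lambda>n. fourier1 g (\<phi> n)) \<longlonglongrightarrow> 0"
proof -
  have "summable (\<lambda>n. (cmod (fourier1 g (\<phi> n)))\<^sup>2)"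
  proof (rule bounded_imp_summable)
    fix n :: nat
    have "(\<Sum>k\<le>n. (cmod (fourier1 g (\<phi> k)))\<^sup>2) = (\<Sum>k\<in>\<phi> ` {..n}. (cmod (fourier1 g k))\<^sup>2)"
      using assms(2) by (subst sum.reindex) (auto simp: inj_on_def)
    also have "\<dots> \<le> integral {0..1} (\<lambda>x. (cmod (g x))\<^sup>2)"
      by (rule bessel[OF assms(1)]) auto
    finally show "(\<Sum>k\<le>n. (cmod (fourier1 g (\<phi> k)))\<^sup>2) \<le> integral {0..1} (\<lambda>x. (cmod (g x))\<^sup>2)" .
  qed auto
  then have "(\<lambda>n. (cmod (fourier1 g (\<phi> n)))\<^sup>2) \<longlonglongrightarrow> 0" by (rule summable_LIMSEQ_zero)
  then have "(\<lambda>n. cmod (fourier1 g (\<phi> n))) \<longlonglongrightarrow> 0"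
    using tendsto_real_sqrt by fastforce
  then show ?thesis by (simp add: tendsto_norm_zero_iff)
qed

lemma cis_2pi_eq_1_iff: "cis (2 * pi * x) = 1 \<longleftrightarrow> x \<in> \<int>"
proof
  assume "cis (2 * pi * x) = 1"
  then have "cos (2 * pi * x) = 1" by (metis cis.sel(1) one_complex.sel(1))
  then obtain m :: int where "2 * pi * x = of_int m * 2 * pi" by (auto simp: cos_one_2pi_int)
  then have "x = of_int m" by simp
  then show "x \<in> \<int>" by simp
qed (simp add: cis_multiple_2pi)

lemma periodic_int:
  assumes "\<And>x. f (x + 1) = f (x::real)"
  shows "f (x + of_int m) = f x"
proof -
  have *: "f (x + of_nat n) = f x" for n x
    by (induction n) (auto simp: assms add.assoc[symmetric] add.commute[of 1])
  show ?thesis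
    by (cases m rule: int_cases2) (use *[of x] *[of "x - of_nat n" for n] in \<open>auto\<close>, metis * diff_add_cancel uminus_add_conv_diff add.commute)
qed

lemma has_vector_derivative_tendsto:
  assumes "(f has_vector_derivative d) (at x)"
  shows "((\<lambda>y. (f y - f x) /\<^sub>R (y - x)) \<longlongrightarrow> d) (at x)"
proof -
  have "((\<lambda>y. norm (f y - f x - (y - x) *\<^sub>R d) / norm (y - x)) \<longlongrightarrow> 0) (at x)"
    using assms by (simp add: has_vector_derivative_def has_derivative_iff_norm)
  moreover have "eventually (\<lambda>y. norm (f y - f x - (y - x) *\<^sub>R d) / norm (y - x) = norm ((f y - f x) /\<^sub>R (y - x) - d)) (at x)"
    unfolding eventually_at
  proof (intro exI[of _ 1] conjI ballI impI)
    fix y assume "y \<noteq> x \<and> dist y x < 1"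
    then have "(f y - f x) /\<^sub>R (y - x) - d = (f y - f x - (y - x) *\<^sub>R d) /\<^sub>R (y - x)"
      by (simp add: scaleR_diff_right)
    then show "norm (f y - f x - (y - x) *\<^sub>R d) / norm (y - x) = norm ((f y - f x) /\<^sub>R (y - x) - d)"
      by (simp add: divide_inverse_commute)
  qed simp
  ultimately have "((\<lambda>y. norm ((f y - f x) /\<^sub>R (y - x) - d)) \<longlongrightarrow> 0) (at x)"
    by (rule Lim_transform_eventually)
  then show ?thesis
    by (simp add: tendsto_norm_zero_iff LIM_zero_iff)
qed

text \<open>Chernoff's argument: writing \<open>f(x) - f(x\<^sub>0) = (e\<^bsup>2\<pi>i(x - x\<^sub>0)\<^esup> - 1) g(x)\<close> with
  \<open>g\<close> continuous makes the symmetric partial sums telescope.\<close>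

lemma fourier_inversion:
  assumes f: "\<And>x. (f has_vector_derivative f' x) (at x)" and f': "continuous_on UNIV f'"
    and per: "\<And>x. f (x + 1) = f x"
  shows "(\<lambda>M. \<Sum>k\<in>{- int M..int M}. fourier1 f k * cis (2 * pi * of_int k * x0)) \<longlonglongrightarrow> f x0"
proof -
  have cf: "continuous_on UNIV f"
    using assms(1) by (rule has_vector_derivative_imp_continuous_on)
  define w where "w = (\<lambda>x. cis (2 * pi * (x - x0)) - 1)"
  \<comment> \<open>At the zeros of \<open>w\<close> the quotient is continued by its limit, the
    quotient of the derivatives \<open>f' x\<close> and \<open>2 * pi * \<i>\<close>.\<close>
  define g where "g x = (if x - x0 \<in> \<int> then f' x / (2 * pi * \<i>) else (f x - f x0) / w x)" for x
  have w0: "w x = 0 \<longleftrightarrow> x - x0 \<in> \<int>" for x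
    unfolding w_def using cis_2pi_eq_1_iff[of "x - x0"] by auto
  have fx0: "f x = f x0" if "x - x0 \<in> \<int>" for x
    using that periodic_int[of f x0, OF per] by (auto elim!: Ints_cases simp: algebra_simps)
  have eq: "f x = f x0 + g x * w x" for x
    using fx0[of x] w0[of x] by (auto simp: g_def)
  have wd: "(w has_vector_derivative (2 * pi * \<i> * cis (2 * pi * (x - x0)))) (at x)" for x
    unfolding w_def has_vector_derivative_def
    by (rule derivative_eq_intros refl | simp add: scaleR_conv_of_real algebra_simps)+
  have cw: "isCont w x" for x
    using wd has_vector_derivative_continuous by blast
  have "isCont g x1" for x1
  proof (cases "x1 - x0 \<in> \<int>")
    case False
    have op: "open {x. w x \<noteq> 0}"
      by (intro open_Collect_neq continuous_intros) (simp_all add: continuous_on_eq_continuous_at cw)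
    have "eventually (\<lambda>x. g x = (f x - f x0) / w x) (nhds x1)"
      using op False w0 unfolding eventually_nhds by (intro exI[of _ "{x. w x \<noteq> 0}"]) (auto simp: g_def)
    moreover have "isCont (\<lambda>x. (f x - f x0) / w x) x1"
      using False w0 cf by (intro continuous_intros cw) (auto simp: continuous_on_eq_continuous_at)
    ultimately show ?thesis by (simp add: isCont_cong)
  next
    case True
    have cis1: "cis (2 * pi * (x1 - x0)) = 1" using True cis_2pi_eq_1_iff by blast
    have wx1: "w x1 = 0" using True w0 by blast
    have l1: "((\<lambda>x. (f x - f x1) /\<^sub>R (x - x1)) \<longlongrightarrow> f' x1) (at x1)"
      by (rule has_vector_derivative_tendsto[OF f])
    have l2: "((\<lambda>x. (w x - w x1) /\<^sub>R (x - x1)) \<longlongrightarrow> 2 * pi * \<i>) (at x1)"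
      using has_vector_derivative_tendsto[OF wd[of x1]] cis1 by simp
    have l3: "((\<lambda>x. ((f x - f x1) /\<^sub>R (x - x1)) / ((w x - w x1) /\<^sub>R (x - x1))) \<longlongrightarrow> f' x1 / (2 * pi * \<i>)) (at x1)"
      by (intro tendsto_divide l1 l2) auto
    have ev: "eventually (\<lambda>x. x \<in> ball x1 1 - {x1}) (at x1)"
      by (rule eventually_at_in_open) auto
    have "eventually (\<lambda>x. ((f x - f x1) /\<^sub>R (x - x1)) / ((w x - w x1) /\<^sub>R (x - x1)) = g x) (at x1)"
      using ev
    proof eventually_elim
      case (elim x)
      have "x - x0 \<notin> \<int>"
      proof
        assume "x - x0 \<in> \<int>"
        then have "x - x1 \<in> \<int>" using True by (metis Ints_diff diff_diff_eq2 diff_add_cancel)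
        then obtain z :: int where "x - x1 = of_int z" by (auto elim: Ints_cases)
        moreover from this have "\<bar>of_int z :: real\<bar> < 1" using elim by (auto simp: dist_real_def)
        ultimately show False using elim by (auto simp: abs_if split: if_splits)
      qed
      then show ?case using elim wx1 fx0[OF True]
        by (simp add: g_def scaleR_conv_of_real divide_simps)
    qed
    from Lim_transform_eventually[OF l3 this] have "(g \<longlongrightarrow> f' x1 / (2 * pi * \<i>)) (at x1)" .
    moreover have "g x1 = f' x1 / (2 * pi * \<i>)" using True by (simp add: g_def)
    ultimately show ?thesis by (simp only: isCont_def)
  qed
  then have cg: "continuous_on UNIV g" by (simp add: continuous_on_eq_continuous_at)
  define G where "G k = cis (2 * pi * of_int k * x0) * fourier1 g k" for k :: int
  \<comment> \<open>Multiplication by e^(2 pi i (x - x0)) shifts the frequency by one, so the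
    product of \<open>g\<close> and \<open>w\<close> contributes a difference of neighbouring values
    of \<open>G\<close>; the constant \<open>f x0\<close> contributes at \<open>k = 0\<close>
    alone.\<close>
  have coef: "fourier1 f k * cis (2 * pi * of_int k * x0) = (if k = 0 then f x0 else 0) + (G (k - 1) - G k)" for k
  proof -
    let ?E = "\<lambda>x. cis (- 2 * pi * of_int k * x)"
    have *: "f x * ?E x = f x0 * ?E x + (cis (- 2 * pi * x0) * (g x * cis (- 2 * pi * of_int (k - 1) * x)) - g x * ?E x)" for x
    proof -
      have "cis (2 * pi * (x - x0)) * ?E x = cis (- 2 * pi * x0) * cis (- 2 * pi * of_int (k - 1) * x)"
        by (simp add: cis_mult algebra_simps)
      then show ?thesis by (subst eq) (simp add: w_def algebra_simps)
    qed
    have fk: "fourier1 f k = fourier1 (\<lambda>x. f x0) k + (cis (- 2 * pi * x0) * fourier1 g (k - 1) - fourier1 g k)"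
    proof (rule has_integral_unique)
      show "((\<lambda>x. f x * ?E x) has_integral fourier1 f k) {0..1}"
        by (rule fourier1_has_integral[OF cf])
      show "((\<lambda>x. f x * ?E x) has_integral fourier1 (\<lambda>x. f x0) k
          + (cis (- 2 * pi * x0) * fourier1 g (k - 1) - fourier1 g k)) {0..1}"
        unfolding * by (intro has_integral_add has_integral_diff has_integral_mult_right
            fourier1_has_integral cg continuous_on_const)
    qed
    have "fourier1 f k * cis (2 * pi * of_int k * x0) = (if k = 0 then f x0 else 0)
        + (cis (- 2 * pi * x0) * cis (2 * pi * of_int k * x0) * fourier1 g (k - 1) - G k)"
      unfolding fk fourier1_const G_def by (cases "k = 0") (simp_all add: algebra_simps)
    also have "cis (- 2 * pi * x0) * cis (2 * pi * of_int k * x0) = cis (2 * pi * of_int (k - 1) * x0)"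
      by (simp add: cis_mult algebra_simps)
    finally show ?thesis by (simp add: G_def)
  qed
  have tel: "(\<Sum>k\<in>{- int M..int M}. (if k = 0 then f x0 else 0) + (G (k - 1) - G k)) = f x0 + G (- 1 - int M) - G (int M)" for M
  proof (induction M)
    case (Suc M)
    have "{- int (Suc M)..int (Suc M)} = insert (- int (Suc M)) (insert (int (Suc M)) {- int M..int M})"
      by auto
    then show ?case using Suc by (simp add: algebra_simps)
  qed simp
  have "(\<lambda>M. f x0 + G (- 1 - int M) - G (int M)) \<longlonglongrightarrow> f x0 + 0 - 0"
  proof (intro tendsto_intros)
    have "(\<lambda>n. G (\<phi> n)) \<longlonglongrightarrow> 0" if "inj \<phi>" for \<phi> :: "nat \<Rightarrow> int"
    proof (rule Lim_null_comparison)
      show "eventually (\<lambda>n. norm (G (\<phi> n)) \<le> norm (fourier1 g (\<phi> n))) sequentially"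
        by (simp add: G_def norm_mult)
      show "(\<lambda>n. norm (fourier1 g (\<phi> n))) \<longlonglongrightarrow> 0"
        using riemann_lebesgue[OF cg that] by (rule tendsto_norm_zero)
    qed
    then show "(\<lambda>M. G (- 1 - int M)) \<longlonglongrightarrow> 0" "(\<lambda>M. G (int M)) \<longlonglongrightarrow> 0"
      by (simp_all add: inj_def)
  qed
  then show ?thesis unfolding coef tel by simp
qed

section \<open>Smooth functions on the torus and their Fourier coefficients\<close>

lemma torus_smooth_continuous: "torus_smooth f \<Longrightarrow> continuous_on UNIV f"
  unfolding torus_smooth_def using C_class.simps(1) by blast

lemma torus_smooth_periodic:
  "torus_smooth f \<Longrightarrow> f (q + of_int m, p + of_int n) = f (q, p)"
  unfolding torus_smooth_def torus_periodic_def by blast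

lemma torus_smooth_has_q_derivative:
  assumes "torus_smooth f"
  shows "((\<lambda>t. f (t, p)) has_vector_derivative partial_q f (q, p)) (at q)"
proof -
  have "C_class (Suc 0) f" using assms unfolding torus_smooth_def by blast
  then show ?thesis by (auto simp: partial_q_def vector_derivative_works[symmetric])
qed

lemma torus_smooth_has_p_derivative:
  assumes "torus_smooth f"
  shows "((\<lambda>t. f (q, t)) has_vector_derivative partial_p f (q, p)) (at p)"
proof -
  have "C_class (Suc 0) f" using assms unfolding torus_smooth_def by blast
  then show ?thesis by (auto simp: partial_p_def vector_derivative_works[symmetric])
qed

lemma has_vector_derivative_shift:
  assumes "(f has_vector_derivative D) (at (x + c))"
  shows "((\<lambda>t. f (t + c :: real)) has_vector_derivative D) (at x)"
proof -
  have "((\<lambda>t. t + c) has_vector_derivative 1) (at x)"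
    by (auto intro!: derivative_eq_intros)
  from vector_diff_chain_at[OF this assms] show ?thesis by (simp add: o_def)
qed

lemma torus_smooth_partial_q:
  assumes "torus_smooth f" shows "torus_smooth (partial_q f)"
  unfolding torus_smooth_def torus_periodic_def
proof (intro conjI allI)
  fix k
  have "C_class (Suc k) f" using assms unfolding torus_smooth_def by blast
  then show "C_class k (partial_q f)" by simp
next
  fix q p :: real and m n :: int
  have "((\<lambda>t. f (t + of_int m, p + of_int n)) has_vector_derivative
      partial_q f (q + of_int m, p + of_int n)) (at q)"
    by (rule has_vector_derivative_shift) (rule torus_smooth_has_q_derivative[OF assms])
  then have "((\<lambda>t. f (t, p)) has_vector_derivative partial_q f (q + of_int m, p + of_int n)) (at q)"
    by (simp add: torus_smooth_periodic[OF assms])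
  then show "partial_q f (q + of_int m, p + of_int n) = partial_q f (q, p)"
    using torus_smooth_has_q_derivative[OF assms] vector_derivative_unique_at by blast
qed

lemma torus_smooth_partial_p:
  assumes "torus_smooth f" shows "torus_smooth (partial_p f)"
  unfolding torus_smooth_def torus_periodic_def
proof (intro conjI allI)
  fix k
  have "C_class (Suc k) f" using assms unfolding torus_smooth_def by blast
  then show "C_class k (partial_p f)" by simp
next
  fix q p :: real and m n :: int
  have "((\<lambda>t. f (q + of_int m, t + of_int n)) has_vector_derivative
      partial_p f (q + of_int m, p + of_int n)) (at p)"
    by (rule has_vector_derivative_shift) (rule torus_smooth_has_p_derivative[OF assms])
  then have "((\<lambda>t. f (q, t)) has_vector_derivative partial_p f (q + of_int m, p + of_int n)) (at p)"
    by (simp add: torus_smooth_periodic[OF assms])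
  then show "partial_p f (q + of_int m, p + of_int n) = partial_p f (q, p)"
    using torus_smooth_has_p_derivative[OF assms] vector_derivative_unique_at by blast
qed

lemma torus_smooth_partials:
  "torus_smooth f \<Longrightarrow> torus_smooth ((partial_q ^^ i) ((partial_p ^^ j) f))"
  by (induction i; induction j) (simp_all add: torus_smooth_partial_q torus_smooth_partial_p)

lemma torus_periodic_eq_frac:
  assumes "torus_periodic f" shows "f (q, p) = f (frac q, frac p)"
proof -
  have "f (frac q + of_int \<lfloor>q\<rfloor>, frac p + of_int \<lfloor>p\<rfloor>) = f (frac q, frac p)"
    using assms unfolding torus_periodic_def by blast
  then show ?thesis by (simp add: frac_def)
qed

lemma torus_smooth_bdd:
  assumes "torus_smooth f" shows "bdd_above (range (\<lambda>x. cmod (f x)))"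
proof -
  have "compact ((\<lambda>x. cmod (f x)) ` (cbox (0,0) (1,1)))"
  proof (rule compact_continuous_image)
    show "continuous_on (cbox (0,0) (1,1)) (\<lambda>x. cmod (f x))"
      using torus_smooth_continuous[OF assms] by (intro continuous_on_norm) (auto elim: continuous_on_subset)
  qed (rule compact_cbox)
  then have "bdd_above ((\<lambda>x. cmod (f x)) ` (cbox (0,0) (1,1)))"
    by (intro bounded_imp_bdd_above compact_imp_bounded)
  moreover have "range (\<lambda>x. cmod (f x)) \<subseteq> (\<lambda>x. cmod (f x)) ` (cbox (0,0) (1,1))"
  proof clarify
    fix q p
    have "f (q, p) = f (frac q, frac p)"
      using assms torus_periodic_eq_frac unfolding torus_smooth_def by blast
    moreover have "(frac q, frac p) \<in> cbox (0,0) (1,1)"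
      by (simp add: cbox_Pair_eq frac_lt_1 less_imp_le)
    ultimately show "cmod (f (q, p)) \<in> (\<lambda>x. cmod (f x)) ` (cbox (0,0) (1,1))"
      by (intro image_eqI[of _ _ "(frac q, frac p)"]) simp_all
  qed
  ultimately show ?thesis by (rule bdd_above_mono)
qed

lemma norm_le_C0_norm: "torus_smooth f \<Longrightarrow> cmod (f x) \<le> C0_norm f"
  unfolding C0_norm_def by (intro cSUP_upper torus_smooth_bdd) auto

lemma C0_norm_nonneg: "torus_smooth f \<Longrightarrow> 0 \<le> C0_norm f"
  using norm_le_C0_norm[of f undefined] norm_ge_zero order_trans by blast

text \<open>A single mixed derivative is measured, and not a full \<open>C_norm\<close>, because the
  baker's map multiplies its norm by an exact power of 2. The pairs that matter are 1 3 and 3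
  1.\<close>

definition mixed_norm :: "nat \<Rightarrow> nat \<Rightarrow> plane_fun \<Rightarrow> real" where
  "mixed_norm i j f = C0_norm ((partial_q ^^ i) ((partial_p ^^ j) f))"

lemma mixed_norm_nonneg: "torus_smooth f \<Longrightarrow> 0 \<le> mixed_norm i j f"
  by (simp add: mixed_norm_def C0_norm_nonneg torus_smooth_partials)

text \<open>The coefficient is taken at \<open>- k\<close> since the expansion of a symbol carries
  the exponential e^(- 2 pi i p k1).\<close>

definition p_coeff :: "plane_fun \<Rightarrow> int \<Rightarrow> real \<Rightarrow> complex" where
  "p_coeff f k q = fourier1 (\<lambda>p. f (q, p)) (- k)"

definition q_coeff :: "plane_fun \<Rightarrow> int \<Rightarrow> real \<Rightarrow> complex" where
  "q_coeff f k p = fourier1 (\<lambda>q. f (q, p)) k"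

section \<open>Coefficients in one variable: decay and vanishing\<close>

lemma continuous_on_section_q: "continuous_on UNIV f \<Longrightarrow> continuous_on A (\<lambda>p. f (q, p))"
  by (rule continuous_on_compose2[of UNIV f]) (auto intro: continuous_on_Pair continuous_on_const continuous_on_id)

lemma continuous_on_section_p: "continuous_on UNIV f \<Longrightarrow> continuous_on A (\<lambda>q. f (q, p))"
  by (rule continuous_on_compose2[of UNIV f]) (auto intro: continuous_on_Pair continuous_on_const continuous_on_id)

lemma p_coeff_partial_p:
  assumes "torus_smooth f"
  shows "p_coeff (partial_p f) k q = - 2 * pi * \<i> * of_int k * p_coeff f k q"
  unfolding p_coeff_def
  using fourier1_deriv[of "\<lambda>p. f (q, p)" "\<lambda>p. partial_p f (q, p)" "- k",
      OF torus_smooth_has_p_derivative[OF assms]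
         continuous_on_section_q[OF torus_smooth_continuous[OF torus_smooth_partial_p[OF assms]]]]
    torus_smooth_periodic[OF assms, of q 0 0 1]
  by simp

lemma q_coeff_partial_q:
  assumes "torus_smooth f"
  shows "q_coeff (partial_q f) k p = 2 * pi * \<i> * of_int k * q_coeff f k p"
  unfolding q_coeff_def
  using fourier1_deriv[of "\<lambda>q. f (q, p)" "\<lambda>q. partial_q f (q, p)" k,
      OF torus_smooth_has_q_derivative[OF assms]
         continuous_on_section_p[OF torus_smooth_continuous[OF torus_smooth_partial_q[OF assms]]]]
    torus_smooth_periodic[OF assms, of 0 1 p 0]
  by simp

lemma norm_p_coeff_le: "torus_smooth f \<Longrightarrow> cmod (p_coeff f k q) \<le> C0_norm f"
  unfolding p_coeff_def
  by (intro norm_fourier1_le continuous_on_section_q torus_smooth_continuous norm_le_C0_norm)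

lemma norm_q_coeff_le: "torus_smooth f \<Longrightarrow> cmod (q_coeff f k p) \<le> C0_norm f"
  unfolding q_coeff_def
  by (intro norm_fourier1_le continuous_on_section_p torus_smooth_continuous norm_le_C0_norm)

lemma norm_p_coeff_iterate:
  "torus_smooth f \<Longrightarrow>
    cmod (p_coeff ((partial_p ^^ n) f) k q) = (2 * pi * \<bar>of_int k\<bar>) ^ n * cmod (p_coeff f k q)"
proof (induction n)
  case (Suc n)
  then show ?case
    using torus_smooth_partials[of f 0 n]
    by (simp add: p_coeff_partial_p norm_mult)
qed simp

lemma norm_q_coeff_iterate:
  "torus_smooth f \<Longrightarrow>
    cmod (q_coeff ((partial_q ^^ n) f) k p) = (2 * pi * \<bar>of_int k\<bar>) ^ n * cmod (q_coeff f k p)"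
proof (induction n)
  case (Suc n)
  then show ?case
    using torus_smooth_partials[of f n 0]
    by (simp add: q_coeff_partial_q norm_mult)
qed simp

text \<open>Differentiation under the integral sign. It gives the derivative of a coefficient across
  the line on which the symbol vanishes.\<close>

lemma fourier1_leibniz:
  assumes "\<And>x y. ((\<lambda>x. u x y) has_vector_derivative u' x y) (at x)"
    and "\<And>x. continuous_on UNIV (u x)" and "continuous_on UNIV (\<lambda>(x, y). u' x y)"
  shows "((\<lambda>x. fourier1 (u x) k) has_vector_derivative fourier1 (u' x) k) (at x)"
proof -
  let ?E = "\<lambda>y. cis (- 2 * pi * of_int k * y)"
  have "((\<lambda>x. integral (cbox 0 1) (\<lambda>y. u x y * ?E y)) has_vector_derivative
      integral (cbox 0 1) (\<lambda>y. u' x y * ?E y)) (at x within UNIV)"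
  proof (rule leibniz_rule_vector_derivative)
    fix x y :: real
    show "((\<lambda>x. u x y * ?E y) has_vector_derivative u' x y * ?E y) (at x within UNIV)"
      using assms(1) by (intro has_vector_derivative_mult_left) auto
    show "(\<lambda>y. u x y * ?E y) integrable_on cbox 0 1"
      using fourier1_integrable[OF assms(2)[of x], of "- 2 * pi * of_int k"] by simp
  next
    have "continuous_on UNIV (\<lambda>z. (case z of (x, y) \<Rightarrow> u' x y) * ?E (snd z))"
      by (intro continuous_intros assms(3))
    then show "continuous_on (UNIV \<times> cbox 0 1) (\<lambda>(x, y). u' x y * ?E y)"
      by (auto simp: case_prod_beta' elim: continuous_on_subset)
  qed auto
  then show ?thesis by (simp add: fourier1_def)
qed

lemma p_coeff_has_derivative:
  assumes "torus_smooth f"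
  shows "((\<lambda>q. p_coeff f k q) has_vector_derivative p_coeff (partial_q f) k q) (at q)"
  unfolding p_coeff_def
proof (rule fourier1_leibniz)
  show "continuous_on UNIV (\<lambda>(x, y). partial_q f (x, y))"
    using torus_smooth_continuous[OF torus_smooth_partial_q[OF assms]] by simp
  show "continuous_on UNIV (\<lambda>p. f (x, p))" for x
    by (rule continuous_on_section_q[OF torus_smooth_continuous[OF assms]])
qed (rule torus_smooth_has_q_derivative[OF assms])

lemma q_coeff_has_derivative:
  assumes "torus_smooth f"
  shows "((\<lambda>p. q_coeff f k p) has_vector_derivative q_coeff (partial_p f) k p) (at p)"
  unfolding q_coeff_def
proof (rule fourier1_leibniz)
  have "continuous_on UNIV (\<lambda>z. partial_p f (snd z, fst z))"
  proof (rule continuous_on_compose2[OF torus_smooth_continuous[OF torus_smooth_partial_p[OF assms]]])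
    show "continuous_on UNIV (\<lambda>z :: real \<times> real. (snd z, fst z))"
      by (intro continuous_on_Pair continuous_on_fst continuous_on_snd continuous_on_id)
  qed simp
  then show "continuous_on UNIV (\<lambda>(x, y). partial_p f (y, x))" by (simp add: case_prod_beta')
  show "continuous_on UNIV (\<lambda>q. f (q, p))" for p
    by (rule continuous_on_section_p[OF torus_smooth_continuous[OF assms]])
qed (rule torus_smooth_has_p_derivative[OF assms])

lemma norm_diff_le_deriv_bound:
  fixes h :: "real \<Rightarrow> complex"
  assumes "\<And>x. (h has_vector_derivative h' x) (at x)" "\<And>x. norm (h' x) \<le> B"
  shows "norm (h x - h y) \<le> B * \<bar>x - y\<bar>"
proof -
  have "norm (h x - h y) \<le> B * norm (x - y)"
  proof (rule differentiable_bound[of UNIV h "\<lambda>x t. t *\<^sub>R h' x"])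
    fix z show "(h has_derivative (\<lambda>t. t *\<^sub>R h' z)) (at z within UNIV)"
      using assms(1)[of z] by (simp add: has_vector_derivative_def)
    show "onorm (\<lambda>t. t *\<^sub>R h' z) \<le> B"
    proof (rule onorm_bound)
      show "0 \<le> B" using assms(2)[of z] norm_ge_zero order_trans by blast
      show "norm (t *\<^sub>R h' z) \<le> B * norm t" for t
        using mult_left_mono[OF assms(2)[of z] abs_ge_zero[of t]] by (simp add: mult.commute)
    qed
  qed auto
  then show ?thesis by simp
qed

lemma twopi_cubed_ge_1: "1 \<le> (2 * pi) ^ 3" and twopi_sq_ge_1: "1 \<le> (2 * pi) ^ 2"
proof -
  have "1 \<le> 2 * pi" using pi_gt3 by linarith
  then show "1 \<le> (2 * pi) ^ 3" "1 \<le> (2 * pi) ^ 2" by (simp_all only: one_le_power)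
qed

text \<open>The factor |k|^3 from integrations by parts and the distance at most |k| / (2 N) leave 1
  / (N k^2); the powers of 2 pi and the factor 1/2 are given away.\<close>

lemma vanishing_bound_aux:
  fixes k :: int and N :: nat and z :: complex
  assumes *: "(2 * pi * \<bar>of_int k\<bar>) ^ 3 * cmod z \<le> B * d" and d: "d \<le> \<bar>of_int k\<bar> / (2 * real N)"
    and "N > 0" and B: "0 \<le> B" and "k \<noteq> 0"
  shows "cmod z \<le> B / real N * (1 / (of_int k)\<^sup>2)"
proof -
  define x where "x = \<bar>real_of_int k\<bar>"
  have x: "x > 0" using assms by (simp add: x_def)
  have "x ^ 3 * cmod z \<le> (2 * pi) ^ 3 * x ^ 3 * cmod z"
    using mult_right_mono[OF twopi_cubed_ge_1, of "x ^ 3 * cmod z"] x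
    by (simp add: mult.assoc)
  also have "\<dots> \<le> B * (x / (2 * real N))"
    using * mult_left_mono[OF d B] by (simp add: x_def power_mult_distrib)
  also have "\<dots> \<le> B * (x / real N)"
    using x B assms(3) by (intro mult_left_mono) (auto simp: field_simps)
  finally have "x * (x\<^sup>2 * cmod z) \<le> x * (B / real N)"
    by (simp add: power3_eq_cube power2_eq_square algebra_simps)
  then have "x\<^sup>2 * cmod z \<le> B / real N" using x by (rule mult_left_le_imp_le)
  moreover have "0 < x\<^sup>2" using x by simp
  ultimately have "cmod z \<le> B / real N / x\<^sup>2" by (simp only: pos_le_divide_eq mult.commute)
  then show ?thesis by (simp add: x_def)
qed

text \<open>Three integrations by parts, and the vanishing at a point at distance \<open>O(\<bar>k\<bar> / N)\<close>.\<close>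

lemma norm_p_coeff_vanishing:
  assumes f: "torus_smooth f" and N: "N > (0::nat)" and z: "\<And>p. f (q0, p) = 0"
    and d: "\<bar>q - q0\<bar> \<le> \<bar>of_int k\<bar> / (2 * real N)"
  shows "cmod (p_coeff f k q) \<le> mixed_norm 1 3 f / real N * (1 / (of_int k)\<^sup>2)"
proof (cases "k = 0")
  case True
  \<comment> \<open>For \<open>k = 0\<close> the right side is 0, as \<open>1 / 0\<close> is 0, and
    \<open>d\<close> forces \<open>q = q0\<close>, where the symbol vanishes.\<close>
  then show ?thesis using d z by (simp add: p_coeff_def fourier1_def)
next
  case False
  define g where "g = (partial_p ^^ 3) f"
  have g: "torus_smooth g" unfolding g_def using torus_smooth_partials[OF f, of 0 3] by simp
  have "p_coeff f k q0 = 0" using z by (simp add: p_coeff_def fourier1_def)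
  then have "p_coeff g k q0 = 0"
    using norm_p_coeff_iterate[OF f, of 3 k q0] by (simp add: g_def)
  moreover have "norm (p_coeff g k q - p_coeff g k q0) \<le> C0_norm (partial_q g) * \<bar>q - q0\<bar>"
    by (rule norm_diff_le_deriv_bound[OF p_coeff_has_derivative[OF g]])
       (intro norm_p_coeff_le torus_smooth_partial_q g)
  ultimately have "(2 * pi * \<bar>of_int k\<bar>) ^ 3 * cmod (p_coeff f k q) \<le> C0_norm (partial_q g) * \<bar>q - q0\<bar>"
    using norm_p_coeff_iterate[OF f, of 3 k q, folded g_def] by (simp only: diff_zero)
  from vanishing_bound_aux[OF this d N _ False] show ?thesis
    using C0_norm_nonneg[OF torus_smooth_partial_q[OF g]] by (simp add: mixed_norm_def g_def)
qed

text \<open>Here the derivative across the line is taken first and the integrations by parts are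
  applied to \<open>partial_p f\<close>, the reverse of the order in
  \<open>norm_p_coeff_vanishing\<close>. In this way \<open>mixed_norm 3 1\<close> appears with its
  own order of differentiation, and partial derivatives never have to be commuted.\<close>

lemma norm_q_coeff_vanishing:
  assumes f: "torus_smooth f" and N: "N > (0::nat)" and z: "\<And>q. f (q, p0) = 0"
    and d: "\<bar>p - p0\<bar> \<le> \<bar>of_int k\<bar> / (2 * real N)"
  shows "cmod (q_coeff f k p) \<le> mixed_norm 3 1 f / real N * (1 / (of_int k)\<^sup>2)"
proof (cases "k = 0")
  case True
  then show ?thesis using d z by (simp add: q_coeff_def fourier1_def)
next
  case False
  let ?g = "partial_p f"
  define c where "c = (2 * pi * \<bar>of_int k\<bar>) ^ 3"
  define B where "B = C0_norm ((partial_q ^^ 3) ?g)"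
  have g: "torus_smooth ?g" using f by (rule torus_smooth_partial_p)
  have g3: "torus_smooth ((partial_q ^^ 3) ?g)" using torus_smooth_partials[OF g, of 3 0] by simp
  have c: "c > 0" using False by (simp add: c_def)
  have "q_coeff f k p0 = 0" using z by (simp add: q_coeff_def fourier1_def)
  moreover have "norm (q_coeff f k p - q_coeff f k p0) \<le> (B / c) * \<bar>p - p0\<bar>"
  proof (rule norm_diff_le_deriv_bound[OF q_coeff_has_derivative[OF f]])
    fix p
    have "c * cmod (q_coeff ?g k p) \<le> B"
      using norm_q_coeff_iterate[OF g, of 3 k p] norm_q_coeff_le[OF g3, of k p]
      by (simp only: c_def B_def)
    then show "cmod (q_coeff ?g k p) \<le> B / c"
      using c by (simp add: pos_le_divide_eq mult.commute)
  qed
  ultimately have "cmod (q_coeff f k p) \<le> B * \<bar>p - p0\<bar> / c" by simp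
  then have "c * cmod (q_coeff f k p) \<le> B * \<bar>p - p0\<bar>"
    using c by (simp add: pos_le_divide_eq mult.commute)
  from vanishing_bound_aux[OF this[unfolded c_def] d N _ False] show ?thesis
    using C0_norm_nonneg[OF g3] by (simp add: mixed_norm_def B_def)
qed

section \<open>Coefficients in both variables as iterated integrals\<close>

lemma continuous_on_plane_wave:
  assumes "torus_smooth f"
  shows "continuous_on A (\<lambda>z. f z * cis (- 2 * pi * (fst z * of_int k2 - snd z * of_int k1)))"
proof (rule continuous_on_mult)
  show "continuous_on A (\<lambda>z :: real \<times> real. cis (- 2 * pi * (fst z * of_int k2 - snd z * of_int k1)))"
    by (intro continuous_on_cis continuous_on_mult continuous_on_diff continuous_on_fst
        continuous_on_snd continuous_on_id continuous_on_const)
qed (rule continuous_on_subset[OF torus_smooth_continuous[OF assms]], simp)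

text \<open>The iterated integral with the momentum variable inside. Together with the opposite
  order in \<open>fourier_coeff_q\<close> it gives decay in either index and the two ways of summing
  the double series.\<close>

lemma fourier_coeff_p: 
  assumes "torus_smooth f"
  shows "fourier_coeff f (k1, k2) = fourier1 (p_coeff f k1) k2"
proof -
  let ?g = "\<lambda>z. f z * cis (- 2 * pi * (fst z * of_int k2 - snd z * of_int k1))"
  have c: "continuous_on (cbox (0, 0) (1, 1)) ?g"
    by (rule continuous_on_plane_wave[OF assms])
  have "fourier_coeff f (k1, k2) = integral (cbox (0, 0) (1, 1)) ?g"
    by (simp add: fourier_coeff_def case_prod_beta')
  also have "\<dots> = integral (cbox 0 1) (\<lambda>q. integral (cbox 0 1) (\<lambda>p. ?g (q, p)))"
    by (rule integral_prod_continuous[OF c])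
  also have "\<dots> = integral (cbox 0 1) (\<lambda>q. p_coeff f k1 q * cis (- 2 * pi * of_int k2 * q))"
  proof (intro integral_cong)
    fix q :: real
    have "?g (q, p) = f (q, p) * cis (- 2 * pi * of_int (- k1) * p) * cis (- 2 * pi * of_int k2 * q)" for p
      by (simp add: mult.assoc cis_mult algebra_simps)
    then show "integral (cbox 0 1) (\<lambda>p. ?g (q, p)) = p_coeff f k1 q * cis (- 2 * pi * of_int k2 * q)"
      unfolding p_coeff_def fourier1_def by (simp only: integral_mult_left cbox_interval)
  qed
  finally show ?thesis by (simp add: fourier1_def)
qed

lemma fourier_coeff_q: 
  assumes "torus_smooth f"
  shows "fourier_coeff f (k1, k2) = fourier1 (q_coeff f k2) (- k1)"
proof -
  let ?g = "\<lambda>z. f z * cis (- 2 * pi * (fst z * of_int k2 - snd z * of_int k1))"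
  have c: "continuous_on (cbox (0, 0) (1, 1)) ?g"
    by (rule continuous_on_plane_wave[OF assms])
  then have c': "continuous_on (cbox (0, 0) (1, 1)) (\<lambda>(q, p). ?g (q, p))" by (simp add: case_prod_beta')
  have "fourier_coeff f (k1, k2) = integral (cbox (0, 0) (1, 1)) ?g"
    by (simp add: fourier_coeff_def case_prod_beta')
  also have "\<dots> = integral (cbox 0 1) (\<lambda>q. integral (cbox 0 1) (\<lambda>p. ?g (q, p)))"
    by (rule integral_prod_continuous[OF c])
  also have "\<dots> = integral (cbox 0 1) (\<lambda>p. integral (cbox 0 1) (\<lambda>q. ?g (q, p)))"
    by (rule integral_swap_continuous[OF c'])
  also have "\<dots> = integral (cbox 0 1) (\<lambda>p. q_coeff f k2 p * cis (- 2 * pi * of_int (- k1) * p))"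
  proof (intro integral_cong)
    fix p :: real
    have "?g (q, p) = f (q, p) * cis (- 2 * pi * of_int k2 * q) * cis (- 2 * pi * of_int (- k1) * p)" for q
      by (simp add: mult.assoc cis_mult algebra_simps)
    then show "integral (cbox 0 1) (\<lambda>q. ?g (q, p)) = q_coeff f k2 p * cis (- 2 * pi * of_int (- k1) * p)"
      unfolding q_coeff_def fourier1_def by (simp only: integral_mult_left cbox_interval)
  qed
  finally show ?thesis by (simp add: fourier1_def)
qed

lemma fourier1_cmult: "fourier1 (\<lambda>q. c * h q) k = c * fourier1 h k"
  by (simp add: fourier1_def mult.assoc)

lemma fourier_coeff_partial_p:
  assumes "torus_smooth f"
  shows "cmod (fourier_coeff (partial_p f) (k1, k2)) = 2 * pi * \<bar>of_int k1\<bar> * cmod (fourier_coeff f (k1, k2))"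
  unfolding fourier_coeff_p[OF assms] fourier_coeff_p[OF torus_smooth_partial_p[OF assms]]
    p_coeff_partial_p[OF assms, abs_def] fourier1_cmult
  by (simp add: norm_mult)

lemma fourier_coeff_partial_q:
  assumes "torus_smooth f"
  shows "cmod (fourier_coeff (partial_q f) (k1, k2)) = 2 * pi * \<bar>of_int k2\<bar> * cmod (fourier_coeff f (k1, k2))"
  unfolding fourier_coeff_q[OF assms] fourier_coeff_q[OF torus_smooth_partial_q[OF assms]]
    q_coeff_partial_q[OF assms, abs_def] fourier1_cmult
  by (simp add: norm_mult)

lemma norm_fourier_coeff_le:
  assumes "torus_smooth f"
  shows "cmod (fourier_coeff f (k1, k2)) \<le> C0_norm f"
  unfolding fourier_coeff_p[OF assms]
proof (rule norm_fourier1_le)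
  show "continuous_on UNIV (p_coeff f k1)"
    by (rule has_vector_derivative_imp_continuous_on[OF p_coeff_has_derivative[OF assms]])
qed (rule norm_p_coeff_le[OF assms])

text \<open>As \<open>1 / 0\<close> is 0, the weight at 0 is set to 1 by hand; it has to dominate
  the coefficient of frequency 0 as well.\<close>

definition wt :: "int \<Rightarrow> real" where
  "wt k = (if k = 0 then 1 else 1 / (of_int k)\<^sup>2)"

section \<open>Absolute summability of the double Fourier series\<close>

lemma wt_nonneg: "0 \<le> wt k"
  by (simp add: wt_def)

lemma summable_on_inverse_square_int: "(\<lambda>k::int. 1 / (of_int k :: real)\<^sup>2) summable_on A"
proof (rule summable_on_subset[OF _ subset_UNIV])
  let ?f = "\<lambda>k::int. 1 / (of_int k :: real)\<^sup>2"
  have s: "(\<lambda>n::nat. 1 / (real n)\<^sup>2) summable_on UNIV"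
  proof (rule norm_summable_imp_summable_on)
    show "summable (\<lambda>n. norm (1 / (real n)\<^sup>2))"
      using inverse_power_summable[of 2, where ?'a = real] by (simp add: field_simps)
  qed
  have "?f summable_on (range int)"
    by (subst summable_on_reindex) (use s in \<open>auto simp: o_def\<close>)
  moreover have "?f summable_on (range (\<lambda>n. - int n) - {0})"
  proof (rule summable_on_subset[of _ "range (\<lambda>n. - int n)"])
    show "?f summable_on (range (\<lambda>n. - int n))"
      by (subst summable_on_reindex) (use s in \<open>auto simp: o_def inj_def\<close>)
  qed auto
  moreover have "(UNIV :: int set) = range int \<union> (range (\<lambda>n. - int n) - {0})"
  proof -
    have "k \<in> range int \<union> (range (\<lambda>n. - int n) - {0})" for k
      by (cases k rule: int_cases2) auto
    then show ?thesis by blast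
  qed
  ultimately show "?f summable_on UNIV"
    using summable_on_Un_disjoint[of ?f "range int" "range (\<lambda>n. - int n) - {0}"] by fastforce
qed

lemma wt_summable: "wt summable_on A"
proof (rule summable_on_subset[OF _ subset_UNIV])
  have "wt summable_on ({0} \<union> - {0})"
  proof (rule summable_on_Un_disjoint)
    show "wt summable_on - {0}"
      using summable_on_inverse_square_int by (rule summable_on_cong[THEN iffD1, rotated]) (auto simp: wt_def)
  qed auto
  then show "wt summable_on UNIV" by simp
qed

lemma wt_product_summable: "(\<lambda>(k, l). wt k * wt l) summable_on A"
proof (rule summable_on_subset[OF _ subset_UNIV])
  have "(\<lambda>(k, l). wt k * wt l) summable_on Sigma UNIV (\<lambda>_. UNIV)"
  proof (rule summable_on_SigmaI)
    fix k
    show "((\<lambda>l. case (k, l) of (k, l) \<Rightarrow> wt k * wt l) has_sum (wt k * infsum wt UNIV)) UNIV"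
      using has_sum_cmult_right[OF has_sum_infsum[OF wt_summable]] by simp
  next
    show "(\<lambda>k. wt k * infsum wt UNIV) summable_on UNIV"
      by (intro summable_on_cmult_left wt_summable)
  qed (simp add: wt_nonneg)
  then show "(\<lambda>(k, l). wt k * wt l) summable_on UNIV" by simp
qed

lemma le_wt:
  assumes "x \<le> B" "(2 * pi * \<bar>of_int k\<bar>)\<^sup>2 * x \<le> B'" "0 \<le> x" "0 \<le> B" "0 \<le> B'"
  shows "x \<le> (B + B') * wt k"
proof (cases "k = 0")
  case False
  then have "(of_int k)\<^sup>2 * x \<le> (2 * pi * \<bar>of_int k\<bar>)\<^sup>2 * x"
    using assms(3) mult_right_mono[OF twopi_sq_ge_1, of "(of_int k)\<^sup>2 * x"]
    by (simp add: power_mult_distrib mult.assoc)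
  then have "(of_int k)\<^sup>2 * x \<le> B + B'" using assms by linarith
  then show ?thesis using False by (simp add: wt_def pos_le_divide_eq mult.commute)
qed (use assms in \<open>auto simp: wt_def\<close>)

text \<open>Two integrations by parts in each variable. \<open>step\<close> yields decay in
  \<open>k2\<close>; used for \<open>f\<close> and for its second momentum derivative, it supplies
  the two bounds that \<open>le_wt\<close> turns into additional decay in \<open>k1\<close>.\<close>

lemma fourier_coeff_decay:
  assumes f: "torus_smooth f"
  obtains B where "\<And>k1 k2. cmod (fourier_coeff f (k1, k2)) \<le> B * (wt k1 * wt k2)"
proof -
  let ?f1 = "partial_p (partial_p f)" and ?f2 = "\<lambda>f. partial_q (partial_q f)"
  have step: "cmod (fourier_coeff g (k1, k2)) \<le> (C0_norm g + C0_norm (?f2 g)) * wt k2"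
    if g: "torus_smooth g" for g k1 k2
  proof (rule le_wt)
    show "cmod (fourier_coeff g (k1, k2)) \<le> C0_norm g" by (rule norm_fourier_coeff_le[OF g])
    have "(2 * pi * \<bar>of_int k2\<bar>)\<^sup>2 * cmod (fourier_coeff g (k1, k2)) = cmod (fourier_coeff (?f2 g) (k1, k2))"
      using g by (simp add: fourier_coeff_partial_q torus_smooth_partial_q power2_eq_square)
    also have "\<dots> \<le> C0_norm (?f2 g)" by (intro norm_fourier_coeff_le torus_smooth_partial_q g)
    finally show "(2 * pi * \<bar>of_int k2\<bar>)\<^sup>2 * cmod (fourier_coeff g (k1, k2)) \<le> C0_norm (?f2 g)" .
  qed (auto intro!: C0_norm_nonneg torus_smooth_partial_q g)
  let ?B = "\<lambda>g. C0_norm g + C0_norm (?f2 g)"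
  have f1: "torus_smooth ?f1" by (intro torus_smooth_partial_p f)
  have B0: "0 \<le> ?B g" if "torus_smooth g" for g
    using that by (intro add_nonneg_nonneg C0_norm_nonneg torus_smooth_partial_q)
  have "cmod (fourier_coeff f (k1, k2)) \<le> (?B f + ?B ?f1) * (wt k1 * wt k2)" for k1 k2
  proof -
    have "cmod (fourier_coeff f (k1, k2)) \<le> (?B f * wt k2 + ?B ?f1 * wt k2) * wt k1"
    proof (rule le_wt)
      have "(2 * pi * \<bar>of_int k1\<bar>)\<^sup>2 * cmod (fourier_coeff f (k1, k2)) = cmod (fourier_coeff ?f1 (k1, k2))"
        using f by (simp add: fourier_coeff_partial_p torus_smooth_partial_p power2_eq_square)
      then show "(2 * pi * \<bar>of_int k1\<bar>)\<^sup>2 * cmod (fourier_coeff f (k1, k2)) \<le> ?B ?f1 * wt k2"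
        using step[OF f1, of k1 k2] by simp
    qed (use step[OF f] B0[OF f] B0[OF f1] in \<open>auto simp: wt_nonneg\<close>)
    then show ?thesis by (simp add: algebra_simps)
  qed
  then show ?thesis by (rule that)
qed

text \<open>The factors \<open>c\<close> stand for matrix entries of translations and for
  exponentials, possibly set to 0 off a residue class; all of them have modulus at most 1.\<close>

lemma fourier_coeff_summable:
  assumes f: "torus_smooth f" and c: "\<And>k. cmod (c k) \<le> 1"
  shows "(\<lambda>k. cmod (fourier_coeff f k * c k)) summable_on A"
proof -
  obtain B where B: "\<And>k1 k2. cmod (fourier_coeff f (k1, k2)) \<le> B * (wt k1 * wt k2)"
    using fourier_coeff_decay[OF f] by blast
  have "(\<lambda>k. B * (case k of (k, l) \<Rightarrow> wt k * wt l)) summable_on A"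
    by (intro summable_on_cmult_right wt_product_summable)
  then show ?thesis
  proof (rule summable_on_comparison_test)
    fix k show "cmod (fourier_coeff f k * c k) \<le> B * (case k of (k, l) \<Rightarrow> wt k * wt l)"
      using B[of "fst k" "snd k"] c[of k] mult_mono[OF B[of "fst k" "snd k"] c[of k]]
      by (auto simp: norm_mult case_prod_beta' intro: order_trans[OF norm_ge_zero])
  qed simp
qed

text \<open>Links the unordered sums in the definition of \<open>weyl_op\<close> with the symmetric
  partial sums in \<open>fourier_inversion\<close>.\<close>

lemma infsum_int_symmetric_limit:
  fixes f :: "int \<Rightarrow> complex"
  assumes "f summable_on UNIV"
  shows "(\<lambda>M. \<Sum>k\<in>{- int M..int M}. f k) \<longlonglongrightarrow> infsum f UNIV"
proof -
  have "filterlim (\<lambda>M. {- int M..int M}) (finite_subsets_at_top UNIV) sequentially"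
    unfolding filterlim_finite_subsets_at_top
  proof (intro allI impI)
    fix X :: "int set" assume X: "finite X \<and> X \<subseteq> UNIV"
    define M0 where "M0 = Max (insert 0 (nat ` abs ` X))"
    have "nat \<bar>x\<bar> \<le> M0" if "x \<in> X" for x
      unfolding M0_def using X that by (intro Max_ge) auto
    then have "X \<subseteq> {- int M..int M}" if "M \<ge> M0" for M
      using that by fastforce
    then show "\<forall>\<^sub>F M in sequentially. finite {- int M..int M} \<and> X \<subseteq> {- int M..int M} \<and> {- int M..int M} \<subseteq> UNIV"
      unfolding eventually_sequentially by auto
  qed
  moreover have "(sum f \<longlongrightarrow> infsum f UNIV) (finite_subsets_at_top UNIV)"
    using has_sum_infsum[OF assms] by (simp add: has_sum_def)
  ultimately show ?thesis by (rule filterlim_compose[rotated])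
qed

lemma fourier_series_infsum:
  assumes "\<And>x. (f has_vector_derivative f' x) (at x)" "continuous_on UNIV f'"
    and "\<And>x. f (x + 1) = f x"
    and "(\<lambda>k. fourier1 f k * cis (2 * pi * of_int k * x)) summable_on UNIV"
  shows "(\<Sum>\<^sub>\<infinity>k. fourier1 f k * cis (2 * pi * of_int k * x)) = f x"
  using LIMSEQ_unique[OF infsum_int_symmetric_limit[OF assms(4)] fourier_inversion[OF assms(1-3)]] .

section \<open>Summing the double series over one index\<close>

lemma p_coeff_periodic: "torus_smooth f \<Longrightarrow> p_coeff f k (q + of_int m) = p_coeff f k q"
  unfolding p_coeff_def using torus_smooth_periodic[of f _ m _ 0] by simp

lemma q_coeff_periodic: "torus_smooth f \<Longrightarrow> q_coeff f k (p + of_int m) = q_coeff f k p"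
  unfolding q_coeff_def using torus_smooth_periodic[of f _ 0 _ m] by simp

lemma fourier_coeff_section_summable:
  assumes "torus_smooth f" "\<And>k. cmod (c k) \<le> 1"
  shows "(\<lambda>k2. fourier_coeff f (k1, k2) * c k2) summable_on UNIV"
    and "(\<lambda>k1. fourier_coeff f (k1, k2) * c k1) summable_on UNIV"
proof -
  have "(\<lambda>k. fourier_coeff f k * c (snd k)) summable_on (range (Pair k1))"
    by (rule abs_summable_summable[OF fourier_coeff_summable[OF assms(1)]]) (rule assms(2))
  then have "((\<lambda>k. fourier_coeff f k * c (snd k)) \<circ> Pair k1) summable_on UNIV"
    by (rule summable_on_reindex[THEN iffD1, rotated]) (simp add: inj_on_def)
  then show "(\<lambda>k2. fourier_coeff f (k1, k2) * c k2) summable_on UNIV"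
    by (simp only: o_def snd_conv)
  have "(\<lambda>k. fourier_coeff f k * c (fst k)) summable_on (range (\<lambda>k1. (k1, k2)))"
    by (rule abs_summable_summable[OF fourier_coeff_summable[OF assms(1)]]) (rule assms(2))
  then have "((\<lambda>k. fourier_coeff f k * c (fst k)) \<circ> (\<lambda>k1. (k1, k2))) summable_on UNIV"
    by (rule summable_on_reindex[THEN iffD1, rotated]) (simp add: inj_on_def)
  then show "(\<lambda>k1. fourier_coeff f (k1, k2) * c k1) summable_on UNIV"
    by (simp only: o_def fst_conv)
qed

lemma infsum_fourier_coeff_p:
  assumes f: "torus_smooth f"
  shows "(\<Sum>\<^sub>\<infinity>k2. fourier_coeff f (k1, k2) * cis (2 * pi * of_int k2 * q)) = p_coeff f k1 q"
  unfolding fourier_coeff_p[OF f]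
proof (rule fourier_series_infsum)
  show "(\<lambda>k. fourier1 (p_coeff f k1) k * cis (2 * pi * of_int k * q)) summable_on UNIV"
    using fourier_coeff_section_summable(1)[OF f, of "\<lambda>k. cis (2 * pi * of_int k * q)" k1]
    by (simp add: fourier_coeff_p[OF f])
  show "continuous_on UNIV (p_coeff (partial_q f) k1)"
    by (rule has_vector_derivative_imp_continuous_on[OF p_coeff_has_derivative[OF torus_smooth_partial_q[OF f]]])
qed (use p_coeff_has_derivative[OF f] p_coeff_periodic[OF f, of _ _ 1] in auto)

lemma infsum_fourier_coeff_q:
  assumes f: "torus_smooth f"
  shows "(\<Sum>\<^sub>\<infinity>k1. fourier_coeff f (k1, k2) * cis (- 2 * pi * of_int k1 * p)) = q_coeff f k2 p"
proof -
  have s: "(\<lambda>k1. fourier_coeff f (k1, k2) * cis (- 2 * pi * of_int k1 * p)) summable_on UNIV"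
    by (rule fourier_coeff_section_summable(2)[OF f]) simp
  have b: "bij (uminus :: int \<Rightarrow> int)" by (rule bij_uminus)
  have eq: "fourier_coeff f (- k, k2) * cis (- 2 * pi * of_int (- k) * p)
      = fourier1 (q_coeff f k2) k * cis (2 * pi * of_int k * p)" for k
    by (simp add: fourier_coeff_q[OF f])
  have "(\<Sum>\<^sub>\<infinity>k1. fourier_coeff f (k1, k2) * cis (- 2 * pi * of_int k1 * p))
      = (\<Sum>\<^sub>\<infinity>k. fourier1 (q_coeff f k2) k * cis (2 * pi * of_int k * p))"
    using infsum_reindex_bij_betw[OF b, of "\<lambda>k1. fourier_coeff f (k1, k2) * cis (- 2 * pi * of_int k1 * p)"]
    unfolding eq by simp
  also have "\<dots> = q_coeff f k2 p"
  proof (rule fourier_series_infsum)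
    show "(\<lambda>k. fourier1 (q_coeff f k2) k * cis (2 * pi * of_int k * p)) summable_on UNIV"
      using s summable_on_reindex_bij_betw[OF b, of "\<lambda>k1. fourier_coeff f (k1, k2) * cis (- 2 * pi * of_int k1 * p)"]
      unfolding eq by simp
    show "continuous_on UNIV (q_coeff (partial_p f) k2)"
      by (rule has_vector_derivative_imp_continuous_on[OF q_coeff_has_derivative[OF torus_smooth_partial_p[OF f]]])
  qed (use q_coeff_has_derivative[OF f] q_coeff_periodic[OF f, of _ _ 1] in auto)
  finally show ?thesis .
qed

text \<open>Summing over \<open>k2\<close> for fixed \<open>k1\<close> inverts the Fourier series in
  position. The evaluation point may depend on \<open>k1\<close>, as the midpoint in a Weyl matrix
  entry does.\<close>

lemma infsum_fourier_coeff_rows: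
  assumes f: "torus_smooth f"
  shows "(\<Sum>\<^sub>\<infinity>(k1, k2). fourier_coeff f (k1, k2) * (if k1 \<in> S then cis (2 * pi * of_int k2 * x k1) else 0))
    = (\<Sum>\<^sub>\<infinity>k1\<in>S. p_coeff f k1 (x k1))"
proof -
  let ?F = "\<lambda>(k1, k2). fourier_coeff f (k1, k2) * (if k1 \<in> S then cis (2 * pi * of_int k2 * x k1) else 0)"
  have "?F summable_on Sigma UNIV (\<lambda>_. UNIV)"
  proof -
    have "(\<lambda>k. fourier_coeff f k * (if fst k \<in> S then cis (2 * pi * of_int (snd k) * x (fst k)) else 0)) summable_on UNIV"
      by (rule abs_summable_summable[OF fourier_coeff_summable[OF f]]) simp
    then show ?thesis by (simp add: case_prod_beta')
  qed
  from infsum_Sigma_banach[OF this]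
  have "infsum ?F UNIV = (\<Sum>\<^sub>\<infinity>k1. \<Sum>\<^sub>\<infinity>k2. ?F (k1, k2))" by simp
  also have "\<dots> = (\<Sum>\<^sub>\<infinity>k1\<in>S. p_coeff f k1 (x k1))"
    by (rule infsum_cong_neutral) (auto simp: infsum_fourier_coeff_p[OF f])
  finally show ?thesis .
qed

lemma infsum_fourier_coeff_cols:
  assumes f: "torus_smooth f"
  shows "(\<Sum>\<^sub>\<infinity>(k1, k2). fourier_coeff f (k1, k2) * (if k2 \<in> S then cis (- 2 * pi * of_int k1 * x k2) else 0))
    = (\<Sum>\<^sub>\<infinity>k2\<in>S. q_coeff f k2 (x k2))"
proof -
  let ?F = "\<lambda>k1 k2. fourier_coeff f (k1, k2) * (if k2 \<in> S then cis (- 2 * pi * of_int k1 * x k2) else 0)"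
  have s: "(\<lambda>(k1, k2). ?F k1 k2) summable_on (UNIV \<times> UNIV)"
  proof -
    have "(\<lambda>k. fourier_coeff f k * (if snd k \<in> S then cis (- 2 * pi * of_int (fst k) * x (snd k)) else 0)) summable_on UNIV"
      by (rule abs_summable_summable[OF fourier_coeff_summable[OF f]]) simp
    then show ?thesis by (simp add: case_prod_beta')
  qed
  have "infsum (\<lambda>(k1, k2). ?F k1 k2) UNIV = (\<Sum>\<^sub>\<infinity>k1. \<Sum>\<^sub>\<infinity>k2. ?F k1 k2)"
    using infsum_Sigma'_banach[OF s] by simp
  also have "\<dots> = (\<Sum>\<^sub>\<infinity>k2. \<Sum>\<^sub>\<infinity>k1. ?F k1 k2)"
    by (rule infsum_swap_banach[OF s])
  also have "\<dots> = (\<Sum>\<^sub>\<infinity>k2\<in>S. q_coeff f k2 (x k2))"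
    by (rule infsum_cong_neutral) (auto simp: infsum_fourier_coeff_q[OF f, simplified])
  finally show ?thesis .
qed

text \<open>The majorant is uniform in the evaluation point, which may move with \<open>k\<close>.
  This justifies splitting off a single term in \<open>infsum_remove_main\<close>.\<close>

lemma q_coeff_abs_summable:
  assumes f: "torus_smooth f"
  shows "(\<lambda>k. cmod (q_coeff f k (x k))) summable_on A"
proof -
  let ?B = "C0_norm f + C0_norm ((partial_q ^^ 2) f)"
  have f2: "torus_smooth ((partial_q ^^ 2) f)" using torus_smooth_partials[OF f, of 2 0] by simp
  have "(\<lambda>k. ?B * wt k) summable_on A" by (intro summable_on_cmult_right wt_summable)
  then show ?thesis
  proof (rule summable_on_comparison_test)
    fix k show "cmod (q_coeff f k (x k)) \<le> ?B * wt k"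
      using norm_q_coeff_iterate[OF f, of 2 k "x k"] norm_q_coeff_le[OF f2, of k "x k"]
      by (intro le_wt norm_q_coeff_le f C0_norm_nonneg f2) auto
  qed simp
qed

section \<open>Matrices and Weyl quantisation\<close>

text \<open>Bounds are carried in this form because they add and compose without any boundedness
  condition on a supremum; \<open>op_norm_le\<close> converts at the very end.\<close>

definition op_bound :: "complex mat \<Rightarrow> real \<Rightarrow> bool" where
  "op_bound A c \<longleftrightarrow> (\<forall>v \<in> carrier_vec (dim_col A). vec_l2_norm (A *\<^sub>v v) \<le> c * vec_l2_norm v)"

section \<open>Operator bounds and Schur's test\<close>

lemma vec_l2_norm_nonneg: "0 \<le> vec_l2_norm v"
  by (simp add: vec_l2_norm_def L2_set_nonneg)

lemma vec_l2_norm_square: "(vec_l2_norm v)\<^sup>2 = (\<Sum>i<dim_vec v. (cmod (v $ i))\<^sup>2)"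
  by (simp add: vec_l2_norm_def L2_set_def sum_nonneg)

lemma op_norm_le:
  assumes "op_bound A c" "0 \<le> c"
  shows "op_norm A \<le> c"
  unfolding op_norm_def
proof (rule cSUP_least)
  have "vec_l2_norm (0\<^sub>v (dim_col A)) \<le> 1" by (simp add: vec_l2_norm_def L2_set_def)
  then show "{v \<in> carrier_vec (dim_col A). vec_l2_norm v \<le> 1} \<noteq> {}"
    by (metis (mono_tags, lifting) empty_iff mem_Collect_eq zero_carrier_vec)
next
  fix v assume v: "v \<in> {v \<in> carrier_vec (dim_col A). vec_l2_norm v \<le> 1}"
  then have "vec_l2_norm (A *\<^sub>v v) \<le> c * vec_l2_norm v" using assms(1) by (auto simp: op_bound_def)
  also have "\<dots> \<le> c * 1" using v assms(2) by (intro mult_left_mono) auto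
  finally show "vec_l2_norm (A *\<^sub>v v) \<le> c" by simp
qed

lemma op_bound_mono:
  assumes "op_bound A c" "c \<le> d" shows "op_bound A d"
  using assms vec_l2_norm_nonneg by (meson mult_right_mono op_bound_def order_trans)

lemma vec_l2_norm_triangle:
  assumes "v \<in> carrier_vec n" "w \<in> carrier_vec n"
  shows "vec_l2_norm (v + w) \<le> vec_l2_norm v + vec_l2_norm w"
proof -
  have "vec_l2_norm (v + w) \<le> L2_set (\<lambda>i. cmod (v $ i) + cmod (w $ i)) {..<n}"
    using assms by (auto simp: vec_l2_norm_def intro!: L2_set_mono norm_triangle_ineq)
  also have "\<dots> \<le> L2_set (\<lambda>i. cmod (v $ i)) {..<n} + L2_set (\<lambda>i. cmod (w $ i)) {..<n}"
    by (rule L2_set_triangle_ineq)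
  finally show ?thesis using assms by (auto simp: vec_l2_norm_def)
qed

lemma op_bound_add:
  assumes A: "A \<in> carrier_mat n n" "B \<in> carrier_mat n n" and b: "op_bound A c" "op_bound B d"
  shows "op_bound (A + B) (c + d)"
  unfolding op_bound_def
proof
  fix v :: "complex vec" assume "v \<in> carrier_vec (dim_col (A + B))"
  then have v: "v \<in> carrier_vec n" using A by simp
  have "vec_l2_norm ((A + B) *\<^sub>v v) = vec_l2_norm (A *\<^sub>v v + B *\<^sub>v v)"
    using A v by (simp add: add_mult_distrib_mat_vec)
  also have "\<dots> \<le> vec_l2_norm (A *\<^sub>v v) + vec_l2_norm (B *\<^sub>v v)"
    using A v by (intro vec_l2_norm_triangle[of _ n]) auto
  also have "\<dots> \<le> c * vec_l2_norm v + d * vec_l2_norm v"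
    using b A v by (intro add_mono) (auto simp: op_bound_def)
  finally show "vec_l2_norm ((A + B) *\<^sub>v v) \<le> (c + d) * vec_l2_norm v" by (simp add: algebra_simps)
qed

lemma op_bound_mult:
  assumes A: "A \<in> carrier_mat n n" "B \<in> carrier_mat n n" and b: "op_bound A c" "op_bound B d" and "0 \<le> c"
  shows "op_bound (A * B) (c * d)"
  unfolding op_bound_def
proof
  fix v :: "complex vec" assume "v \<in> carrier_vec (dim_col (A * B))"
  then have v: "v \<in> carrier_vec n" using A by simp
  have "vec_l2_norm ((A * B) *\<^sub>v v) = vec_l2_norm (A *\<^sub>v (B *\<^sub>v v))"
    using A v by (simp add: assoc_mult_mat_vec)
  also have "\<dots> \<le> c * vec_l2_norm (B *\<^sub>v v)"
    using A b v by (auto simp: op_bound_def)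
  also have "\<dots> \<le> c * (d * vec_l2_norm v)"
    using b A v assms(5) by (intro mult_left_mono) (auto simp: op_bound_def)
  finally show "vec_l2_norm ((A * B) *\<^sub>v v) \<le> (c * d) * vec_l2_norm v" by simp
qed

lemma op_bound_uminus:
  assumes "A \<in> carrier_mat n n" "op_bound A c"
  shows "op_bound (- A) c"
  unfolding op_bound_def
proof
  fix v :: "complex vec" assume "v \<in> carrier_vec (dim_col (- A))"
  then have v: "v \<in> carrier_vec n" using assms by simp
  have "vec_l2_norm (- A *\<^sub>v v) = vec_l2_norm (A *\<^sub>v v)"
    using assms v by (auto simp: vec_l2_norm_def intro!: L2_set_cong)
  then show "vec_l2_norm (- A *\<^sub>v v) \<le> c * vec_l2_norm v"
    using assms v by (auto simp: op_bound_def)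
qed

lemma op_bound_conj:
  assumes "A \<in> carrier_mat n n" "B \<in> carrier_mat n n" "U \<in> carrier_mat n n"
    and "op_bound A 1" "op_bound B 1" "op_bound U c" "0 \<le> c"
  shows "op_bound (A * U * B) c"
proof -
  have "op_bound (A * U) (1 * c)" by (rule op_bound_mult) (use assms in auto)
  then have "op_bound (A * U * B) (1 * c * 1)"
    by (rule op_bound_mult[rotated 2]) (use assms in auto)
  then show ?thesis by simp
qed

lemma mat_mult_vec_index:
  assumes "A \<in> carrier_mat n n" "v \<in> carrier_vec n" "i < n"
  shows "(A *\<^sub>v v) $ i = (\<Sum>j<n. A $$ (i, j) * v $ j)"
  using assms by (auto simp: scalar_prod_def atLeast0LessThan)

lemma mat_mult_index:
  assumes "A \<in> carrier_mat n n" "B \<in> carrier_mat n n" "i < n" "j < n"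
  shows "(A * B) $$ (i, j) = (\<Sum>k<n. A $$ (i, k) * B $$ (k, j))"
  using assms by (auto simp: scalar_prod_def atLeast0LessThan)

lemma mat_mult3_index:
  assumes "A \<in> carrier_mat n n" "B \<in> carrier_mat n n" "C \<in> carrier_mat n n" "i < n" "j < n"
  shows "(A * B * C) $$ (i, j) = (\<Sum>k<n. \<Sum>l<n. A $$ (i, k) * B $$ (k, l) * C $$ (l, j))"
proof -
  have "(A * B * C) $$ (i, j) = (\<Sum>l<n. (\<Sum>k<n. A $$ (i, k) * B $$ (k, l)) * C $$ (l, j))"
    unfolding mat_mult_index[OF mult_carrier_mat[OF assms(1,2)] assms(3-5)]
    using assms by (intro sum.cong refl) (simp add: mat_mult_index[of A n B] del: index_mult_mat)
  also have "\<dots> = (\<Sum>l<n. \<Sum>k<n. A $$ (i, k) * B $$ (k, l) * C $$ (l, j))"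
    by (simp add: sum_distrib_right)
  also have "\<dots> = (\<Sum>k<n. \<Sum>l<n. A $$ (i, k) * B $$ (k, l) * C $$ (l, j))"
    by (rule sum.swap)
  finally show ?thesis .
qed

text \<open>Writing each modulus as a product of two square roots, Cauchy-Schwarz bounds the square
  of a component by the row sum times a weighted sum; adding over the rows brings in the column
  sums.\<close>

lemma schur_test:
  assumes W: "W \<in> carrier_mat n n" and S: "0 \<le> S"
    and rows: "\<And>i. i < n \<Longrightarrow> (\<Sum>j<n. cmod (W $$ (i, j))) \<le> S"
    and cols: "\<And>j. j < n \<Longrightarrow> (\<Sum>i<n. cmod (W $$ (i, j))) \<le> S"
  shows "op_bound W S"
  unfolding op_bound_def
proof
  fix v :: "complex vec" assume "v \<in> carrier_vec (dim_col W)"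
  then have v: "v \<in> carrier_vec n" using W by simp
  let ?w = "\<lambda>i j. cmod (W $$ (i, j))"
  have row: "(cmod ((W *\<^sub>v v) $ i))\<^sup>2 \<le> S * (\<Sum>j<n. ?w i j * (cmod (v $ j))\<^sup>2)" if i: "i < n" for i
  proof -
    have "cmod ((W *\<^sub>v v) $ i) \<le> (\<Sum>j<n. sqrt (?w i j) * (sqrt (?w i j) * cmod (v $ j)))"
      unfolding mat_mult_vec_index[OF W v i]
      by (rule order_trans[OF norm_sum]) (simp add: norm_mult mult.assoc[symmetric])
    then have "(cmod ((W *\<^sub>v v) $ i))\<^sup>2 \<le> (\<Sum>j<n. sqrt (?w i j) * (sqrt (?w i j) * cmod (v $ j)))\<^sup>2"
      by (intro power_mono) auto
    also have "\<dots> \<le> (\<Sum>j<n. (sqrt (?w i j))\<^sup>2) * (\<Sum>j<n. (sqrt (?w i j) * cmod (v $ j))\<^sup>2)"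
      by (rule Cauchy_Schwarz_ineq_sum)
    also have "\<dots> = (\<Sum>j<n. ?w i j) * (\<Sum>j<n. ?w i j * (cmod (v $ j))\<^sup>2)"
      by (simp add: power_mult_distrib)
    also have "\<dots> \<le> S * (\<Sum>j<n. ?w i j * (cmod (v $ j))\<^sup>2)"
      by (intro mult_right_mono rows i sum_nonneg) auto
    finally show ?thesis .
  qed
  have "(vec_l2_norm (W *\<^sub>v v))\<^sup>2 \<le> (\<Sum>i<n. S * (\<Sum>j<n. ?w i j * (cmod (v $ j))\<^sup>2))"
  proof -
    have dim: "dim_vec (W *\<^sub>v v) = n" using W by simp
    show ?thesis unfolding vec_l2_norm_square dim by (rule sum_mono, rule row, simp)
  qed
  also have "\<dots> = S * (\<Sum>j<n. (\<Sum>i<n. ?w i j) * (cmod (v $ j))\<^sup>2)"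
    unfolding sum_distrib_left[symmetric] sum_distrib_right by (subst sum.swap) simp
  also have "\<dots> \<le> S * (\<Sum>j<n. S * (cmod (v $ j))\<^sup>2)"
    by (intro mult_left_mono sum_mono mult_right_mono cols S) auto
  also have "\<dots> = (S * vec_l2_norm v)\<^sup>2"
    using v by (simp add: power_mult_distrib vec_l2_norm_square sum_distrib_left power2_eq_square[of S] mult.assoc)
  finally show "vec_l2_norm (W *\<^sub>v v) \<le> S * vec_l2_norm v"
    by (rule power2_le_imp_le) (intro mult_nonneg_nonneg S vec_l2_norm_nonneg)
qed

section \<open>Unitary matrices and their inverses\<close>

definition adj :: "complex mat \<Rightarrow> complex mat" where
  "adj A = Matrix.mat (dim_col A) (dim_row A) (\<lambda>(i, j). cnj (A $$ (j, i)))"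

lemma adj_carrier [simp]: "A \<in> carrier_mat n m \<Longrightarrow> adj A \<in> carrier_mat m n"
  by (auto simp: adj_def)

lemma adj_dim [simp]: "dim_row (adj A) = dim_col A" "dim_col (adj A) = dim_row A"
  by (simp_all add: adj_def)

lemma adj_index: "A \<in> carrier_mat n n \<Longrightarrow> i < n \<Longrightarrow> j < n \<Longrightarrow> adj A $$ (i, j) = cnj (A $$ (j, i))"
  by (auto simp: adj_def)

lemma isometry_op_bound:
  assumes A: "A \<in> carrier_mat n n" and AA: "adj A * A = 1\<^sub>m n"
  shows "op_bound A 1"
  unfolding op_bound_def
proof
  fix v :: "complex vec" assume "v \<in> carrier_vec (dim_col A)"
  then have v: "v \<in> carrier_vec n" using A by simp
  have delta: "(\<Sum>i<n. cnj (A $$ (i, l)) * A $$ (i, j)) = (if l = j then 1 else 0)" if "l < n" "j < n" for l j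
  proof -
    have "(adj A * A) $$ (l, j) = (\<Sum>i<n. cnj (A $$ (i, l)) * A $$ (i, j))"
      using A that by (simp add: mat_mult_index[of _ n] adj_index del: index_mult_mat)
    then show ?thesis using AA that by simp
  qed
  have "of_real ((vec_l2_norm (A *\<^sub>v v))\<^sup>2) = (\<Sum>i<n. (A *\<^sub>v v) $ i * cnj ((A *\<^sub>v v) $ i))"
    using A by (simp add: vec_l2_norm_square complex_norm_square del: of_real_power index_mult_mat_vec)
  also have "\<dots> = (\<Sum>i<n. \<Sum>j<n. \<Sum>l<n. v $ j * cnj (v $ l) * (cnj (A $$ (i, l)) * A $$ (i, j)))"
    by (rule sum.cong[OF refl]) (simp add: mat_mult_vec_index[OF A v] sum_product algebra_simps del: index_mult_mat_vec)
  also have "\<dots> = (\<Sum>j<n. \<Sum>l<n. \<Sum>i<n. v $ j * cnj (v $ l) * (cnj (A $$ (i, l)) * A $$ (i, j)))"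
    by (subst sum.swap, rule sum.cong[OF refl], rule sum.swap)
  also have "\<dots> = (\<Sum>j<n. \<Sum>l<n. v $ j * cnj (v $ l) * (if l = j then 1 else 0))"
    unfolding sum_distrib_left[symmetric] by (intro sum.cong refl) (simp add: delta)
  also have "\<dots> = (\<Sum>j<n. v $ j * cnj (v $ j))"
    by (simp add: sum.delta if_distrib cong: if_cong)
  also have "\<dots> = of_real ((vec_l2_norm v)\<^sup>2)"
    using v by (simp add: vec_l2_norm_square complex_norm_square del: of_real_power)
  finally have "(vec_l2_norm (A *\<^sub>v v))\<^sup>2 = (vec_l2_norm v)\<^sup>2"
    by (simp only: of_real_eq_iff)
  then show "vec_l2_norm (A *\<^sub>v v) \<le> 1 * vec_l2_norm v"
    using vec_l2_norm_nonneg by (simp add: power2_eq_iff_nonneg)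
qed

definition unitary_mat :: "nat \<Rightarrow> complex mat \<Rightarrow> bool" where
  "unitary_mat n A \<longleftrightarrow> A \<in> carrier_mat n n \<and> adj A * A = 1\<^sub>m n \<and> A * adj A = 1\<^sub>m n"

lemma adj_adj [simp]: "A \<in> carrier_mat n m \<Longrightarrow> adj (adj A) = A"
  by (rule eq_matI) (auto simp: adj_def)

lemma unitary_adj: "unitary_mat n A \<Longrightarrow> unitary_mat n (adj A)"
  by (auto simp: unitary_mat_def)

lemma unitary_op_bound: "unitary_mat n A \<Longrightarrow> op_bound A 1"
  using isometry_op_bound by (auto simp: unitary_mat_def)

text \<open>Orthonormal columns suffice: for square matrices a left inverse is also a right
  inverse.\<close>

lemma unitaryI:
  assumes "A \<in> carrier_mat n n" "\<And>i j. i < n \<Longrightarrow> j < n \<Longrightarrow> (\<Sum>k<n. cnj (A $$ (k, i)) * A $$ (k, j)) = (if i = j then 1 else 0)"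
  shows "unitary_mat n A"
proof -
  have "adj A * A = 1\<^sub>m n"
    by (rule eq_matI) (use assms in \<open>auto simp: mat_mult_index[of _ n] adj_index simp del: index_mult_mat(1)\<close>)
  then show ?thesis
    using mat_mult_left_right_inverse[of "adj A" n A] assms(1) by (auto simp: unitary_mat_def)
qed

text \<open>\<open>mat_inv\<close> extracts a value from an option, so the case \<open>None\<close>
  has to be excluded: the two-sided inverse \<open>B\<close> exhibits \<open>A\<close> as a unit of
  the matrix ring.\<close>

lemma mat_inv_eq:
  assumes A: "A \<in> carrier_mat n n" and B: "B \<in> carrier_mat n n" "A * B = 1\<^sub>m n" "B * A = 1\<^sub>m n"
  shows "mat_inv A = B"
proof (cases "mat_inverse A")
  case None
  then have "A \<notin> Units (ring_mat TYPE(complex) n ())" using mat_inverse(1)[OF A, of "()"] by simp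
  moreover have "A \<in> Units (ring_mat TYPE(complex) n ())"
    using A B unfolding Units_def ring_mat_def by auto
  ultimately show ?thesis by blast
next
  case (Some C)
  then have C: "C * A = 1\<^sub>m n" "C \<in> carrier_mat n n" using mat_inverse(2)[OF A] by auto
  have "C = C * (A * B)" using B C by simp
  also have "\<dots> = (C * A) * B" by (rule assoc_mult_mat[symmetric]) (rule C A B)+
  also have "\<dots> = B" using B C by simp
  finally show ?thesis using Some by (simp add: mat_inv_def)
qed

lemma unitary_mat_inv: "unitary_mat n A \<Longrightarrow> mat_inv A = adj A"
  by (rule mat_inv_eq[of _ n]) (auto simp: unitary_mat_def)

lemma adj_mult:
  assumes "A \<in> carrier_mat n n" "B \<in> carrier_mat n n"
  shows "adj (A * B) = adj B * adj A"
  by (rule eq_matI) (use assms in \<open>auto simp: mat_mult_index[of _ n] adj_index[OF mult_carrier_mat[OF assms]]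
      adj_index mult.commute simp del: index_mult_mat(1)\<close>)

lemma unitary_mult:
  assumes A: "unitary_mat n A" and B: "unitary_mat n B"
  shows "unitary_mat n (A * B)"
proof -
  have c: "A \<in> carrier_mat n n" "B \<in> carrier_mat n n" "adj A \<in> carrier_mat n n" "adj B \<in> carrier_mat n n"
    using A B by (auto simp: unitary_mat_def)
  have "adj A * (A * B) = (adj A * A) * B"
    by (rule assoc_mult_mat[symmetric]) (rule c)+
  also have "\<dots> = B" using A c by (simp add: unitary_mat_def)
  finally have AB: "adj A * (A * B) = B" .
  have "adj (A * B) * (A * B) = adj B * (adj A * (A * B))"
    unfolding adj_mult[OF c(1,2)] by (rule assoc_mult_mat) (rule c mult_carrier_mat)+
  also have "\<dots> = 1\<^sub>m n" unfolding AB using B by (simp add: unitary_mat_def)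
  finally show ?thesis
    using mat_mult_left_right_inverse[of "adj (A * B)" n "A * B"] c by (simp add: unitary_mat_def)
qed

section \<open>The Fourier matrix and the quantum baker's map\<close>

lemma sum_roots_of_unity:
  fixes d :: int
  assumes "N > 0"
  shows "(\<Sum>j<N. cis (2 * pi * of_int d * real j / real N)) = (if int N dvd d then of_nat N else 0)"
proof -
  let ?z = "cis (2 * pi * (of_int d / real N))"
  have zj: "cis (2 * pi * of_int d * real j / real N) = ?z ^ j" for j
    by (simp only: Complex.DeMoivre) (simp add: field_simps)
  have one: "?z = 1 \<longleftrightarrow> int N dvd d"
  proof
    assume "?z = 1"
    then have "of_int d / real N \<in> \<int>" by (simp only: cis_2pi_eq_1_iff)
    then obtain m :: int where "of_int d / real N = of_int m" by (auto elim: Ints_cases)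
    then have "real_of_int d = real_of_int (int N * m)" using assms by (simp add: field_simps)
    then have "d = int N * m" by (simp only: of_int_eq_iff)
    then show "int N dvd d" by simp
  next
    assume "int N dvd d"
    then obtain m where "d = int N * m" by blast
    then have "of_int d / real N = of_int m" using assms by simp
    then show "?z = 1" by (simp only: cis_2pi_eq_1_iff) simp
  qed
  have "?z ^ N = cis (2 * pi * of_int d)" using assms by (simp add: Complex.DeMoivre)
  also have "\<dots> = 1" by (simp only: cis_2pi_eq_1_iff) simp
  finally have zN: "?z ^ N = 1" .
  show ?thesis
  proof (cases "int N dvd d")
    case True
    then have "?z = 1" by (simp only: one)
    then show ?thesis using True unfolding zj by simp
  next
    case False
    then have "?z \<noteq> 1" by (simp only: one) simp
    then have "(\<Sum>j<N. ?z ^ j) = 0"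
      using geometric_sum[of ?z N] zN by simp
    then show ?thesis using False unfolding zj by simp
  qed
qed

lemma fourier_mat_carrier [simp]: "fourier_mat N \<in> carrier_mat N N"
  by (simp add: fourier_mat_def)

lemma fourier_mat_index:
  "k < N \<Longrightarrow> j < N \<Longrightarrow>
    fourier_mat N $$ (k, j) = complex_of_real (1 / sqrt (real N)) * cis (- 2 * pi * real k * real j / real N)"
  by (simp add: fourier_mat_def)

lemma sqrt_inverse_square: "N > 0 \<Longrightarrow> complex_of_real (1 / sqrt (real N)) * complex_of_real (1 / sqrt (real N)) = 1 / of_nat N"
  unfolding of_real_mult[symmetric] by (simp add: real_sqrt_mult_self)

lemma unitary_fourier_mat:
  assumes N: "N > 0" shows "unitary_mat N (fourier_mat N)"
proof (rule unitaryI)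
  fix i j assume ij: "i < N" "j < N"
  have "cnj (fourier_mat N $$ (k, i)) * fourier_mat N $$ (k, j)
      = 1 / of_nat N * cis (2 * pi * of_int (int i - int j) * real k / real N)" if "k < N" for k
  proof -
    have "cnj (fourier_mat N $$ (k, i)) * fourier_mat N $$ (k, j)
      = (complex_of_real (1 / sqrt (real N)) * complex_of_real (1 / sqrt (real N))) *
        (cis (2 * pi * real k * real i / real N) * cis (- 2 * pi * real k * real j / real N))"
      using that ij by (simp add: fourier_mat_index cis_cnj mult_ac del: of_real_divide)
    also have "cis (2 * pi * real k * real i / real N) * cis (- 2 * pi * real k * real j / real N)
      = cis (2 * pi * of_int (int i - int j) * real k / real N)"
      by (simp add: cis_mult diff_divide_distrib[symmetric] algebra_simps)
    finally show ?thesis by (simp only: sqrt_inverse_square[OF N])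
  qed
  then have "(\<Sum>k<N. cnj (fourier_mat N $$ (k, i)) * fourier_mat N $$ (k, j))
      = 1 / of_nat N * (if int N dvd int i - int j then of_nat N else 0)"
    by (simp only: sum_roots_of_unity[OF N, symmetric] sum_distrib_left) (rule sum.cong, auto)
  moreover have "int N dvd int i - int j \<longleftrightarrow> i = j"
  proof
    assume "int N dvd int i - int j"
    then have "int i mod int N = int j mod int N" by (simp add: mod_eq_dvd_iff)
    then show "i = j" using ij by simp
  qed simp
  ultimately show "(\<Sum>k<N. cnj (fourier_mat N $$ (k, i)) * fourier_mat N $$ (k, j)) = (if i = j then 1 else 0)"
    using N by simp
qed simp

definition baker_block :: "nat \<Rightarrow> complex mat" where
  "baker_block M = four_block_mat (fourier_mat M) (0\<^sub>m M M) (0\<^sub>m M M) (fourier_mat M)"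

lemma baker_block_carrier [simp]: "baker_block M \<in> carrier_mat (2 * M) (2 * M)"
  by (simp add: baker_block_def mult_2)

lemma baker_block_index:
  assumes "r < 2 * M" "j < 2 * M"
  shows "baker_block M $$ (r, j) =
    (if r < M then if j < M then fourier_mat M $$ (r, j) else 0
     else if j < M then 0 else fourier_mat M $$ (r - M, j - M))"
  using assms by (auto simp: baker_block_def fourier_mat_def)

lemma unitary_baker_block:
  assumes M: "M > 0" shows "unitary_mat (2 * M) (baker_block M)"
proof -
  let ?A = "fourier_mat M" and ?Z = "0\<^sub>m M M :: complex mat"
  have u: "adj ?A * ?A = 1\<^sub>m M" using unitary_fourier_mat[OF M] by (simp add: unitary_mat_def)
  have "adj (baker_block M) = four_block_mat (adj ?A) ?Z ?Z (adj ?A)"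
    by (rule eq_matI) (auto simp: adj_def baker_block_index carrier_matD[OF baker_block_carrier]
        carrier_matD[OF fourier_mat_carrier])
  then have "adj (baker_block M) * baker_block M = 1\<^sub>m (M + M)"
    using u left_mult_zero_mat[of ?A M M M] right_mult_zero_mat[of "adj ?A" M M M]
    by (simp add: baker_block_def mult_four_block_mat[of _ M M _ M _ M _ _ M _ M])
  then have 1: "adj (baker_block M) * baker_block M = 1\<^sub>m (2 * M)" by (simp add: mult_2)
  then show ?thesis
    using mat_mult_left_right_inverse[of "adj (baker_block M)" "2 * M" "baker_block M"]
    by (auto simp: unitary_mat_def)
qed

lemma quantum_baker_eq:
  assumes "N = 2 * M" "M > 0"
  shows "quantum_baker N = adj (fourier_mat N) * baker_block M"
  using assms unitary_mat_inv[OF unitary_fourier_mat[of N]]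
  by (simp add: quantum_baker_def baker_block_def Let_def)

lemma unitary_quantum_baker:
  assumes "N = 2 * M" "M > 0"
  shows "unitary_mat N (quantum_baker N)"
  using assms unitary_baker_block[of M] unitary_fourier_mat[of N]
  by (simp add: quantum_baker_eq unitary_mult unitary_adj)

section \<open>Entries of Weyl operators in the position and momentum bases\<close>

lemma has_sum_finite_sum:
  fixes f :: "'i \<Rightarrow> 'k \<Rightarrow> 'a::topological_comm_monoid_add"
  assumes "finite I" "\<And>i. i \<in> I \<Longrightarrow> (f i has_sum s i) A"
  shows "((\<lambda>k. \<Sum>i\<in>I. f i k) has_sum (\<Sum>i\<in>I. s i)) A"
  using assms by (induction I rule: finite_induct) (auto intro!: has_sum_add)

lemma weyl_op_carrier [simp]: "weyl_op N f \<in> carrier_mat N N"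
  by (simp add: weyl_op_def)

lemma weyl_translation_index:
  "i < N \<Longrightarrow> j < N \<Longrightarrow> weyl_translation N (k1, k2) $$ (i, j) =
    (if int i = (int j + k1) mod int N
     then cis (pi * of_int k1 * of_int k2 / real N) * cis (2 * pi * of_int k2 * real j / real N) else 0)"
  by (simp add: weyl_translation_def)

lemma weyl_op_has_sum:
  assumes f: "torus_smooth f" and "i < N" "j < N"
  shows "((\<lambda>k. fourier_coeff f k * weyl_translation N k $$ (i, j)) has_sum weyl_op N f $$ (i, j)) UNIV"
proof -
  have "(\<lambda>k. fourier_coeff f k * weyl_translation N k $$ (i, j)) summable_on UNIV"
    by (rule abs_summable_summable[OF fourier_coeff_summable[OF f]])
       (use assms in \<open>auto simp: split_paired_all weyl_translation_index norm_mult\<close>)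
  then show ?thesis using assms by (simp add: weyl_op_def has_sum_infsum)
qed

text \<open>The frequencies \<open>k1\<close> for which the translation has a nonzero entry
  \<open>(i, j)\<close>. In the momentum basis \<open>k2\<close> takes over this role.\<close>

definition shift_set :: "nat \<Rightarrow> nat \<Rightarrow> nat \<Rightarrow> int set" where
  "shift_set N i j = {k. int i = (int j + k) mod int N}"

text \<open>The phase e^(i pi k1 k2 / N) and the modulation at \<open>j\<close> combine to the
  exponential of frequency \<open>k2\<close> at (j + k1 / 2) / N. Summing over \<open>k2\<close>
  therefore evaluates the coefficient at the midpoint between \<open>j\<close> and
  \<open>j + k1\<close>.\<close>

lemma weyl_op_index:
  assumes f: "torus_smooth f" and ij: "i < N" "j < N"
  shows "weyl_op N f $$ (i, j) = (\<Sum>\<^sub>\<infinity>k\<in>shift_set N i j. p_coeff f k ((real j + of_int k / 2) / real N))"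
proof -
  let ?x = "\<lambda>k. (real j + of_int k / 2) / real N"
  have "weyl_op N f $$ (i, j) = (\<Sum>\<^sub>\<infinity>k. fourier_coeff f k * weyl_translation N k $$ (i, j))"
    using ij by (simp add: weyl_op_def)
  also have "\<dots> = (\<Sum>\<^sub>\<infinity>(k1, k2). fourier_coeff f (k1, k2) * (if k1 \<in> shift_set N i j then cis (2 * pi * of_int k2 * ?x k1) else 0))"
  proof (rule infsum_cong, clarify)
    fix k1 k2
    have "cis (pi * of_int k1 * of_int k2 / real N) * cis (2 * pi * of_int k2 * real j / real N) = cis (2 * pi * of_int k2 * ?x k1)"
      by (simp add: cis_mult add_divide_distrib[symmetric] algebra_simps)
    then show "fourier_coeff f (k1, k2) * weyl_translation N (k1, k2) $$ (i, j)
        = fourier_coeff f (k1, k2) * (if k1 \<in> shift_set N i j then cis (2 * pi * of_int k2 * ?x k1) else 0)"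
      using ij by (simp only: weyl_translation_index shift_set_def mem_Collect_eq)
  qed
  also have "\<dots> = (\<Sum>\<^sub>\<infinity>k\<in>shift_set N i j. p_coeff f k (?x k))"
    by (rule infsum_fourier_coeff_rows[OF f])
  finally show ?thesis .
qed

text \<open>Conjugation by the Fourier matrix rotates phase space: \<open>T(k\<^sub>1, k\<^sub>2)\<close> becomes \<open>T(k\<^sub>2, - k\<^sub>1)\<close>.\<close>

lemma fourier_conj_translation:
  assumes rs: "r < N" "s < N"
  shows "(\<Sum>i<N. \<Sum>j<N. fourier_mat N $$ (r, i) * weyl_translation N (k1, k2) $$ (i, j) * adj (fourier_mat N) $$ (j, s))
    = (if k2 \<in> shift_set N r s then cis (- 2 * pi * of_int k1 * ((real s + of_int k2 / 2) / real N)) else 0)"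
proof -
  have N: "N > 0" using rs by simp
  let ?c = "complex_of_real (1 / sqrt (real N))"
  let ?i = "\<lambda>j. nat ((int j + k1) mod int N)"
  let ?u = "cis (pi * of_int k1 * of_int k2 / real N - 2 * pi * real r * of_int k1 / real N)"
  let ?t = "\<lambda>i j. fourier_mat N $$ (r, i) * weyl_translation N (k1, k2) $$ (i, j) * adj (fourier_mat N) $$ (j, s)"
  \<comment> \<open>Reducing \<open>j + k1\<close> modulo \<open>N\<close> changes the exponent by a
    multiple of 2 pi, as \<open>r\<close> is an integer.\<close>
  have per: "cis (- 2 * pi * real r * real (?i j) / real N) = cis (- 2 * pi * real r * (real j + of_int k1) / real N)" for j
  proof -
    have e: "real (?i j) = real j + of_int k1 - of_int ((int j + k1) div int N) * real N"
    proof -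
      have "int (?i j) = int j + k1 - ((int j + k1) div int N) * int N"
        using N by (simp add: minus_div_mult_eq_mod)
      then have "real_of_int (int (?i j)) = real_of_int (int j + k1 - ((int j + k1) div int N) * int N)"
        by (rule arg_cong)
      then show ?thesis by (simp only: of_int_of_nat_eq of_int_add of_int_diff of_int_mult)
    qed
    have "- 2 * pi * real r * real (?i j) / real N
        = - 2 * pi * real r * (real j + of_int k1) / real N + 2 * pi * of_int (int r * ((int j + k1) div int N))"
      unfolding e using N by (simp add: field_simps)
    then show ?thesis
      by (simp only: cis_mult[symmetric] cis_2pi_eq_1_iff) (simp add: cis_2pi_eq_1_iff[THEN iffD2])
  qed
  have inner: "(\<Sum>i<N. ?t i j)
      = ?u * (1 / of_nat N) *
        cis (2 * pi * of_int (int s + k2 - int r) * real j / real N)" if j: "j < N" for j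
  proof -
    have i: "?i j < N" using N by (simp add: nat_less_iff)
    have iff: "int i = (int j + k1) mod int N \<longleftrightarrow> i = ?i j" for i using N by auto
    have "(\<Sum>i<N. ?t i j)
      = (\<Sum>i<N. if i = ?i j then fourier_mat N $$ (r, i) * (cis (pi * of_int k1 * of_int k2 / real N) * cis (2 * pi * of_int k2 * real j / real N)) * adj (fourier_mat N) $$ (j, s) else 0)"
      using j by (intro sum.cong refl) (simp add: weyl_translation_index iff)
    also have "\<dots> = fourier_mat N $$ (r, ?i j) * (cis (pi * of_int k1 * of_int k2 / real N) * cis (2 * pi * of_int k2 * real j / real N)) * adj (fourier_mat N) $$ (j, s)"
      using i by (subst sum.delta) auto
    also have "\<dots> = (?c * ?c) * (cis (- 2 * pi * real r * (real j + of_int k1) / real N) * cis (pi * of_int k1 * of_int k2 / real N)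
        * cis (2 * pi * of_int k2 * real j / real N) * cis (2 * pi * real s * real j / real N))"
      using i j rs by (simp only: adj_index[OF fourier_mat_carrier] fourier_mat_index per)
        (simp add: cis_cnj mult_ac del: of_real_divide)
    also have "cis (- 2 * pi * real r * (real j + of_int k1) / real N) * cis (pi * of_int k1 * of_int k2 / real N)
        * cis (2 * pi * of_int k2 * real j / real N) * cis (2 * pi * real s * real j / real N)
      = ?u *
        cis (2 * pi * of_int (int s + k2 - int r) * real j / real N)"
      unfolding cis_mult by (rule arg_cong[where f = cis]) (use N in \<open>simp add: field_simps\<close>)
    finally show ?thesis by (simp only: sqrt_inverse_square[OF N] mult_ac)
  qed
  have "(\<Sum>i<N. \<Sum>j<N. ?t i j)
      = (\<Sum>j<N. ?u * (1 / of_nat N) *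
        cis (2 * pi * of_int (int s + k2 - int r) * real j / real N))"
    by (subst sum.swap) (rule sum.cong[OF refl], rule inner, simp)
  also have "\<dots> = ?u * (1 / of_nat N) *
        (if int N dvd int s + k2 - int r then of_nat N else 0)"
    by (simp only: sum_distrib_left[symmetric] sum_roots_of_unity[OF N])
  also have "\<dots> = (if k2 \<in> shift_set N r s then cis (- 2 * pi * of_int k1 * ((real s + of_int k2 / 2) / real N)) else 0)"
  proof (cases "int N dvd int s + k2 - int r")
    case True
    then have "k2 \<in> shift_set N r s"
      using rs by (auto simp: shift_set_def mod_eq_dvd_iff[symmetric])
    obtain m where m: "int s + k2 - int r = int N * m" using True by blast
    then have "real_of_int (int s + k2 - int r) = real_of_int (int N * m)" by presburger
    \<comment> \<open>Eliminating \<open>r\<close> in favour of \<open>s\<close> turns the phase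
      \<open>?u\<close> into the exponential at the midpoint, up to \<open>k1 * m\<close> full
      periods.\<close>
    then have r: "real r = real s + of_int k2 - real N * of_int m" by simp
    have "pi * of_int k1 * of_int k2 / real N - 2 * pi * real r * of_int k1 / real N
      = - 2 * pi * of_int k1 * ((real s + of_int k2 / 2) / real N) + 2 * pi * of_int (k1 * m)"
      unfolding r using N by (simp add: field_simps)
    then have "?u
      = cis (- 2 * pi * of_int k1 * ((real s + of_int k2 / 2) / real N)) * cis (2 * pi * of_int (k1 * m))"
      by (simp only: cis_mult)
    also have "cis (2 * pi * of_int (k1 * m)) = 1" by (simp only: cis_2pi_eq_1_iff) simp
    finally show ?thesis using True \<open>k2 \<in> shift_set N r s\<close> N by simp
  next
    case False
    then have "k2 \<notin> shift_set N r s"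
      using rs by (auto simp: shift_set_def)
    then show ?thesis using False by simp
  qed
  finally show ?thesis .
qed

lemma fourier_weyl_op_index:
  assumes f: "torus_smooth f" and rs: "r < N" "s < N"
  shows "(fourier_mat N * weyl_op N f * adj (fourier_mat N)) $$ (r, s)
    = (\<Sum>\<^sub>\<infinity>k\<in>shift_set N r s. q_coeff f k ((real s + of_int k / 2) / real N))"
proof -
  let ?F = "fourier_mat N"
  let ?x = "\<lambda>k. (real s + of_int k / 2) / real N"
  have "((\<lambda>k. \<Sum>i<N. \<Sum>j<N. ?F $$ (r, i) * (fourier_coeff f k * weyl_translation N k $$ (i, j)) * adj ?F $$ (j, s))
    has_sum (\<Sum>i<N. \<Sum>j<N. ?F $$ (r, i) * weyl_op N f $$ (i, j) * adj ?F $$ (j, s))) UNIV"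
    by (intro has_sum_finite_sum has_sum_cmult_left has_sum_cmult_right weyl_op_has_sum f) auto
  moreover have "(\<Sum>i<N. \<Sum>j<N. ?F $$ (r, i) * (fourier_coeff f k * weyl_translation N k $$ (i, j)) * adj ?F $$ (j, s))
     = fourier_coeff f k * (\<Sum>i<N. \<Sum>j<N. ?F $$ (r, i) * weyl_translation N k $$ (i, j) * adj ?F $$ (j, s))" for k
    by (simp add: sum_distrib_left mult_ac)
  ultimately have "((\<lambda>k. fourier_coeff f k * (\<Sum>i<N. \<Sum>j<N. ?F $$ (r, i) * weyl_translation N k $$ (i, j) * adj ?F $$ (j, s)))
    has_sum (?F * weyl_op N f * adj ?F) $$ (r, s)) UNIV"
    using rs by (simp add: mat_mult3_index[of _ N] del: index_mult_mat)
  then have "(?F * weyl_op N f * adj ?F) $$ (r, s)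
    = (\<Sum>\<^sub>\<infinity>k. fourier_coeff f k * (\<Sum>i<N. \<Sum>j<N. ?F $$ (r, i) * weyl_translation N k $$ (i, j) * adj ?F $$ (j, s)))"
    by (simp only: infsumI)
  also have "\<dots> = (\<Sum>\<^sub>\<infinity>(k1, k2). fourier_coeff f (k1, k2) * (if k2 \<in> shift_set N r s then cis (- 2 * pi * of_int k1 * ?x k2) else 0))"
    by (rule infsum_cong) (clarify, simp only: fourier_conj_translation[OF rs])
  also have "\<dots> = (\<Sum>\<^sub>\<infinity>k\<in>shift_set N r s. q_coeff f k (?x k))"
    by (rule infsum_fourier_coeff_cols[OF f])
  finally show ?thesis .
qed

section \<open>One step of the quantum baker's map on a half strip\<close>

text \<open>For a fixed row the sets \<open>shift_set N i j\<close> of different columns are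
  disjoint, and likewise for a fixed column. So each row sum and each column sum of the majorants is
  at most the sum of \<open>w\<close> over all integers, whatever \<open>N\<close> is.\<close>

lemma schur_shift_set:
  assumes W: "W \<in> carrier_mat N N"
    and w: "\<And>k. 0 \<le> w k" "w summable_on UNIV"
    and b: "\<And>r s. r < N \<Longrightarrow> s < N \<Longrightarrow> cmod (W $$ (r, s)) \<le> infsum w (shift_set N r s)"
  shows "op_bound W (infsum w UNIV)"
proof -
  have part: "(\<Sum>i<N. infsum w (S i)) \<le> infsum w UNIV"
    if disj: "\<And>i j k. i < N \<Longrightarrow> j < N \<Longrightarrow> k \<in> S i \<Longrightarrow> k \<in> S j \<Longrightarrow> i = j" for S :: "nat \<Rightarrow> int set"
  proof (rule has_sum_mono)
    have "((\<lambda>k. if k \<in> S i then w k else 0) has_sum infsum w (S i)) UNIV" for i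
    proof -
      have "(w has_sum infsum w (S i)) (S i)"
        by (rule has_sum_infsum) (rule summable_on_subset[OF w(2)], simp)
      then show ?thesis by (rule has_sum_cong_neutral[THEN iffD1, rotated -1]) auto
    qed
    then show "((\<lambda>k. \<Sum>i<N. if k \<in> S i then w k else 0) has_sum (\<Sum>i<N. infsum w (S i))) UNIV"
      by (intro has_sum_finite_sum) auto
    show "(w has_sum infsum w UNIV) UNIV" by (rule has_sum_infsum[OF w(2)])
    fix k
    show "(\<Sum>i<N. if k \<in> S i then w k else 0) \<le> w k"
    proof (cases "\<exists>i<N. k \<in> S i")
      case True
      then obtain i where i: "i < N" "k \<in> S i" by blast
      have "(\<Sum>j<N. if k \<in> S j then w k else 0) = (\<Sum>j<N. if j = i then w k else 0)"
        using disj i by (intro sum.cong refl) auto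
      then show ?thesis using i by simp
    next
      case False
      then have "(\<Sum>i<N. if k \<in> S i then w k else 0) = 0" by (intro sum.neutral) auto
      then show ?thesis using w(1) by simp
    qed
  qed
  show ?thesis
  proof (rule schur_test[OF W])
    show "0 \<le> infsum w UNIV" by (rule infsum_nonneg) (rule w(1))
    fix i assume i: "i < N"
    have "(\<Sum>j<N. cmod (W $$ (i, j))) \<le> (\<Sum>j<N. infsum w (shift_set N i j))"
      by (intro sum_mono b i) simp
    also have "\<dots> \<le> infsum w UNIV"
    proof (rule part)
      fix j j' k assume *: "j < N" "j' < N" "k \<in> shift_set N i j" "k \<in> shift_set N i j'"
      then have "(int j + k) mod int N = (int j' + k) mod int N" by (simp add: shift_set_def)
      then have "int N dvd (int j + k) - (int j' + k)" by (simp only: mod_eq_dvd_iff)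
      then have "int N dvd int j - int j'" by simp
      then have "int j mod int N = int j' mod int N" by (simp only: mod_eq_dvd_iff)
      then show "j = j'" using * by simp
    qed
    finally show "(\<Sum>j<N. cmod (W $$ (i, j))) \<le> infsum w UNIV" .
  next
    fix j assume j: "j < N"
    have "(\<Sum>i<N. cmod (W $$ (i, j))) \<le> (\<Sum>i<N. infsum w (shift_set N i j))"
      by (intro sum_mono b j) simp
    also have "\<dots> \<le> infsum w UNIV"
      by (rule part) (auto simp: shift_set_def)
    finally show "(\<Sum>i<N. cmod (W $$ (i, j))) \<le> infsum w UNIV" .
  qed
qed

section \<open>Truncation to a half block, and dilation\<close>

definition half_range :: "nat \<Rightarrow> nat \<Rightarrow> nat set" where
  "half_range M e = {e * M..<e * M + M}"

lemma half_range_less: "e < 2 \<Longrightarrow> r \<in> half_range M e \<Longrightarrow> r < 2 * M"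
  by (auto simp: half_range_def less_2_cases_iff)

definition half_cut :: "nat \<Rightarrow> nat \<Rightarrow> complex mat \<Rightarrow> complex mat" where
  "half_cut M e X = Matrix.mat (2 * M) (2 * M)
     (\<lambda>(i, j). if i \<in> half_range M e \<and> j \<in> half_range M e then X $$ (i, j) else 0)"

text \<open>The compression of \<open>H\<close> to even indices, placed on half block
  \<open>e\<close>. The factor 2 is the squared ratio of the normalising constants of the Fourier
  matrices of sizes \<open>M\<close> and \<open>2 * M\<close>.\<close>

definition dilate :: "nat \<Rightarrow> nat \<Rightarrow> complex mat \<Rightarrow> complex mat" where
  "dilate M e H = Matrix.mat (2 * M) (2 * M)
     (\<lambda>(r, s). if r \<in> half_range M e \<and> s \<in> half_range M e
        then 2 * H $$ (2 * (r - e * M), 2 * (s - e * M)) else 0)"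

lemma half_cut_carrier [simp]: "half_cut M e X \<in> carrier_mat (2 * M) (2 * M)"
  and dilate_carrier [simp]: "dilate M e X \<in> carrier_mat (2 * M) (2 * M)"
  by (simp_all add: half_cut_def dilate_def)

lemma sum_half_range:
  assumes "e < 2"
  shows "(\<Sum>r<2 * M. if r \<in> half_range M e then g r else 0) = (\<Sum>r<M. g (r + e * M) :: 'a::comm_monoid_add)"
proof -
  have "(\<Sum>r<2 * M. if r \<in> half_range M e then g r else 0) = (\<Sum>r\<in>{..<2 * M} \<inter> half_range M e. g r)"
    by (simp add: sum.inter_restrict)
  also have "{..<2 * M} \<inter> half_range M e = (\<lambda>r. r + e * M) ` {..<M}"
  proof (rule equalityI; rule subsetI)
    fix x assume "x \<in> {..<2 * M} \<inter> half_range M e"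
    then show "x \<in> (\<lambda>r. r + e * M) ` {..<M}"
      by (intro image_eqI[of _ _ "x - e * M"]) (auto simp: half_range_def)
  next
    fix x assume "x \<in> (\<lambda>r. r + e * M) ` {..<M}"
    then show "x \<in> {..<2 * M} \<inter> half_range M e"
      using half_range_less[OF assms, of x M] by (auto simp: half_range_def)
  qed
  also have "(\<Sum>r\<in>(\<lambda>r. r + e * M) ` {..<M}. g r) = (\<Sum>r<M. g (r + e * M))"
    by (subst sum.reindex) (auto simp: inj_on_def)
  finally show ?thesis .
qed

lemma sum_even:
  "(\<Sum>s<2 * (M::nat). if even s then g (s div 2) else 0) = (\<Sum>s<M. g s :: 'a::comm_monoid_add)"
  by (induction M) auto

text \<open>Apart from the factor 2, the matrix spreads one half of a vector over the even
  positions, applies \<open>H\<close> and reads off the even positions; neither the spreading nor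
  the reading increases the norm.\<close>

lemma op_bound_dilate:
  assumes H: "H \<in> carrier_mat (2 * M) (2 * M)" and b: "op_bound H c" "0 \<le> c" and e: "e < 2"
  shows "op_bound (dilate M e H) (2 * c)"
  unfolding op_bound_def
proof
  let ?I = "half_range M e"
  fix v :: "complex vec" assume "v \<in> carrier_vec (dim_col (dilate M e H))"
  then have v: "v \<in> carrier_vec (2 * M)" by (simp add: dilate_def)
  define w where "w = Matrix.vec (2 * M) (\<lambda>s. if even s then v $ (s div 2 + e * M) else 0)"
  have w: "w \<in> carrier_vec (2 * M)" by (simp add: w_def)
  have idx: "(dilate M e H *\<^sub>v v) $ r = (if r \<in> ?I then 2 * (H *\<^sub>v w) $ (2 * (r - e * M)) else 0)"
    if r: "r < 2 * M" for r
  proof -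
    have "(dilate M e H *\<^sub>v v) $ r = (\<Sum>s<2 * M. if s \<in> ?I then (if r \<in> ?I then 2 * H $$ (2 * (r - e * M), 2 * (s - e * M)) * v $ s else 0) else 0)"
      unfolding mat_mult_vec_index[OF dilate_carrier v r]
      by (intro sum.cong refl) (use r in \<open>auto simp: dilate_def\<close>)
    also have "\<dots> = (if r \<in> ?I then 2 * (\<Sum>s<M. H $$ (2 * (r - e * M), 2 * s) * v $ (s + e * M)) else 0)"
      unfolding sum_half_range[OF e] by (simp add: sum_distrib_left mult.assoc)
    also have "(\<Sum>s<M. H $$ (2 * (r - e * M), 2 * s) * v $ (s + e * M))
      = (\<Sum>s<2 * M. if even s then H $$ (2 * (r - e * M), 2 * (s div 2)) * v $ (s div 2 + e * M) else 0)"
      by (rule sum_even[symmetric])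
    also have "\<dots> = (\<Sum>s<2 * M. H $$ (2 * (r - e * M), s) * w $ s)"
      by (intro sum.cong refl) (auto simp: w_def)
    also have "(if r \<in> ?I then 2 * (\<Sum>s<2 * M. H $$ (2 * (r - e * M), s) * w $ s) else 0)
      = (if r \<in> ?I then 2 * (H *\<^sub>v w) $ (2 * (r - e * M)) else 0)"
      using mat_mult_vec_index[OF H w, of "2 * (r - e * M)"] by (auto simp: half_range_def simp del: index_mult_mat_vec)
    finally show ?thesis .
  qed
  have even_le: "(\<Sum>r<M. g (2 * r)) \<le> (\<Sum>r<2 * M. g r)" if "\<And>r. 0 \<le> g r" for g :: "nat \<Rightarrow> real"
    unfolding sum_even[symmetric, of "\<lambda>r. g (2 * r)"] by (intro sum_mono) (use that in auto)
  have half_le: "(\<Sum>r<M. g (r + e * M)) \<le> (\<Sum>r<2 * M. g r)" if "\<And>r. 0 \<le> g r" for g :: "nat \<Rightarrow> real"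
    unfolding sum_half_range[OF e, symmetric] by (intro sum_mono) (use that in auto)
  have dim: "dim_vec (dilate M e H *\<^sub>v v) = 2 * M" "dim_vec (H *\<^sub>v w) = 2 * M" "dim_vec w = 2 * M" "dim_vec v = 2 * M"
    using H v by (simp_all add: dilate_def w_def)
  have "(vec_l2_norm (dilate M e H *\<^sub>v v))\<^sup>2
      = (\<Sum>r<2 * M. if r \<in> ?I then 4 * (cmod ((H *\<^sub>v w) $ (2 * (r - e * M))))\<^sup>2 else 0)"
    unfolding vec_l2_norm_square dim
    by (intro sum.cong refl) (simp add: idx norm_mult power_mult_distrib del: index_mult_mat_vec)
  also have "\<dots> = 4 * (\<Sum>r<M. (cmod ((H *\<^sub>v w) $ (2 * r)))\<^sup>2)"
    unfolding sum_half_range[OF e] by (simp add: sum_distrib_left)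
  also have "\<dots> \<le> 4 * (\<Sum>r<2 * M. (cmod ((H *\<^sub>v w) $ r))\<^sup>2)"
    by (intro mult_left_mono even_le) auto
  also have "\<dots> = (2 * vec_l2_norm (H *\<^sub>v w))\<^sup>2"
    by (simp only: power_mult_distrib vec_l2_norm_square dim) simp
  finally have 1: "vec_l2_norm (dilate M e H *\<^sub>v v) \<le> 2 * vec_l2_norm (H *\<^sub>v w)"
    by (rule power2_le_imp_le) (simp add: vec_l2_norm_nonneg)
  have "(vec_l2_norm w)\<^sup>2 = (\<Sum>s<2 * M. if even s then (cmod (v $ (s div 2 + e * M)))\<^sup>2 else 0)"
    unfolding vec_l2_norm_square dim by (intro sum.cong refl) (simp add: w_def)
  also have "\<dots> = (\<Sum>s<M. (cmod (v $ (s + e * M)))\<^sup>2)" by (rule sum_even)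
  also have "\<dots> \<le> (\<Sum>s<2 * M. (cmod (v $ s))\<^sup>2)" by (rule half_le) simp
  also have "\<dots> = (vec_l2_norm v)\<^sup>2" by (simp only: vec_l2_norm_square dim)
  finally have 2: "vec_l2_norm w \<le> vec_l2_norm v"
    by (rule power2_le_imp_le) (rule vec_l2_norm_nonneg)
  have "vec_l2_norm (H *\<^sub>v w) \<le> c * vec_l2_norm w" using b(1) w H by (auto simp: op_bound_def)
  also have "\<dots> \<le> c * vec_l2_norm v" by (rule mult_left_mono[OF 2 b(2)])
  finally show "vec_l2_norm (dilate M e H *\<^sub>v v) \<le> 2 * c * vec_l2_norm v" using 1 by linarith
qed

text \<open>Moving the column by \<open>e * M\<close> changes the exponent in an even row by a
  multiple of 2 pi, so one formula covers both halves.\<close>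

lemma baker_block_fourier:
  assumes e: "e < 2" and r: "r \<in> half_range M e" and i: "i \<in> half_range M e"
  shows "baker_block M $$ (r, i) = complex_of_real (sqrt 2) * fourier_mat (2 * M) $$ (2 * (r - e * M), i)"
proof -
  have M: "M > 0" using r by (auto simp: half_range_def)
  define r' i' where "r' = r - e * M" and "i' = i - e * M"
  have lt: "r' < M" "i' < M" and ri: "r = r' + e * M" "i = i' + e * M"
    using r i by (auto simp: r'_def i'_def half_range_def)
  have "baker_block M $$ (r, i) = fourier_mat M $$ (r', i')"
    using e lt half_range_less[OF e r] half_range_less[OF e i]
    by (auto simp: baker_block_index ri less_2_cases_iff)
  also have "\<dots> = complex_of_real (1 / sqrt (real M)) * cis (- 2 * pi * real r' * real i' / real M)"
    using lt by (simp add: fourier_mat_index)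
  also have "cis (- 2 * pi * real r' * real i' / real M) = cis (- 2 * pi * real (2 * r') * real i / real (2 * M))"
  proof -
    have "- 2 * pi * real (2 * r') * real i / real (2 * M)
      = - 2 * pi * real r' * real i' / real M + 2 * pi * of_int (- (int r' * int e))"
      using M by (simp add: ri field_simps)
    then have "cis (- 2 * pi * real (2 * r') * real i / real (2 * M))
      = cis (- 2 * pi * real r' * real i' / real M) * cis (2 * pi * of_int (- (int r' * int e)))"
      by (simp only: cis_mult)
    also have "cis (2 * pi * of_int (- (int r' * int e))) = 1" by (simp only: cis_2pi_eq_1_iff) simp
    finally show ?thesis by simp
  qed
  also have "complex_of_real (1 / sqrt (real M)) = complex_of_real (sqrt 2) * complex_of_real (1 / sqrt (real (2 * M)))"
    unfolding of_real_mult[symmetric] using M by (simp add: real_sqrt_mult)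
  finally show ?thesis
    using lt half_range_less[OF e i] by (simp add: fourier_mat_index r'_def)
qed

text \<open>The truncated matrix sees only the columns of the block transform in half
  \<open>e\<close>. There its rows of half \<open>e\<close> are multiples of even rows of the full
  transform, and its other rows vanish. Without the truncation the columns of the other half would
  enter.\<close>

lemma baker_block_conj_cut:
  assumes e: "e < 2"
  shows "baker_block M * half_cut M e X * adj (baker_block M)
    = dilate M e (fourier_mat (2 * M) * half_cut M e X * adj (fourier_mat (2 * M)))"
proof (rule eq_matI)
  let ?N = "2 * M" and ?I = "half_range M e" and ?G = "baker_block M" and ?C = "half_cut M e X"
  let ?F = "fourier_mat (2 * M)"
  fix r s assume "r < dim_row (dilate M e (?F * ?C * adj ?F))" "s < dim_col (dilate M e (?F * ?C * adj ?F))"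
  then have rs: "r < ?N" "s < ?N" by (simp_all add: dilate_def)
  have zero: "?G $$ (r, i) = 0" if "r < ?N" "r \<notin> ?I" "i \<in> ?I" for r i
    using that e half_range_less[OF e that(3)]
    by (auto simp: baker_block_index half_range_def less_2_cases_iff)
  have C0: "?C $$ (i, j) = 0" if "i < ?N" "j < ?N" "\<not> (i \<in> ?I \<and> j \<in> ?I)" for i j
    using that by (auto simp: half_cut_def)
  have lhs: "(?G * ?C * adj ?G) $$ (r, s) = (\<Sum>i<?N. \<Sum>j<?N. ?G $$ (r, i) * ?C $$ (i, j) * cnj (?G $$ (s, j)))"
    unfolding mat_mult3_index[OF baker_block_carrier half_cut_carrier adj_carrier[OF baker_block_carrier] rs]
    using rs by (intro sum.cong refl) (simp add: adj_index[OF baker_block_carrier])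
  show "(?G * ?C * adj ?G) $$ (r, s) = dilate M e (?F * ?C * adj ?F) $$ (r, s)"
  proof (cases "r \<in> ?I \<and> s \<in> ?I")
    case True
    let ?r = "2 * (r - e * M)" and ?s = "2 * (s - e * M)"
    have lt: "?r < ?N" "?s < ?N" using True by (auto simp: half_range_def)
    have "dilate M e (?F * ?C * adj ?F) $$ (r, s) = 2 * (?F * ?C * adj ?F) $$ (?r, ?s)"
      using rs True by (simp add: dilate_def del: index_mult_mat)
    also have "\<dots> = 2 * (\<Sum>i<?N. \<Sum>j<?N. ?F $$ (?r, i) * ?C $$ (i, j) * cnj (?F $$ (?s, j)))"
      unfolding mat_mult3_index[OF fourier_mat_carrier half_cut_carrier adj_carrier[OF fourier_mat_carrier] lt]
      using lt by (intro arg_cong2[of _ _ _ _ "(*)"] refl sum.cong) (simp add: adj_index[OF fourier_mat_carrier])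
    also have "\<dots> = (\<Sum>i<?N. \<Sum>j<?N. 2 * (?F $$ (?r, i) * ?C $$ (i, j) * cnj (?F $$ (?s, j))))"
      by (simp add: sum_distrib_left)
    also have "\<dots> = (\<Sum>i<?N. \<Sum>j<?N. ?G $$ (r, i) * ?C $$ (i, j) * cnj (?G $$ (s, j)))"
    proof (intro sum.cong refl)
      fix i j assume ij: "i \<in> {..<?N}" "j \<in> {..<?N}"
      have sq: "complex_of_real (sqrt 2) * complex_of_real (sqrt 2) = 2"
        unfolding of_real_mult[symmetric] by simp
      show "2 * (?F $$ (?r, i) * ?C $$ (i, j) * cnj (?F $$ (?s, j))) = ?G $$ (r, i) * ?C $$ (i, j) * cnj (?G $$ (s, j))"
      proof (cases "i \<in> ?I \<and> j \<in> ?I")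
        case True': True
        have "?G $$ (r, i) * ?C $$ (i, j) * cnj (?G $$ (s, j))
          = (complex_of_real (sqrt 2) * complex_of_real (sqrt 2)) * (?F $$ (?r, i) * ?C $$ (i, j) * cnj (?F $$ (?s, j)))"
          using True True' by (simp add: baker_block_fourier[OF e])
        then show ?thesis by (simp only: sq)
      next
        case False
        then show ?thesis using C0[of i j] ij by simp
      qed
    qed
    finally show ?thesis using lhs by simp
  next
    case False
    have "(\<Sum>i<?N. \<Sum>j<?N. ?G $$ (r, i) * ?C $$ (i, j) * cnj (?G $$ (s, j))) = 0"
    proof (intro sum.neutral ballI)
      fix i j assume ij: "i \<in> {..<?N}" "j \<in> {..<?N}"
      show "?G $$ (r, i) * ?C $$ (i, j) * cnj (?G $$ (s, j)) = 0"
        using False zero[OF rs(1), of i] zero[OF rs(2), of j] C0[of i j] ij by auto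
    qed
    moreover have "dilate M e (?F * ?C * adj ?F) $$ (r, s) = 0"
      using False rs by (auto simp: dilate_def simp del: index_mult_mat)
    ultimately show ?thesis using lhs by simp
  qed
qed (simp_all add: dilate_def carrier_matD[OF baker_block_carrier])

section \<open>Estimates for the terms whose path meets a line of zeros\<close>

lemma norm_infsum_le_infsum:
  fixes f :: "int \<Rightarrow> complex"
  assumes "\<And>k. k \<in> A \<Longrightarrow> cmod (f k) \<le> w k" "w summable_on UNIV" "\<And>k. 0 \<le> w k" "A \<subseteq> B"
  shows "cmod (infsum f A) \<le> infsum w B"
proof -
  have wA: "w summable_on A" and wB: "w summable_on B" by (rule summable_on_subset[OF assms(2)], simp)+
  have fs: "(\<lambda>k. cmod (f k)) summable_on A"
    by (rule summable_on_comparison_test[OF wA]) (use assms in auto)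
  have "cmod (infsum f A) \<le> infsum (\<lambda>k. cmod (f k)) A"
    by (rule norm_infsum_bound[OF fs])
  also have "\<dots> \<le> infsum w A" by (rule infsum_mono[OF fs wA]) (rule assms(1))
  also have "\<dots> \<le> infsum w B"
    by (rule infsum_mono_neutral[OF wA wB]) (use assms in auto)
  finally show ?thesis .
qed

text \<open>The term \<open>k = 0\<close> is 0 because \<open>1 / 0\<close> is 0, so the value is
  pi^2 / 3.\<close>

definition inv_sq_sum :: real where
  "inv_sq_sum = (\<Sum>\<^sub>\<infinity>k::int. 1 / (of_int k)\<^sup>2)"

lemma inv_sq_sum_nonneg: "0 \<le> inv_sq_sum"
  unfolding inv_sq_sum_def by (rule infsum_nonneg) simp

text \<open>Each entry is allowed its own series and its own index set inside the residue class, so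
  that a main term can be left out or a sign changed before the estimate.\<close>

lemma schur_inv_sq:
  assumes W: "W \<in> carrier_mat N N" and D: "0 \<le> D"
    and b: "\<And>r s. r < N \<Longrightarrow> s < N \<Longrightarrow> \<exists>f A. W $$ (r, s) = infsum f A \<and> A \<subseteq> shift_set N r s \<and>
      (\<forall>k\<in>A. cmod (f k) \<le> D / real N * (1 / (of_int k)\<^sup>2))"
  shows "op_bound W (D / real N * inv_sq_sum)"
proof -
  let ?w = "\<lambda>k::int. D / real N * (1 / (of_int k)\<^sup>2)"
  have s: "?w summable_on UNIV" by (intro summable_on_cmult_right summable_on_inverse_square_int)
  have n: "0 \<le> ?w k" for k using D by simp
  have "op_bound W (infsum ?w UNIV)"
  proof (rule schur_shift_set[OF W n s])
    fix r t assume "r < N" "t < N"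
    then obtain f A where "W $$ (r, t) = infsum f A" "A \<subseteq> shift_set N r t" "\<forall>k\<in>A. cmod (f k) \<le> ?w k"
      using b by blast
    then show "cmod (W $$ (r, t)) \<le> infsum ?w (shift_set N r t)"
      using norm_infsum_le_infsum[of A f ?w "shift_set N r t"] s n by simp
  qed
  also have "infsum ?w UNIV = D / real N * inv_sq_sum"
    unfolding inv_sq_sum_def by (intro infsum_cmult_right summable_on_inverse_square_int)
  finally show ?thesis .
qed

lemma shift_set_residue:
  assumes "k \<in> shift_set N r s"
  obtains m :: int where "int s + k = int r + int N * m"
proof -
  have "int s + k = int r + int N * ((int s + k) div int N)"
    using assms by (simp add: shift_set_def)
  then show ?thesis by (rule that)
qed

lemma main_term_in_shift_set: "r < N \<Longrightarrow> int r - int s \<in> shift_set N r s"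
  by (simp add: shift_set_def)

text \<open>Some multiple of \<open>N\<close> lies between \<open>s\<close> and \<open>s + k\<close>.\<close>

lemma shift_set_crossing:
  assumes rs: "r < N" "s < N" and k: "k \<in> shift_set N r s" "k \<noteq> int r - int s"
  obtains t :: int where "\<bar>(real s + of_int k / 2) / real N - of_int t\<bar> \<le> \<bar>of_int k\<bar> / (2 * real N)"
proof -
  have N: "real N > 0" using rs by simp
  obtain m where m: "int s + k = int r + int N * m" using shift_set_residue[OF k(1)] .
  have "m \<noteq> 0" using m k(2) by auto
  \<comment> \<open>\<open>m\<close> counts the wraps of the path. For positive \<open>m\<close> it
    passes \<open>N\<close>, for negative \<open>m\<close> it passes 0, as \<open>r\<close> and
    \<open>s\<close> are at least 0 and less than \<open>N\<close>.\<close>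
  have "\<exists>t::int. int s \<le> int N * t \<and> int N * t \<le> int s + k \<or> int s + k \<le> int N * t \<and> int N * t \<le> int s"
  proof (cases "m > 0")
    case True
    then have "int N * 1 \<le> int N * m" by (intro mult_left_mono) auto
    then have "int s \<le> int N * 1 \<and> int N * 1 \<le> int s + k" using m rs by linarith
    then show ?thesis by blast
  next
    case False
    then have "int N * m \<le> int N * (- 1)" using \<open>m \<noteq> 0\<close> by (intro mult_left_mono) auto
    then have "int s + k \<le> int N * 0 \<and> int N * 0 \<le> int s" using m rs by linarith
    then show ?thesis by blast
  qed
  then obtain t :: int where t: "int s \<le> int N * t \<and> int N * t \<le> int s + k \<or> int s + k \<le> int N * t \<and> int N * t \<le> int s"
    by blast
  have "real_of_int (int s) \<le> real_of_int (int N * t) \<and> real_of_int (int N * t) \<le> real_of_int (int s + k)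
    \<or> real_of_int (int s + k) \<le> real_of_int (int N * t) \<and> real_of_int (int N * t) \<le> real_of_int (int s)"
    using t by (simp only: of_int_le_iff)
  \<comment> \<open>A point of a segment is at most half its length away from the midpoint.\<close>
  then have "\<bar>real s + of_int k / 2 - real N * of_int t\<bar> \<le> \<bar>of_int k\<bar> / 2"
    by (auto simp: abs_if)
  then have "\<bar>real s + of_int k / 2 - real N * of_int t\<bar> / real N \<le> \<bar>of_int k\<bar> / 2 / real N"
    using N by (intro divide_right_mono) auto
  moreover have "(real s + of_int k / 2) / real N - of_int t = (real s + of_int k / 2 - real N * of_int t) / real N"
    using N by (simp add: field_simps)
  ultimately have "\<bar>(real s + of_int k / 2) / real N - of_int t\<bar> \<le> \<bar>of_int k\<bar> / (2 * real N)"
    using N by (simp add: abs_divide)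
  then show ?thesis by (rule that)
qed

text \<open>Both ends of the path are half its length away from the midpoint. This serves when an
  end itself lies on a line of zeros.\<close>

lemma half_step_dist: 
  assumes "N > (0::nat)"
  shows "\<bar>(real s + of_int k / 2) / real N - real s / real N\<bar> \<le> \<bar>of_int k\<bar> / (2 * real N)"
    and "\<bar>(real s + of_int k / 2) / real N - (real s + of_int k) / real N\<bar> \<le> \<bar>of_int k\<bar> / (2 * real N)"
proof -
  have "(real s + of_int k / 2) / real N - real s / real N = of_int k / (2 * real N)"
    "(real s + of_int k / 2) / real N - (real s + of_int k) / real N = - (of_int k / (2 * real N))"
    using assms by (simp_all add: field_simps)
  then show "\<bar>(real s + of_int k / 2) / real N - real s / real N\<bar> \<le> \<bar>of_int k\<bar> / (2 * real N)"
    "\<bar>(real s + of_int k / 2) / real N - (real s + of_int k) / real N\<bar> \<le> \<bar>of_int k\<bar> / (2 * real N)"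
    by (simp_all add: abs_divide)
qed

text \<open>An entry off the block has an end of its path outside the half strip: the start
  \<open>j\<close>, or the end \<open>j + k\<close>, which is \<open>i\<close> up to a multiple of
  \<open>2 * M\<close>. The symbol is 0 on the position line through that end.\<close>

lemma weyl_op_minus_cut:
  assumes a: "torus_smooth a" and M: "M > 0"
    and z: "\<And>i p. i < 2 * M \<Longrightarrow> i \<notin> half_range M e \<Longrightarrow> a (real i / real (2 * M), p) = 0"
  shows "op_bound (weyl_op (2 * M) a - half_cut M e (weyl_op (2 * M) a))
    (mixed_norm 1 3 a / real (2 * M) * inv_sq_sum)"
proof (rule schur_inv_sq)
  let ?N = "2 * M" and ?I = "half_range M e"
  have N: "?N > 0" using M by simp
  show "weyl_op ?N a - half_cut M e (weyl_op ?N a) \<in> carrier_mat ?N ?N" by (intro minus_carrier_mat half_cut_carrier)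
  show "0 \<le> mixed_norm 1 3 a" by (rule mixed_norm_nonneg[OF a])
  fix i j assume ij: "i < ?N" "j < ?N"
  let ?x = "\<lambda>k. (real j + of_int k / 2) / real ?N"
  have idx: "(weyl_op ?N a - half_cut M e (weyl_op ?N a)) $$ (i, j) =
    (if i \<in> ?I \<and> j \<in> ?I then 0 else weyl_op ?N a $$ (i, j))"
    using ij by (simp add: half_cut_def carrier_matD[OF weyl_op_carrier])
  show "\<exists>f A. (weyl_op ?N a - half_cut M e (weyl_op ?N a)) $$ (i, j) = infsum f A \<and> A \<subseteq> shift_set ?N i j \<and>
      (\<forall>k\<in>A. cmod (f k) \<le> mixed_norm 1 3 a / real ?N * (1 / (of_int k)\<^sup>2))"
  proof (cases "i \<in> ?I \<and> j \<in> ?I")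
    case True
    then show ?thesis unfolding idx by (intro exI[of _ "\<lambda>_. 0"] exI[of _ "{}"]) simp
  next
    case False
    have "cmod (p_coeff a k (?x k)) \<le> mixed_norm 1 3 a / real ?N * (1 / (of_int k)\<^sup>2)"
      if k: "k \<in> shift_set ?N i j" for k
    proof (cases "j \<in> ?I")
      case False
      show ?thesis
        by (rule norm_p_coeff_vanishing[OF a N _ half_step_dist(1)[OF N]]) (rule z[OF ij(2) False])
    next
      case True
      then have i: "i \<notin> ?I" using False by simp
      obtain m where "int j + k = int i + int ?N * m" using shift_set_residue[OF k] .
      then have "real_of_int (int j + k) = real_of_int (int i + int ?N * m)" by (rule arg_cong)
      then have "(real j + of_int k) / real ?N = real i / real ?N + of_int m"
        using N by (simp add: field_simps)
      then have "a ((real j + of_int k) / real ?N, p) = 0" for p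
        using torus_smooth_periodic[OF a, of _ m p 0] z[OF ij(1) i, of p] by simp
      then show ?thesis
        by (rule norm_p_coeff_vanishing[OF a N _ half_step_dist(2)[OF N]])
    qed
    then show ?thesis
      unfolding idx if_not_P[OF False] weyl_op_index[OF a ij]
      by (intro exI[of _ "\<lambda>k. p_coeff a k (?x k)"] exI[of _ "shift_set ?N i j"]) simp
  qed
qed

lemma infsum_remove_main:
  assumes f: "torus_smooth f" and r: "r < N"
  shows "(\<Sum>\<^sub>\<infinity>k\<in>shift_set N r s. q_coeff f k ((real s + of_int k / 2) / real N))
    = q_coeff f (int r - int s) ((real r + real s) / (2 * real N))
    + (\<Sum>\<^sub>\<infinity>k\<in>shift_set N r s - {int r - int s}. q_coeff f k ((real s + of_int k / 2) / real N))"
proof -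
  let ?f = "\<lambda>k. q_coeff f k ((real s + of_int k / 2) / real N)" and ?k = "int r - int s"
  have s: "?f summable_on A" for A by (rule abs_summable_summable[OF q_coeff_abs_summable[OF f]])
  have "shift_set N r s = {?k} \<union> (shift_set N r s - {?k})" using main_term_in_shift_set[OF r] by auto
  then have "infsum ?f (shift_set N r s) = infsum ?f ({?k} \<union> (shift_set N r s - {?k}))" by simp
  also have "\<dots> = infsum ?f {?k} + infsum ?f (shift_set N r s - {?k})"
    by (rule infsum_Un_disjoint[OF s s]) simp
  also have "infsum ?f {?k} = q_coeff f ?k ((real r + real s) / (2 * real N))"
    using r by (simp add: field_simps)
  finally show ?thesis .
qed

text \<open>A multiple of \<open>N\<close> on the path is an integer momentum, where the symbol
  vanishes by periodicity.\<close>

lemma norm_q_coeff_crossing: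
  assumes f: "torus_smooth f" and z: "\<And>q. f (q, 0) = 0"
    and rs: "r < N" "s < N" and k: "k \<in> shift_set N r s - {int r - int s}"
  shows "cmod (q_coeff f k ((real s + of_int k / 2) / real N)) \<le> mixed_norm 3 1 f / real N * (1 / (of_int k)\<^sup>2)"
proof -
  obtain t :: int where t: "\<bar>(real s + of_int k / 2) / real N - of_int t\<bar> \<le> \<bar>of_int k\<bar> / (2 * real N)"
    using shift_set_crossing[OF rs] k by blast
  show ?thesis
    by (rule norm_q_coeff_vanishing[OF f _ _ t])
       (use rs z torus_smooth_periodic[OF f, of _ 0 0 t] in auto)
qed

text \<open>The terms \<open>k = r - s\<close> of the momentum matrix: those whose path does not
  wrap around the torus.\<close>

definition main_mat :: "nat \<Rightarrow> plane_fun \<Rightarrow> complex mat" where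
  "main_mat N f = Matrix.mat N N (\<lambda>(r, s). q_coeff f (int r - int s) ((real r + real s) / (2 * real N)))"

lemma main_mat_carrier [simp]: "main_mat N f \<in> carrier_mat N N"
  by (simp add: main_mat_def)

lemma fourier_conj_carrier [simp]:
  "X \<in> carrier_mat N N \<Longrightarrow> fourier_mat N * X * adj (fourier_mat N) \<in> carrier_mat N N"
  by (intro mult_carrier_mat[of _ N N _ N] adj_carrier fourier_mat_carrier)

lemma fourier_weyl_op_minus_main:
  assumes f: "torus_smooth f" and z: "\<And>q. f (q, 0) = 0"
  shows "op_bound (fourier_mat N * weyl_op N f * adj (fourier_mat N) - main_mat N f)
    (mixed_norm 3 1 f / real N * inv_sq_sum)"
proof (rule schur_inv_sq)
  let ?H = "fourier_mat N * weyl_op N f * adj (fourier_mat N)"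
  show "?H - main_mat N f \<in> carrier_mat N N" by (intro minus_carrier_mat main_mat_carrier)
  show "0 \<le> mixed_norm 3 1 f" by (rule mixed_norm_nonneg[OF f])
  fix r s assume rs: "r < N" "s < N"
  have "(?H - main_mat N f) $$ (r, s) = ?H $$ (r, s) - q_coeff f (int r - int s) ((real r + real s) / (2 * real N))"
    using rs by (simp add: main_mat_def del: index_mult_mat)
  also have "\<dots> = (\<Sum>\<^sub>\<infinity>k\<in>shift_set N r s - {int r - int s}. q_coeff f k ((real s + of_int k / 2) / real N))"
    unfolding fourier_weyl_op_index[OF f rs] infsum_remove_main[OF f rs(1)] by simp
  finally show "\<exists>g A. (?H - main_mat N f) $$ (r, s) = infsum g A \<and> A \<subseteq> shift_set N r s \<and>
      (\<forall>k\<in>A. cmod (g k) \<le> mixed_norm 3 1 f / real N * (1 / (of_int k)\<^sup>2))"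
    using norm_q_coeff_crossing[OF f z rs] by blast
qed

text \<open>Inside the block the main terms cancel by \<open>main\<close>, and what is left wraps
  around. Outside the block \<open>b\<close> vanishes on the momentum line through one end of each
  path, so there the whole entry is small, main term included.\<close>

lemma dilate_main_minus_fourier_weyl_op:
  assumes b: "torus_smooth b" and M: "M > 0" and e: "e < 2"
    and z0: "\<And>q. b (q, 0) = 0"
    and z: "\<And>i q. i < 2 * M \<Longrightarrow> i \<notin> half_range M e \<Longrightarrow> b (q, real i / real (2 * M)) = 0"
    and main: "\<And>r s. r < M \<Longrightarrow> s < M \<Longrightarrow> 2 * q_coeff a (2 * (int r - int s)) ((real r + real s) / real (2 * M))
      = q_coeff b (int r - int s) ((real (r + e * M) + real (s + e * M)) / (2 * real (2 * M)))"
  shows "op_bound (dilate M e (main_mat (2 * M) a) - fourier_mat (2 * M) * weyl_op (2 * M) b * adj (fourier_mat (2 * M)))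
    (mixed_norm 3 1 b / real (2 * M) * inv_sq_sum)"
proof (rule schur_inv_sq)
  let ?N = "2 * M" and ?I = "half_range M e"
  let ?H = "fourier_mat ?N * weyl_op ?N b * adj (fourier_mat ?N)"
  let ?W = "dilate M e (main_mat ?N a) - ?H"
  have N: "?N > 0" using M by simp
  show "?W \<in> carrier_mat ?N ?N" by (intro minus_carrier_mat fourier_conj_carrier weyl_op_carrier)
  show "0 \<le> mixed_norm 3 1 b" by (rule mixed_norm_nonneg[OF b])
  fix r s assume rs: "r < ?N" "s < ?N"
  let ?x = "\<lambda>k. (real s + of_int k / 2) / real ?N"
  let ?f = "\<lambda>k. q_coeff b k (?x k)"
  have neg: "infsum (\<lambda>k. - ?f k) A = - infsum ?f A" for A by (rule infsum_uminus)
  have W: "?W $$ (r, s) = dilate M e (main_mat ?N a) $$ (r, s) - infsum ?f (shift_set ?N r s)"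
    unfolding fourier_weyl_op_index[OF b rs, symmetric]
    by (rule index_minus_mat(1)) (use rs carrier_matD[OF fourier_conj_carrier[OF weyl_op_carrier[of ?N b]]] in \<open>simp_all only:\<close>)
  show "\<exists>g A. ?W $$ (r, s) = infsum g A \<and> A \<subseteq> shift_set ?N r s \<and>
      (\<forall>k\<in>A. cmod (g k) \<le> mixed_norm 3 1 b / real ?N * (1 / (of_int k)\<^sup>2))"
  proof (cases "r \<in> ?I \<and> s \<in> ?I")
    case True
    define r' s' where "r' = r - e * M" and "s' = s - e * M"
    have lt: "r' < M" "s' < M" and ri: "r = r' + e * M" "s = s' + e * M"
      using True by (auto simp: r'_def s'_def half_range_def)
    have "dilate M e (main_mat ?N a) $$ (r, s) = 2 * q_coeff a (2 * (int r' - int s')) ((real r' + real s') / real ?N)"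
    proof -
      have "(real (2 * r') + real (2 * s')) / (2 * real ?N) = (real r' + real s') / real ?N"
        using N by (simp add: field_simps)
      moreover have "int (2 * r') - int (2 * s') = 2 * (int r' - int s')" by simp
      moreover have "dilate M e (main_mat ?N a) $$ (r, s) = 2 * main_mat ?N a $$ (2 * r', 2 * s')"
        using rs True by (simp add: dilate_def r'_def s'_def)
      moreover have "main_mat ?N a $$ (2 * r', 2 * s')
        = q_coeff a (int (2 * r') - int (2 * s')) ((real (2 * r') + real (2 * s')) / (2 * real ?N))"
        using lt by (simp add: main_mat_def)
      ultimately show ?thesis by (simp only:)
    qed
    also have "\<dots> = q_coeff b (int r - int s) ((real r + real s) / (2 * real ?N))"
      using main[OF lt] by (simp add: ri)
    finally have "?W $$ (r, s) = - infsum ?f (shift_set ?N r s - {int r - int s})"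
      unfolding W infsum_remove_main[OF b rs(1)] by simp
    then show ?thesis
      using norm_q_coeff_crossing[OF b z0 rs]
      by (intro exI[of _ "\<lambda>k. - ?f k"] exI[of _ "shift_set ?N r s - {int r - int s}"]) (simp only: neg, auto)
  next
    case False
    have bound: "cmod (?f k) \<le> mixed_norm 3 1 b / real ?N * (1 / (of_int k)\<^sup>2)"
      if k: "k \<in> shift_set ?N r s" for k
    proof (cases "s \<in> ?I")
      case False
      show ?thesis
        by (rule norm_q_coeff_vanishing[OF b N _ half_step_dist(1)[OF N]]) (rule z[OF rs(2) False])
    next
      case True
      then have r: "r \<notin> ?I" using False by simp
      obtain m where "int s + k = int r + int ?N * m" using shift_set_residue[OF k] .
      then have "real_of_int (int s + k) = real_of_int (int r + int ?N * m)" by (rule arg_cong)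
      then have "(real s + of_int k) / real ?N = real r / real ?N + of_int m"
        using N by (simp add: field_simps)
      then have "b (q, (real s + of_int k) / real ?N) = 0" for q
        using torus_smooth_periodic[OF b, of q 0 _ m] z[OF rs(1) r, of q] by simp
      then show ?thesis
        by (rule norm_q_coeff_vanishing[OF b N _ half_step_dist(2)[OF N]])
    qed
    have "?W $$ (r, s) = - infsum ?f (shift_set ?N r s)"
      unfolding W using False rs by (auto simp: dilate_def)
    then show ?thesis
      using bound by (intro exI[of _ "\<lambda>k. - ?f k"] exI[of _ "shift_set ?N r s"]) (simp only: neg, auto)
  qed
qed

section \<open>Comparison of evolved operator and evolved symbol\<close>

lemma dilate_minus:
  assumes "X \<in> carrier_mat (2 * M) (2 * M)" "Y \<in> carrier_mat (2 * M) (2 * M)" and e: "e < 2"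
  shows "dilate M e (X - Y) = dilate M e X - dilate M e Y"
  by (rule eq_matI) (use assms in \<open>auto simp: dilate_def half_range_def right_diff_distrib\<close>)

text \<open>The quantum map is \<open>adj F * G\<close>, so conjugation by the unitary
  \<open>F\<close> reduces the claim to \<open>G * X * adj G - F * Y * adj F\<close>, a comparison
  in the momentum basis.\<close>

lemma egorov_half_block:
  assumes a: "torus_smooth a" and b: "torus_smooth b" and M: "M > 0" and e: "e < 2"
    and za: "\<And>i p. i < 2 * M \<Longrightarrow> i \<notin> half_range M e \<Longrightarrow> a (real i / real (2 * M), p) = 0"
    and za0: "\<And>q. a (q, 0) = 0" and zb0: "\<And>q. b (q, 0) = 0"
    and zb: "\<And>i q. i < 2 * M \<Longrightarrow> i \<notin> half_range M e \<Longrightarrow> b (q, real i / real (2 * M)) = 0"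
    and main: "\<And>r s. r < M \<Longrightarrow> s < M \<Longrightarrow> 2 * q_coeff a (2 * (int r - int s)) ((real r + real s) / real (2 * M))
      = q_coeff b (int r - int s) ((real (r + e * M) + real (s + e * M)) / (2 * real (2 * M)))"
  shows "op_bound (quantum_baker (2 * M) * weyl_op (2 * M) a * adj (quantum_baker (2 * M)) - weyl_op (2 * M) b)
    ((3 * mixed_norm 1 3 a + 2 * mixed_norm 3 1 a + mixed_norm 3 1 b) / real (2 * M) * inv_sq_sum)"
proof -
  let ?N = "2 * M"
  define F where "F = fourier_mat ?N"
  define G where "G = baker_block M"
  define X where "X = weyl_op ?N a"
  define Y where "Y = weyl_op ?N b"
  define C where "C = half_cut M e X"
  define A0 where "A0 = main_mat ?N a"
  have uF: "unitary_mat ?N F" unfolding F_def using M by (intro unitary_fourier_mat) simp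
  have uG: "unitary_mat ?N G" unfolding G_def using M by (intro unitary_baker_block) simp
  have c: "F \<in> carrier_mat ?N ?N" "G \<in> carrier_mat ?N ?N" "X \<in> carrier_mat ?N ?N" "Y \<in> carrier_mat ?N ?N"
    "C \<in> carrier_mat ?N ?N" "A0 \<in> carrier_mat ?N ?N" "adj F \<in> carrier_mat ?N ?N" "adj G \<in> carrier_mat ?N ?N"
    by (simp_all add: F_def G_def X_def Y_def C_def A0_def)
  have cc: "A * Z * B \<in> carrier_mat ?N ?N"
    if "A \<in> carrier_mat ?N ?N" "Z \<in> carrier_mat ?N ?N" "B \<in> carrier_mat ?N ?N" for A B Z :: "complex mat"
    using that by (intro mult_carrier_mat[of _ ?N ?N _ ?N])
  have cm: "A - B \<in> carrier_mat ?N ?N" if "A \<in> carrier_mat ?N ?N" "B \<in> carrier_mat ?N ?N" for A B :: "complex mat"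
    using that by (intro minus_carrier_mat)
  let ?d1 = "mixed_norm 1 3 a / real ?N * inv_sq_sum" and ?d2 = "mixed_norm 3 1 a / real ?N * inv_sq_sum"
    and ?d3 = "mixed_norm 3 1 b / real ?N * inv_sq_sum"
  have d: "0 \<le> ?d1" "0 \<le> ?d2" "0 \<le> ?d3"
    using mixed_norm_nonneg[OF a] mixed_norm_nonneg[OF b] inv_sq_sum_nonneg by simp_all
  have conj_minus: "A * Z * adj A - A * Z' * adj A = A * (Z - Z') * adj A"
    if "A \<in> carrier_mat ?N ?N" "Z \<in> carrier_mat ?N ?N" "Z' \<in> carrier_mat ?N ?N" for A Z Z' :: "complex mat"
    using that by (simp add: mult_minus_distrib_mat[of A ?N ?N Z ?N Z'] 
        minus_mult_distrib_mat[of "A * Z" ?N ?N "A * Z'" "adj A" ?N])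
  have XC: "op_bound (X - C) ?d1"
    unfolding X_def C_def by (rule weyl_op_minus_cut[OF a M za])
  have t1: "op_bound (G * (X - C) * adj G) ?d1"
    using op_bound_conj[OF c(2) c(8) cm[OF c(3,5)] _ _ XC d(1)] unitary_op_bound[OF uG] unitary_op_bound[OF unitary_adj[OF uG]] by blast
  have "op_bound (F * (X - C) * adj F) ?d1"
    using op_bound_conj[OF c(1) c(7) cm[OF c(3,5)] _ _ XC d(1)] unitary_op_bound[OF uF] unitary_op_bound[OF unitary_adj[OF uF]] by blast
  then have "op_bound (dilate M e (F * (X - C) * adj F)) (2 * ?d1)"
    by (rule op_bound_dilate[OF cc[OF c(1) cm[OF c(3,5)] c(7)] _ d(1) e])
  then have t2: "op_bound (- dilate M e (F * (X - C) * adj F)) (2 * ?d1)"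
    by (rule op_bound_uminus[OF dilate_carrier])
  have "op_bound (F * X * adj F - A0) ?d2"
    unfolding F_def X_def A0_def by (rule fourier_weyl_op_minus_main[OF a za0])
  then have t3: "op_bound (dilate M e (F * X * adj F - A0)) (2 * ?d2)"
    by (rule op_bound_dilate[OF cm[OF cc[OF c(1) c(3) c(7)] c(6)] _ d(2) e])
  have t4: "op_bound (dilate M e A0 - F * Y * adj F) ?d3"
    unfolding F_def Y_def A0_def by (rule dilate_main_minus_fourier_weyl_op[OF b M e zb0 zb main])
  have GC: "G * C * adj G = dilate M e (F * C * adj F)"
    unfolding G_def C_def F_def by (rule baker_block_conj_cut[OF e])
  \<comment> \<open>The identity for \<open>C\<close> sits between the first two terms; the momentum
    matrix of \<open>C\<close> is not explicit, so \<open>C\<close> is replaced by \<open>X\<close>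
    again under the dilation. The two replacements cost \<open>?d1\<close> and
    \<open>2 * ?d1\<close>, whence the coefficient 3; dilation also doubles
    \<open>?d2\<close>.\<close>
  let ?T = "G * (X - C) * adj G + (- dilate M e (F * (X - C) * adj F)) + dilate M e (F * X * adj F - A0) + (dilate M e A0 - F * Y * adj F)"
  have Tb: "op_bound ?T (?d1 + 2 * ?d1 + 2 * ?d2 + ?d3)"
    by (intro op_bound_add[of _ ?N] t1 t2 t3 t4 add_carrier_mat uminus_carrier_mat dilate_carrier cc cm c)
  have split: "G * X * adj G - F * Y * adj F = ?T"
  proof -
    have 1: "G * (X - C) * adj G = G * X * adj G - dilate M e (F * C * adj F)"
      unfolding GC[symmetric] by (rule conj_minus[symmetric]) (rule c)+
    have 2: "dilate M e (F * (X - C) * adj F) = dilate M e (F * X * adj F) - dilate M e (F * C * adj F)"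
      unfolding conj_minus[OF c(1,3,5), symmetric] by (rule dilate_minus[OF cc[OF c(1,3,7)] cc[OF c(1,5,7)] e])
    have 3: "dilate M e (F * X * adj F - A0) = dilate M e (F * X * adj F) - dilate M e A0"
      by (rule dilate_minus[OF cc[OF c(1,3,7)] c(6) e])
    have gen: "P - S = (P - Q) + (- (R - Q)) + (R - A) + (A - S)"
      if "P \<in> carrier_mat ?N ?N" "Q \<in> carrier_mat ?N ?N" "R \<in> carrier_mat ?N ?N" "S \<in> carrier_mat ?N ?N"
        "A \<in> carrier_mat ?N ?N" for P Q R S A :: "complex mat"
      by (rule eq_matI) (use that in auto)
    show ?thesis unfolding 1 2 3
      by (rule gen) (intro cc c dilate_carrier)+
  qed
  have qb: "quantum_baker ?N = adj F * G" unfolding F_def G_def by (rule quantum_baker_eq[OF refl M])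
  have adjqb: "adj (adj F * G) = adj G * F"
    using c by (simp add: adj_mult[of "adj F" ?N G])
  have "quantum_baker ?N * X * adj (quantum_baker ?N) - Y = adj F * (G * X * adj G - F * Y * adj F) * F"
  proof -
    have YY: "adj F * (F * Y * adj F) * F = Y"
    proof -
      have "adj F * (F * Y * adj F) = (adj F * (F * Y)) * adj F"
        by (rule assoc_mult_mat[symmetric]) (use c in auto)
      also have "adj F * (F * Y) = (adj F * F) * Y" by (rule assoc_mult_mat[symmetric]) (use c in auto)
      also have "\<dots> = Y" using uF c by (simp add: unitary_mat_def)
      finally have e1: "adj F * (F * Y * adj F) = Y * adj F" .
      have e2: "Y * adj F * F = Y * (adj F * F)" by (rule assoc_mult_mat) (use c in auto)
      show ?thesis unfolding e1 e2 using uF c by (simp add: unitary_mat_def)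
    qed
    have XX: "adj F * (G * X * adj G) * F = quantum_baker ?N * X * adj (quantum_baker ?N)"
    proof -
      have "adj F * (G * X * adj G) = adj F * (G * X) * adj G" by (rule assoc_mult_mat[symmetric]) (use c in auto)
      also have "adj F * (G * X) = adj F * G * X" by (rule assoc_mult_mat[symmetric]) (use c in auto)
      finally have "adj F * (G * X * adj G) * F = adj F * G * X * adj G * F" by simp
      also have "\<dots> = adj F * G * X * (adj G * F)" by (rule assoc_mult_mat) (use c in auto)
      finally show ?thesis unfolding qb adjqb .
    qed
    have "adj F * (G * X * adj G - F * Y * adj F) * F = adj F * (G * X * adj G) * F - adj F * (F * Y * adj F) * F"
      unfolding mult_minus_distrib_mat[OF c(7) cc[OF c(2,3,8)] cc[OF c(1,4,7)]]
      by (rule minus_mult_distrib_mat[of _ ?N ?N _ _ ?N]) (intro mult_carrier_mat[of _ ?N ?N _ ?N] c)+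
    then show ?thesis unfolding YY XX by simp
  qed
  moreover have "op_bound (adj F * (G * X * adj G - F * Y * adj F) * F) (?d1 + 2 * ?d1 + 2 * ?d2 + ?d3)"
  proof (rule op_bound_conj[OF c(7) c(1)])
    show "op_bound (G * X * adj G - F * Y * adj F) (?d1 + 2 * ?d1 + 2 * ?d2 + ?d3)"
      unfolding split by (rule Tb)
    show "0 \<le> ?d1 + 2 * ?d1 + 2 * ?d2 + ?d3" using d by linarith
  qed (rule cm[OF cc[OF c(2,3,8)] cc[OF c(1,4,7)]] unitary_op_bound[OF unitary_adj[OF uF]]
      unitary_op_bound[OF uF])+
  moreover have "?d1 + 2 * ?d1 + 2 * ?d2 + ?d3
    = (3 * mixed_norm 1 3 a + 2 * mixed_norm 3 1 a + mixed_norm 3 1 b) / real ?N * inv_sq_sum"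
    by (simp add: add_divide_distrib algebra_simps)
  ultimately show ?thesis by (simp only: X_def Y_def)
qed

section \<open>Flatness along the lines of discontinuity\<close>

definition vanishes_near :: "plane_fun \<Rightarrow> real \<times> real \<Rightarrow> bool" where
  "vanishes_near f x \<longleftrightarrow> eventually (\<lambda>y. f y = 0) (nhds x)"

text \<open>The lines \<open>q * 2 ^ m \<in> \<int>\<close> contain the discontinuities of the m-th
  iterate of the baker's map; integer \<open>p\<close> is the seam of the momentum axis. Vanishing
  in a neighbourhood is demanded because it is inherited by derivatives and by restrictions to a
  strip.\<close>

definition flat_lines :: "nat \<Rightarrow> plane_fun set" where
  "flat_lines m = {f. torus_smooth f \<and> (\<forall>q p. q * 2 ^ m \<in> \<int> \<or> p \<in> \<int> \<longrightarrow> vanishes_near f (q, p))}"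

lemma vanishes_near_imp_zero: "vanishes_near f x \<Longrightarrow> f x = 0"
  unfolding vanishes_near_def by (rule eventually_nhds_x_imp_x)

lemma flat_lines_smooth: "f \<in> flat_lines m \<Longrightarrow> torus_smooth f"
  by (simp add: flat_lines_def)

lemma has_vector_derivative_cong_nhds:
  assumes "eventually (\<lambda>t. f t = g t) (nhds (x::real))" "(g has_vector_derivative D) (at x)"
  shows "(f has_vector_derivative D) (at x)"
proof -
  obtain S where S: "open S" "x \<in> S" "\<And>t. t \<in> S \<Longrightarrow> f t = g t"
    using assms(1) unfolding eventually_nhds by auto
  show ?thesis
    by (rule has_vector_derivative_transform_within_open[OF assms(2) S(1,2)]) (simp add: S(3))
qed

lemma eventually_section_q:
  assumes "eventually P (nhds (q :: real, p :: real))" shows "eventually (\<lambda>t. P (t, p)) (nhds q)"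
proof -
  have "((\<lambda>t. (t, p)) \<longlongrightarrow> (q, p)) (nhds q)" by (intro tendsto_Pair tendsto_const filterlim_ident)
  then show ?thesis using assms by (rule eventually_compose_filterlim[rotated])
qed

lemma eventually_section_p:
  assumes "eventually P (nhds (q :: real, p :: real))" shows "eventually (\<lambda>t. P (q, t)) (nhds p)"
proof -
  have "((\<lambda>t. (q, t)) \<longlongrightarrow> (q, p)) (nhds p)" by (intro tendsto_Pair tendsto_const filterlim_ident)
  then show ?thesis using assms by (rule eventually_compose_filterlim[rotated])
qed

lemma partial_q_eqI: "((\<lambda>t. f (t, p)) has_vector_derivative D) (at q) \<Longrightarrow> partial_q f (q, p) = D"
  by (simp add: partial_q_def vector_derivative_at)

lemma partial_p_eqI: "((\<lambda>t. f (q, t)) has_vector_derivative D) (at p) \<Longrightarrow> partial_p f (q, p) = D"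
  by (simp add: partial_p_def vector_derivative_at)

text \<open>Vanishing near a point is an open condition, so all nearby points have it too, and both
  derivatives are 0 at each of them.\<close>

lemma vanishes_near_partial:
  assumes "vanishes_near f x"
  shows "vanishes_near (partial_q f) x" "vanishes_near (partial_p f) x"
proof -
  have *: "eventually (\<lambda>y. vanishes_near f y) (nhds x)"
    using assms unfolding vanishes_near_def by (simp add: eventually_eventually)
  have q: "partial_q f y = 0" and p: "partial_p f y = 0" if "vanishes_near f y" for y
  proof -
    obtain q p where y: "y = (q, p)" by (cases y)
    show "partial_q f y = 0" unfolding y
      by (rule partial_q_eqI, rule has_vector_derivative_cong_nhds[OF eventually_section_q])
         (use that y in \<open>auto simp: vanishes_near_def\<close>)
    show "partial_p f y = 0" unfolding y
      by (rule partial_p_eqI, rule has_vector_derivative_cong_nhds[OF eventually_section_p])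
         (use that y in \<open>auto simp: vanishes_near_def\<close>)
  qed
  show "vanishes_near (partial_q f) x" unfolding vanishes_near_def
    by (rule eventually_mono[OF *]) (rule q)
  show "vanishes_near (partial_p f) x" unfolding vanishes_near_def
    by (rule eventually_mono[OF *]) (rule p)
qed

lemma flat_lines_partial:
  assumes "f \<in> flat_lines m" shows "partial_q f \<in> flat_lines m" "partial_p f \<in> flat_lines m"
  using assms by (auto simp: flat_lines_def torus_smooth_partial_q torus_smooth_partial_p vanishes_near_partial)

lemma flat_lines_partials:
  "f \<in> flat_lines m \<Longrightarrow> (partial_q ^^ i) ((partial_p ^^ j) f) \<in> flat_lines m"
  by (induction i; induction j) (simp_all add: flat_lines_partial)

text \<open>The operations \<open>f \<mapsto> f \<circ> B\<^bsup>-1\<^esup>\<close> and restriction to a half strip are both of the following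
  kind on functions which are flat along the lines of discontinuity.\<close>

definition piecewise_affine :: "nat \<Rightarrow> real \<Rightarrow> real \<Rightarrow> (plane_fun \<Rightarrow> plane_fun) \<Rightarrow> bool" where
  "piecewise_affine m \<alpha> \<mu> \<Phi> \<longleftrightarrow> (\<forall>x.
     (\<forall>f\<in>flat_lines m. vanishes_near (\<Phi> f) x) \<or>
     (\<exists>\<beta> \<nu>. \<forall>f\<in>flat_lines m. eventually (\<lambda>(q, p). \<Phi> f (q, p) = f (\<alpha> * q + \<beta>, \<mu> * p + \<nu>)) (nhds x)))"

lemma has_vector_derivative_affine:
  assumes "(g has_vector_derivative D) (at (\<alpha> * x + \<beta> :: real))"
  shows "((\<lambda>t. g (\<alpha> * t + \<beta>)) has_vector_derivative (of_real \<alpha> * D :: complex)) (at x)"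
proof -
  have "((\<lambda>t. \<alpha> * t + \<beta>) has_vector_derivative \<alpha>) (at x)"
    by (auto intro!: derivative_eq_intros)
  from vector_diff_chain_at[OF this assms] show ?thesis
    by (simp add: o_def scaleR_conv_of_real)
qed

text \<open>In \<open>piecewise_affine\<close> the shifts \<open>\<beta>\<close> and
  \<open>\<nu>\<close> are chosen for the point before the function, so the same local formula holds
  for \<open>f\<close> and for its partial derivatives. The claim is then the chain rule.\<close>

lemma piecewise_affine_derivs:
  assumes \<Phi>: "piecewise_affine m \<alpha> \<mu> \<Phi>" and f: "f \<in> flat_lines m"
  shows "((\<lambda>t. \<Phi> f (t, p)) has_vector_derivative of_real \<alpha> * \<Phi> (partial_q f) (q, p)) (at q)"
    and "((\<lambda>t. \<Phi> f (q, t)) has_vector_derivative of_real \<mu> * \<Phi> (partial_p f) (q, p)) (at p)"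
proof -
  let ?D1 = "((\<lambda>t. \<Phi> f (t, p)) has_vector_derivative of_real \<alpha> * \<Phi> (partial_q f) (q, p)) (at q)"
  let ?D2 = "((\<lambda>t. \<Phi> f (q, t)) has_vector_derivative of_real \<mu> * \<Phi> (partial_p f) (q, p)) (at p)"
  note sm = flat_lines_smooth[OF f]
  consider "\<forall>f\<in>flat_lines m. vanishes_near (\<Phi> f) (q, p)"
    | \<beta> \<nu> where "\<forall>f\<in>flat_lines m. eventually (\<lambda>(q, p). \<Phi> f (q, p) = f (\<alpha> * q + \<beta>, \<mu> * p + \<nu>)) (nhds (q, p))"
    using \<Phi> unfolding piecewise_affine_def by blast
  then have "?D1 \<and> ?D2"
  proof cases
    case 1
    then have v: "vanishes_near (\<Phi> f) (q, p)" and z: "\<Phi> (partial_q f) (q, p) = 0" "\<Phi> (partial_p f) (q, p) = 0"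
      using f flat_lines_partial[OF f] vanishes_near_imp_zero by blast+
    have ?D1 unfolding z
      by (rule has_vector_derivative_cong_nhds[OF eventually_section_q[OF v[unfolded vanishes_near_def]]]) simp
    moreover have ?D2 unfolding z
      by (rule has_vector_derivative_cong_nhds[OF eventually_section_p[OF v[unfolded vanishes_near_def]]]) simp
    ultimately show ?thesis by blast
  next
    case 2
    have ev: "eventually (\<lambda>(q, p). \<Phi> f (q, p) = f (\<alpha> * q + \<beta>, \<mu> * p + \<nu>)) (nhds (q, p))"
      using 2 f by blast
    have q: "\<Phi> (partial_q f) (q, p) = partial_q f (\<alpha> * q + \<beta>, \<mu> * p + \<nu>)"
      using eventually_nhds_x_imp_x[OF bspec[OF 2 flat_lines_partial(1)[OF f]]] by simp
    have p: "\<Phi> (partial_p f) (q, p) = partial_p f (\<alpha> * q + \<beta>, \<mu> * p + \<nu>)"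
      using eventually_nhds_x_imp_x[OF bspec[OF 2 flat_lines_partial(2)[OF f]]] by simp
    have ?D1 unfolding q
    proof (rule has_vector_derivative_cong_nhds)
      show "eventually (\<lambda>t. \<Phi> f (t, p) = f (\<alpha> * t + \<beta>, \<mu> * p + \<nu>)) (nhds q)"
        using eventually_section_q[OF ev] by simp
      show "((\<lambda>t. f (\<alpha> * t + \<beta>, \<mu> * p + \<nu>)) has_vector_derivative of_real \<alpha> * partial_q f (\<alpha> * q + \<beta>, \<mu> * p + \<nu>)) (at q)"
        by (rule has_vector_derivative_affine) (rule torus_smooth_has_q_derivative[OF sm])
    qed
    moreover have ?D2 unfolding p
    proof (rule has_vector_derivative_cong_nhds)
      show "eventually (\<lambda>t. \<Phi> f (q, t) = f (\<alpha> * q + \<beta>, \<mu> * t + \<nu>)) (nhds p)"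
        using eventually_section_p[OF ev] by simp
      show "((\<lambda>t. f (\<alpha> * q + \<beta>, \<mu> * t + \<nu>)) has_vector_derivative of_real \<mu> * partial_p f (\<alpha> * q + \<beta>, \<mu> * p + \<nu>)) (at p)"
        by (rule has_vector_derivative_affine[of "\<lambda>t. f (\<alpha> * q + \<beta>, t)"]) (rule torus_smooth_has_p_derivative[OF sm])
    qed
    ultimately show ?thesis by blast
  qed
  then show ?D1 ?D2 by blast+
qed

lemma piecewise_affine_continuous:
  assumes \<Phi>: "piecewise_affine m \<alpha> \<mu> \<Phi>" and f: "f \<in> flat_lines m"
  shows "isCont (\<Phi> f) x"
proof -
  have cf: "isCont f y" for y
    using torus_smooth_continuous[OF flat_lines_smooth[OF f]] continuous_on_eq_continuous_at[OF open_UNIV, of f] by blast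
  consider "\<forall>f\<in>flat_lines m. vanishes_near (\<Phi> f) x"
    | \<beta> \<nu> where "\<forall>f\<in>flat_lines m. eventually (\<lambda>(q, p). \<Phi> f (q, p) = f (\<alpha> * q + \<beta>, \<mu> * p + \<nu>)) (nhds x)"
    using \<Phi> unfolding piecewise_affine_def by blast
  then show ?thesis
  proof cases
    case 1
    then have "eventually (\<lambda>y. \<Phi> f y = 0) (nhds x)" using f by (auto simp: vanishes_near_def)
    then have "isCont (\<Phi> f) x \<longleftrightarrow> isCont (\<lambda>_. 0 :: complex) x" by (rule isCont_cong)
    then show ?thesis by simp
  next
    case 2
    then have "eventually (\<lambda>y. \<Phi> f y = f (\<alpha> * fst y + \<beta>, \<mu> * snd y + \<nu>)) (nhds x)"
      using f by (auto simp: case_prod_beta')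
    then have *: "isCont (\<Phi> f) x \<longleftrightarrow> isCont (\<lambda>y. f (\<alpha> * fst y + \<beta>, \<mu> * snd y + \<nu>)) x" by (rule isCont_cong)
    have "isCont (\<lambda>y. (\<alpha> * fst y + \<beta>, \<mu> * snd y + \<nu>)) x"
      by (intro continuous_Pair continuous_add continuous_mult continuous_fst continuous_snd
          continuous_const continuous_ident)
    then have "isCont (\<lambda>y. f (\<alpha> * fst y + \<beta>, \<mu> * snd y + \<nu>)) x"
      using cf by (rule isCont_o2)
    then show ?thesis using * by blast
  qed
qed

text \<open>The constant \<open>c\<close> takes part in the induction: a derivative multiplies it by
  \<open>\<alpha>\<close> or \<open>\<mu>\<close> and replaces \<open>f\<close> by a partial
  derivative, which is flat again.\<close>

lemma piecewise_affine_C_class: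
  assumes \<Phi>: "piecewise_affine m \<alpha> \<mu> \<Phi>"
  shows "f \<in> flat_lines m \<Longrightarrow> C_class k (\<lambda>x. c * \<Phi> f x)"
proof (induction k arbitrary: f c)
  case 0
  have "continuous_on UNIV (\<Phi> f)"
    using piecewise_affine_continuous[OF \<Phi> 0] by (simp add: continuous_on_eq_continuous_at)
  then show ?case by (simp add: continuous_on_mult_left)
next
  case (Suc k)
  note f = Suc.prems
  have q: "((\<lambda>t. c * \<Phi> f (t, p)) has_vector_derivative c * (of_real \<alpha> * \<Phi> (partial_q f) (q, p))) (at q)" for q p
    by (intro has_vector_derivative_mult_right piecewise_affine_derivs[OF \<Phi> f])
  have p: "((\<lambda>t. c * \<Phi> f (q, t)) has_vector_derivative c * (of_real \<mu> * \<Phi> (partial_p f) (q, p))) (at p)" for q p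
    by (intro has_vector_derivative_mult_right piecewise_affine_derivs[OF \<Phi> f])
  have "partial_q (\<lambda>x. c * \<Phi> f x) = (\<lambda>x. (c * of_real \<alpha>) * \<Phi> (partial_q f) x)"
    using partial_q_eqI[OF q] by (auto simp: mult.assoc)
  moreover have "partial_p (\<lambda>x. c * \<Phi> f x) = (\<lambda>x. (c * of_real \<mu>) * \<Phi> (partial_p f) x)"
    using partial_p_eqI[OF p] by (auto simp: mult.assoc)
  moreover have "continuous_on UNIV (\<Phi> f)"
    using piecewise_affine_continuous[OF \<Phi> f] by (simp add: continuous_on_eq_continuous_at)
  ultimately show ?case
    using Suc.IH[OF flat_lines_partial(1)[OF f]] Suc.IH[OF flat_lines_partial(2)[OF f]]
      differentiableI_vector[OF q] differentiableI_vector[OF p]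
    by (simp add: continuous_on_mult_left)
qed

lemma piecewise_affine_smooth:
  assumes "piecewise_affine m \<alpha> \<mu> \<Phi>" "f \<in> flat_lines m" "torus_periodic (\<Phi> f)"
  shows "torus_smooth (\<Phi> f)"
  using piecewise_affine_C_class[OF assms(1,2), of _ 1] assms(3) by (simp add: torus_smooth_def)

lemma piecewise_affine_partial:
  assumes "piecewise_affine m \<alpha> \<mu> \<Phi>" "f \<in> flat_lines m"
  shows "partial_q (\<lambda>x. c * \<Phi> f x) = (\<lambda>x. (c * of_real \<alpha>) * \<Phi> (partial_q f) x)"
    and "partial_p (\<lambda>x. c * \<Phi> f x) = (\<lambda>x. (c * of_real \<mu>) * \<Phi> (partial_p f) x)"
  using partial_q_eqI[OF has_vector_derivative_mult_right[OF piecewise_affine_derivs(1)[OF assms]]]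
    partial_p_eqI[OF has_vector_derivative_mult_right[OF piecewise_affine_derivs(2)[OF assms]]]
  by (auto simp: mult.assoc)

lemma piecewise_affine_partials:
  assumes \<Phi>: "piecewise_affine m \<alpha> \<mu> \<Phi>" and f: "f \<in> flat_lines m"
  shows "(partial_q ^^ i) ((partial_p ^^ j) (\<Phi> f))
    = (\<lambda>x. of_real (\<alpha> ^ i * \<mu> ^ j) * \<Phi> ((partial_q ^^ i) ((partial_p ^^ j) f)) x)"
proof -
  have p: "(partial_p ^^ j) (\<Phi> f) = (\<lambda>x. of_real (\<mu> ^ j) * \<Phi> ((partial_p ^^ j) f) x)"
  proof (induction j)
    case (Suc j)
    then show ?case
      using piecewise_affine_partial(2)[OF \<Phi> flat_lines_partials[OF f, of 0 j]] by (simp add: mult.commute)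
  qed simp
  show ?thesis
  proof (induction i)
    case (Suc i)
    then show ?case
      unfolding funpow.simps o_apply Suc.IH piecewise_affine_partial(1)[OF \<Phi> flat_lines_partials[OF f, of i j]]
      by (simp add: mult_ac)
  qed (simp add: p)
qed

section \<open>Restriction to a half strip\<close>

definition strip :: "nat \<Rightarrow> plane_fun \<Rightarrow> plane_fun" where
  "strip e f = (\<lambda>(q, p). if (frac q < 1 / 2) = (e = 0) then f (q, p) else 0)"

lemma frac_add_int: "frac (x + of_int m) = frac (x :: real)"
  by (simp add: frac_def)

lemma strip_periodic: "torus_periodic f \<Longrightarrow> torus_periodic (strip e f)"
  by (auto simp: torus_periodic_def strip_def frac_add_int)

lemma eventually_fst: "eventually P (nhds q) \<Longrightarrow> eventually (\<lambda>y. P (fst y)) (nhds (q :: real, p :: real))"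
  by (rule eventually_compose_filterlim[of P "nhds q"]) (auto intro!: tendsto_eq_intros filterlim_ident)

lemma eventually_snd: "eventually P (nhds p) \<Longrightarrow> eventually (\<lambda>y. P (snd y)) (nhds (q :: real, p :: real))"
  by (rule eventually_compose_filterlim[of P "nhds p"]) (auto intro!: tendsto_eq_intros filterlim_ident)

lemma eventually_floor_eq:
  assumes "(q :: real) \<notin> \<int>"
  shows "eventually (\<lambda>t. \<lfloor>t\<rfloor> = \<lfloor>q\<rfloor>) (nhds q)"
proof -
  have "of_int \<lfloor>q\<rfloor> < q" using assms by (metis Ints_of_int of_int_floor_le order_le_less)
  then have "eventually (\<lambda>t. t \<in> {of_int \<lfloor>q\<rfloor><..<of_int \<lfloor>q\<rfloor> + 1}) (nhds q)"
    by (intro eventually_nhds_in_open) auto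
  then show ?thesis by eventually_elim (auto simp: floor_eq_iff)
qed

lemma eventually_half_eq:
  assumes "2 * (q :: real) \<notin> \<int>"
  shows "eventually (\<lambda>t. (frac t < 1 / 2) = (frac q < 1 / 2)) (nhds q)"
proof -
  have q: "q \<notin> \<int>" using assms by auto
  have ne: "q - of_int \<lfloor>q\<rfloor> \<noteq> 1 / 2"
  proof
    assume "q - of_int \<lfloor>q\<rfloor> = 1 / 2"
    then have "2 * q = of_int (2 * \<lfloor>q\<rfloor> + 1)" by simp
    then show False using assms by (metis Ints_of_int)
  qed
  have "eventually (\<lambda>t. (t - of_int \<lfloor>q\<rfloor> < 1 / 2) = (q - of_int \<lfloor>q\<rfloor> < 1 / 2)) (nhds q)"
  proof (cases "q - of_int \<lfloor>q\<rfloor> < 1 / 2")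
    case True
    then have "eventually (\<lambda>t. t \<in> {..<1 / 2 + of_int \<lfloor>q\<rfloor>}) (nhds q)"
      by (intro eventually_nhds_in_open) auto
    then show ?thesis by eventually_elim (use True in auto)
  next
    case False
    then have "eventually (\<lambda>t. t \<in> {1 / 2 + of_int \<lfloor>q\<rfloor><..}) (nhds q)"
      using ne by (intro eventually_nhds_in_open) auto
    then show ?thesis by eventually_elim (use False in auto)
  qed
  with eventually_floor_eq[OF q] show ?thesis
    by eventually_elim (simp add: frac_def)
qed

text \<open>On the edges \<open>2 * q \<in> \<int>\<close> of the strips every flat function
  vanishes locally; elsewhere the indicator of the strip is locally constant. The level is a
  successor so that the line \<open>q = 1 / 2\<close> is among the flat ones.\<close>

lemma strip_piecewise_affine: "piecewise_affine (Suc m) 1 1 (strip e)"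
  unfolding piecewise_affine_def
proof
  fix x :: "real \<times> real"
  obtain q p where x: "x = (q, p)" by (cases x)
  show "(\<forall>f\<in>flat_lines (Suc m). vanishes_near (strip e f) x) \<or>
     (\<exists>\<beta> \<nu>. \<forall>f\<in>flat_lines (Suc m). eventually (\<lambda>(q, p). strip e f (q, p) = f (1 * q + \<beta>, 1 * p + \<nu>)) (nhds x))"
  proof (cases "2 * q \<in> \<int>")
    case True
    have "q * 2 ^ Suc m = 2 * q * 2 ^ m" by simp
    then have "q * 2 ^ Suc m \<in> \<int>" using True by (metis Ints_mult Ints_numeral Ints_power)
    then have "vanishes_near (strip e f) x" if "f \<in> flat_lines (Suc m)" for f
    proof -
      have "vanishes_near f x" using that \<open>q * 2 ^ Suc m \<in> \<int>\<close> unfolding flat_lines_def x by blast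
      then show ?thesis unfolding vanishes_near_def
        by (rule eventually_mono) (auto simp: strip_def)
    qed
    then show ?thesis by blast
  next
    case False
    have ev: "eventually (\<lambda>y. (frac (fst y) < 1 / 2) = (frac q < 1 / 2)) (nhds x)"
      unfolding x by (rule eventually_fst[OF eventually_half_eq[OF False]])
    show ?thesis
    proof (cases "(frac q < 1 / 2) = (e = 0)")
      case True
      have "eventually (\<lambda>(q, p). strip e f (q, p) = f (1 * q + 0, 1 * p + 0)) (nhds x)" for f
        using ev by eventually_elim (use True in \<open>auto simp: strip_def\<close>)
      then show ?thesis by blast
    next
      case False
      have "vanishes_near (strip e f) x" for f unfolding vanishes_near_def
        using ev by eventually_elim (use False in \<open>auto simp: strip_def\<close>)
      then show ?thesis by blast
    qed
  qed
qed

lemma strip_flat_lines: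
  assumes f: "f \<in> flat_lines (Suc m)" shows "strip e f \<in> flat_lines (Suc m)"
proof -
  have "torus_smooth (strip e f)"
    using flat_lines_smooth[OF f]
    by (intro piecewise_affine_smooth[OF strip_piecewise_affine f] strip_periodic) (simp add: torus_smooth_def)
  moreover have "vanishes_near (strip e f) x" if "vanishes_near f x" for x
    using that unfolding vanishes_near_def by (rule eventually_mono) (auto simp: strip_def)
  ultimately show ?thesis using f by (auto simp: flat_lines_def)
qed

lemma strip_add: "f = (\<lambda>x. strip 0 f x + strip 1 f x)"
  by (auto simp: strip_def)

lemma C0_norm_leI: "(\<And>x. cmod (f x) \<le> B) \<Longrightarrow> C0_norm f \<le> B"
  unfolding C0_norm_def by (rule cSUP_least) auto

lemma mixed_norm_strip_le:
  assumes f: "f \<in> flat_lines (Suc m)"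
  shows "mixed_norm i j (strip e f) \<le> mixed_norm i j f"
  unfolding mixed_norm_def piecewise_affine_partials[OF strip_piecewise_affine f]
proof (rule C0_norm_leI)
  fix x
  let ?g = "(partial_q ^^ i) ((partial_p ^^ j) f)"
  have g: "torus_smooth ?g" by (rule torus_smooth_partials[OF flat_lines_smooth[OF f]])
  have "cmod (strip e ?g x) \<le> C0_norm ?g"
    using norm_le_C0_norm[OF g, of x] C0_norm_nonneg[OF g] by (cases x) (auto simp: strip_def)
  then show "cmod (of_real (1 ^ i * 1 ^ j) * strip e ?g x) \<le> C0_norm ?g" by simp
qed

section \<open>Composition with the inverse baker's map\<close>

lemma torus_rep_in_unit_square: "torus_rep x \<in> unit_square"
  by (cases x) (simp add: torus_rep_def unit_square_def frac_lt_1)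

lemma inv_into_baker_in_unit_square:
  "x \<in> unit_square \<Longrightarrow> inv_into unit_square (baker ^^ n) x \<in> unit_square"
  using bij_betw_baker_funpow[of n] by (intro inv_into_into) (simp add: bij_betw_def)

lemma torus_rep_id: "x \<in> unit_square \<Longrightarrow> torus_rep x = x"
  by (cases x) (auto simp: torus_rep_def unit_square_def frac_eq)

lemma comp_baker_inv_0: "torus_periodic f \<Longrightarrow> comp_baker_inv f 0 = f"
proof
  fix x assume f: "torus_periodic f"
  have "inv_into unit_square (baker ^^ 0) (torus_rep x) = torus_rep x"
    by (rule inv_into_f_eq) (auto simp: torus_rep_in_unit_square)
  moreover have "f (torus_rep x) = f x"
    using torus_periodic_eq_frac[OF f, of "fst x" "snd x"] by (cases x) (simp add: torus_rep_def)
  ultimately show "comp_baker_inv f 0 x = f x" by (simp add: comp_baker_inv_def)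
qed

lemma comp_baker_inv_Suc: "comp_baker_inv f (Suc n) = comp_baker_inv (comp_baker_inv f n) 1"
proof
  fix x
  let ?S = unit_square and ?y = "torus_rep x"
  define z where "z = inv_into ?S (baker ^^ 1) ?y"
  define w where "w = inv_into ?S (baker ^^ n) z"
  have y: "?y \<in> ?S" by (rule torus_rep_in_unit_square)
  have z: "z \<in> ?S" unfolding z_def by (rule inv_into_baker_in_unit_square[OF y])
  have w: "w \<in> ?S" unfolding w_def by (rule inv_into_baker_in_unit_square[OF z])
  have "(baker ^^ 1) z = ?y" unfolding z_def
    by (rule f_inv_into_f) (use bij_betw_baker_funpow[of 1] y in \<open>simp add: bij_betw_def\<close>)
  moreover have "(baker ^^ n) w = z" unfolding w_def
    by (rule f_inv_into_f) (use bij_betw_baker_funpow[of n] z in \<open>simp add: bij_betw_def\<close>)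
  ultimately have "(baker ^^ Suc n) w = ?y" by simp
  then have "inv_into ?S (baker ^^ Suc n) ?y = w"
    using bij_betw_baker_funpow[of "Suc n"] w by (intro inv_into_f_eq) (auto simp: bij_betw_def)
  then show "comp_baker_inv f (Suc n) x = comp_baker_inv (comp_baker_inv f n) 1 x"
    unfolding comp_baker_inv_def by (simp only: z_def[symmetric] torus_rep_id[OF z] w_def)
qed

text \<open>Composition with a bijection of the unit square leaves the range of a periodic function
  unchanged.\<close>

lemma C0_norm_comp_baker_inv:
  assumes f: "torus_periodic f" shows "C0_norm (comp_baker_inv f n) = C0_norm f"
proof -
  let ?S = unit_square
  have "range f = f ` ?S"
  proof -
    have "f x = f (torus_rep x)" for x
      using torus_periodic_eq_frac[OF f, of "fst x" "snd x"] by (cases x) (simp add: torus_rep_def)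
    then show ?thesis using torus_rep_in_unit_square by blast
  qed
  moreover have "range (comp_baker_inv f n) = f ` ?S"
  proof -
    have b: "bij_betw (inv_into ?S (baker ^^ n)) ?S ?S"
      by (rule bij_betw_inv_into[OF bij_betw_baker_funpow])
    have "range torus_rep = ?S"
      using torus_rep_in_unit_square torus_rep_id by (metis (no_types, lifting) image_subset_iff rangeI subsetI subset_antisym)
    then have "range (\<lambda>x. inv_into ?S (baker ^^ n) (torus_rep x)) = ?S"
      using b by (simp add: bij_betw_def image_image[symmetric])
    then show ?thesis unfolding comp_baker_inv_def by (metis image_image)
  qed
  ultimately have "range f = range (comp_baker_inv f n)" by simp
  then have "range (\<lambda>x. cmod (f x)) = range (\<lambda>x. cmod (comp_baker_inv f n x))"
    by (metis image_image)
  then show ?thesis by (simp add: C0_norm_def)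
qed

text \<open>Periodicity lets the second argument stay \<open>2 * p\<close> in both inverse branches,
  so only the position depends on the branch.\<close>

lemma comp_baker_inv_1:
  assumes f: "torus_periodic f"
  shows "comp_baker_inv f 1 (q, p) = f ((frac q + (if frac p < 1 / 2 then 0 else 1)) / 2, 2 * p)"
proof -
  let ?S = unit_square
  let ?w = "if frac p < 1 / 2 then (frac q / 2, 2 * frac p) else ((frac q + 1) / 2, 2 * frac p - 1)"
  have lt: "0 \<le> frac q" "frac q < 1" "0 \<le> frac p" "frac p < 1" by (simp_all add: frac_lt_1)
  have *: "(if y < 1 / 2 then (x / 2, 2 * y) else ((x + 1) / 2, 2 * y - 1)) \<in> ?S \<and>
      baker (if y < 1 / 2 then (x / 2, 2 * y) else ((x + 1) / 2, 2 * y - 1)) = (x, y)"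
    if "0 \<le> x" "x < 1" "0 \<le> y" "y < 1" for x y :: real
    using that by (auto simp: unit_square_def baker_def field_simps)
  have w: "?w \<in> ?S" and "baker ?w = (frac q, frac p)" using *[OF lt] by blast+
  then have "(baker ^^ 1) ?w = (frac q, frac p)" by simp
  then have "inv_into ?S (baker ^^ 1) (torus_rep (q, p)) = ?w"
    using bij_betw_baker_funpow[of 1] w
    by (intro inv_into_f_eq) (auto simp: bij_betw_def torus_rep_def simp del: funpow.simps)
  then have "comp_baker_inv f 1 (q, p) = f ?w" by (simp add: comp_baker_inv_def)
  also have "\<dots> = f ((frac q + (if frac p < 1 / 2 then 0 else 1)) / 2, 2 * p)"
  proof -
    have per: "f (x, y + of_int n) = f (x, y)" for x y n
      using f unfolding torus_periodic_def by (metis add.right_neutral of_int_0)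
    have "2 * frac p + of_int (2 * \<lfloor>p\<rfloor>) = 2 * p" "2 * frac p - 1 + of_int (2 * \<lfloor>p\<rfloor> + 1) = 2 * p"
      by (simp_all add: frac_def)
    then have "f (x, 2 * frac p) = f (x, 2 * p)" "f (x, 2 * frac p - 1) = f (x, 2 * p)" for x
      using per[of x "2 * frac p" "2 * \<lfloor>p\<rfloor>"] per[of x "2 * frac p - 1" "2 * \<lfloor>p\<rfloor> + 1"] by simp_all
    then show ?thesis by (cases "frac p < 1 / 2") simp_all
  qed
  finally show ?thesis .
qed

lemma comp_baker_inv_periodic: "torus_periodic (comp_baker_inv f n)"
  by (simp add: torus_periodic_def comp_baker_inv_def torus_rep_def frac_add_int)

text \<open>Near \<open>q\<close> the floor is \<open>\<lfloor>q\<rfloor>\<close> or, when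
  \<open>q\<close> is an integer, possibly one less. With the two inverse branches this gives four
  affine images of the point, and \<open>f\<close> vanishes near each of them.\<close>

lemma comp_baker_inv_vanishes_near:
  assumes f: "torus_periodic f"
    and v: "\<And>(n::int) (e::int). e \<in> {0, 1} \<Longrightarrow> vanishes_near f ((q - of_int n + of_int e) / 2, 2 * p)"
  shows "vanishes_near (comp_baker_inv f 1) (q, p)"
proof -
  let ?h = "\<lambda>n e y. ((fst y - of_int n + of_int e) / 2 :: real, 2 * snd y :: real)"
  have ev: "eventually (\<lambda>y. f (?h n e y) = 0) (nhds (q, p))" if "e \<in> {0, 1}" for n e :: int
  proof -
    have A: "eventually (\<lambda>y. f y = 0) (nhds ((q - of_int n + of_int e) / 2, 2 * p))"
      using v[OF that] by (simp add: vanishes_near_def)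
    have "isCont (?h n e) (q, p)"
      by (intro continuous_Pair continuous_divide continuous_add continuous_diff continuous_mult continuous_fst continuous_snd
          continuous_const continuous_ident) auto
    then have "filterlim (?h n e) (nhds ((q - of_int n + of_int e) / 2, 2 * p)) (nhds (q, p))"
      by (simp add: isCont_def tendsto_nhds_iff)
    from eventually_compose_filterlim[OF A this] show ?thesis .
  qed
  have fl: "eventually (\<lambda>y. fst y \<in> {of_int \<lfloor>q\<rfloor> - 1<..<of_int \<lfloor>q\<rfloor> + 1}) (nhds (q, p))"
    by (rule eventually_fst, rule eventually_nhds_in_open) (auto, linarith)
  have "eventually (\<lambda>y. f (?h \<lfloor>q\<rfloor> 0 y) = 0 \<and> f (?h \<lfloor>q\<rfloor> 1 y) = 0 \<and> f (?h (\<lfloor>q\<rfloor> - 1) 0 y) = 0 \<and> f (?h (\<lfloor>q\<rfloor> - 1) 1 y) = 0)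
      (nhds (q, p))"
    by (intro eventually_conj ev) auto
  with fl show ?thesis unfolding vanishes_near_def
  proof eventually_elim
    case (elim y)
    have "\<lfloor>fst y\<rfloor> = \<lfloor>q\<rfloor> \<or> \<lfloor>fst y\<rfloor> = \<lfloor>q\<rfloor> - 1"
      using elim(1) by (auto simp: floor_eq_iff)
    then show ?case
      using elim(2) comp_baker_inv_1[OF f, of "fst y" "snd y"] by (auto simp: frac_def)
  qed
qed

text \<open>Points with integer \<open>q\<close> or integer \<open>2 * p\<close>, where the formula
  may jump, are sent to lines near which \<open>f\<close> vanishes; elsewhere floor and branch are
  locally constant.\<close>

lemma comp_baker_inv_piecewise_affine: "piecewise_affine (Suc m) (1 / 2) 2 (\<lambda>f. comp_baker_inv f 1)"
  unfolding piecewise_affine_def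
proof
  fix x :: "real \<times> real"
  obtain q p where x: "x = (q, p)" by (cases x)
  show "(\<forall>f\<in>flat_lines (Suc m). vanishes_near (comp_baker_inv f 1) x) \<or>
     (\<exists>\<beta> \<nu>. \<forall>f\<in>flat_lines (Suc m). eventually (\<lambda>(q, p). comp_baker_inv f 1 (q, p) = f (1 / 2 * q + \<beta>, 2 * p + \<nu>)) (nhds x))"
  proof (cases "q \<in> \<int> \<or> 2 * p \<in> \<int>")
    case True
    have "vanishes_near (comp_baker_inv f 1) x" if f: "f \<in> flat_lines (Suc m)" for f
      unfolding x
    proof (rule comp_baker_inv_vanishes_near)
      show "torus_periodic f" using flat_lines_smooth[OF f] by (simp add: torus_smooth_def)
      fix n e :: int
      have "(q - of_int n + of_int e) / 2 * 2 ^ Suc m = (q - of_int n + of_int e) * 2 ^ m" by simp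
      then have "(q - of_int n + of_int e) / 2 * 2 ^ Suc m \<in> \<int> \<or> 2 * p \<in> \<int>"
        using True by (metis Ints_add Ints_diff Ints_mult Ints_numeral Ints_of_int Ints_power)
      then show "vanishes_near f ((q - of_int n + of_int e) / 2, 2 * p)"
        using f unfolding flat_lines_def by blast
    qed
    then show ?thesis by blast
  next
    case False
    have ev1: "eventually (\<lambda>y. \<lfloor>fst y\<rfloor> = \<lfloor>q\<rfloor>) (nhds x)"
      unfolding x using False by (intro eventually_fst eventually_floor_eq) auto
    have ev2: "eventually (\<lambda>y. (frac (snd y) < 1 / 2) = (frac p < 1 / 2)) (nhds x)"
      unfolding x using False by (intro eventually_snd eventually_half_eq) auto
    let ?\<beta> = "(- of_int \<lfloor>q\<rfloor> + (if frac p < 1 / 2 then 0 else 1)) / 2 :: real"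
    have "eventually (\<lambda>(q, p). comp_baker_inv f 1 (q, p) = f (1 / 2 * q + ?\<beta>, 2 * p + 0)) (nhds x)"
      if f: "f \<in> flat_lines (Suc m)" for f
      using ev1 ev2
    proof eventually_elim
      case (elim y)
      obtain q' p' where y: "y = (q', p')" by (cases y)
      have "(frac q' + (if frac p' < 1 / 2 then 0 else 1)) / 2 = 1 / 2 * q' + ?\<beta>"
        using elim by (simp add: y frac_def field_simps)
      moreover have "torus_periodic f" using flat_lines_smooth[OF f] by (simp add: torus_smooth_def)
      ultimately show ?case
        unfolding y prod.case by (simp only: comp_baker_inv_1 add_0_right)
    qed
    then show ?thesis by blast
  qed
qed

lemma comp_baker_inv_smooth:
  "f \<in> flat_lines (Suc m) \<Longrightarrow> torus_smooth (comp_baker_inv f 1)"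
  by (rule piecewise_affine_smooth[OF comp_baker_inv_piecewise_affine _ comp_baker_inv_periodic])

text \<open>The inverse map halves positions and so sends lines of level \<open>m\<close> to lines
  of level \<open>Suc m\<close>; this is where a dyadic level is used up.\<close>

lemma comp_baker_inv_flat_lines:
  assumes f: "f \<in> flat_lines (Suc m)" shows "comp_baker_inv f 1 \<in> flat_lines m"
  unfolding flat_lines_def
proof (intro CollectI conjI allI impI)
  show "torus_smooth (comp_baker_inv f 1)" by (rule comp_baker_inv_smooth[OF f])
  fix q p :: real assume qp: "q * 2 ^ m \<in> \<int> \<or> p \<in> \<int>"
  show "vanishes_near (comp_baker_inv f 1) (q, p)"
  proof (rule comp_baker_inv_vanishes_near)
    show "torus_periodic f" using flat_lines_smooth[OF f] by (simp add: torus_smooth_def)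
    fix n e :: int
    have "(q - of_int n + of_int e) / 2 * 2 ^ Suc m = (q - of_int n + of_int e) * 2 ^ m" by simp
    also have "\<dots> = q * 2 ^ m - of_int n * 2 ^ m + of_int e * 2 ^ m"
      by (simp add: algebra_simps)
    finally have "(q - of_int n + of_int e) / 2 * 2 ^ Suc m = q * 2 ^ m - of_int n * 2 ^ m + of_int e * 2 ^ m" .
    then have "(q - of_int n + of_int e) / 2 * 2 ^ Suc m \<in> \<int> \<or> 2 * p \<in> \<int>"
      using qp by (metis Ints_add Ints_diff Ints_mult Ints_numeral Ints_of_int Ints_power)
    then show "vanishes_near f ((q - of_int n + of_int e) / 2, 2 * p)"
      using f unfolding flat_lines_def by blast
  qed
qed

lemma C0_norm_cmult:
  assumes f: "torus_smooth f" and c: "0 < c"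
  shows "C0_norm (\<lambda>x. of_real c * f x) = c * C0_norm f"
proof (rule antisym)
  show "C0_norm (\<lambda>x. of_real c * f x) \<le> c * C0_norm f"
    using norm_le_C0_norm[OF f] c by (intro C0_norm_leI) (simp add: norm_mult)
  have bdd: "bdd_above (range (\<lambda>x. cmod (of_real c * f x)))"
    using norm_le_C0_norm[OF f] c by (intro bdd_aboveI[of _ "c * C0_norm f"]) (auto simp: norm_mult)
  have "C0_norm f \<le> C0_norm (\<lambda>x. of_real c * f x) / c"
  proof (rule C0_norm_leI)
    fix x
    have "c * cmod (f x) \<le> C0_norm (\<lambda>x. of_real c * f x)"
      using cSUP_upper[OF UNIV_I bdd, of x] c by (simp add: C0_norm_def norm_mult)
    then show "cmod (f x) \<le> C0_norm (\<lambda>x. of_real c * f x) / c" using c by (simp add: pos_le_divide_eq mult.commute)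
  qed
  then show "c * C0_norm f \<le> C0_norm (\<lambda>x. of_real c * f x)" using c by (simp add: pos_le_divide_eq mult.commute)
qed

text \<open>A derivative of the composition is the composed derivative times the chain rule factor,
  and composition does not change the sup norm. The pair 1 3 receives the factor 4, the pair 3 1 the
  factor 1 / 4.\<close>

lemma mixed_norm_comp_baker_inv:
  assumes f: "f \<in> flat_lines (Suc m)"
  shows "mixed_norm i j (comp_baker_inv f 1) = (1 / 2) ^ i * 2 ^ j * mixed_norm i j f"
proof -
  let ?g = "(partial_q ^^ i) ((partial_p ^^ j) f)"
  have g: "?g \<in> flat_lines (Suc m)" by (rule flat_lines_partials[OF f])
  have "mixed_norm i j (comp_baker_inv f 1) = (1 / 2) ^ i * 2 ^ j * C0_norm (comp_baker_inv ?g 1)"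
    unfolding mixed_norm_def piecewise_affine_partials[OF comp_baker_inv_piecewise_affine f]
    by (rule C0_norm_cmult[OF comp_baker_inv_smooth[OF g]]) simp
  also have "C0_norm (comp_baker_inv ?g 1) = C0_norm ?g"
    using flat_lines_smooth[OF g] by (intro C0_norm_comp_baker_inv) (simp add: torus_smooth_def)
  finally show ?thesis by (simp add: mixed_norm_def)
qed

text \<open>The good set omits these lines because \<open>\<delta>\<close> and
  \<open>\<gamma>\<close> are positive, so their points lie in the open complement of the closed
  support.\<close>

lemma plane_support_flat_lines:
  assumes a: "torus_smooth a" and s: "plane_support a \<subseteq> good_set n \<delta> \<gamma>" and "0 < \<delta>" "0 < \<gamma>"
  shows "a \<in> flat_lines n"
  unfolding flat_lines_def
proof (intro CollectI conjI allI impI a)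
  fix q p :: real assume qp: "q * 2 ^ n \<in> \<int> \<or> p \<in> \<int>"
  have "(q, p) \<notin> good_set n \<delta> \<gamma>"
  proof (cases "p \<in> \<int>")
    case True
    then have "frac p = 0" by simp
    then have "\<not> \<gamma> < frac p" using assms(4) by linarith
    then show ?thesis unfolding good_set_def by blast
  next
    case False
    then obtain k :: int where "q * 2 ^ n = of_int k" using qp by (auto elim: Ints_cases)
    then have "q - of_int k / 2 ^ n = 0" by (simp add: field_simps)
    then have "\<not> (\<bar>q - of_int k / 2 ^ n\<bar> > \<delta>)" using assms(3) by simp
    then show ?thesis unfolding good_set_def by blast
  qed
  then have "(q, p) \<in> - closure {x. a x \<noteq> 0}" using s by (auto simp: plane_support_def)
  then have "eventually (\<lambda>y. y \<in> - closure {x. a x \<noteq> 0}) (nhds (q, p))"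
    by (intro eventually_nhds_in_open) auto
  then show "vanishes_near a (q, p)" unfolding vanishes_near_def
  proof (rule eventually_mono)
    fix y assume "y \<in> - closure {x. a x \<noteq> 0}"
    then have "y \<notin> {x. a x \<noteq> 0}" using closure_subset[of "{x. a x \<noteq> 0}"] by fast
    then show "a y = 0" by simp
  qed
qed

section \<open>Egorov estimate\<close>

text \<open>The substitution x = (q + e) / 2 stretches the half interval carrying the strip to the
  unit interval: the Jacobian is 2, the frequency in x is 2 k, and the shift by \<open>e\<close>
  adds whole periods only.\<close>

lemma q_coeff_comp_baker_inv_strip:
  assumes f: "f \<in> flat_lines (Suc m)" and e: "e < 2" and p: "real e / 2 \<le> p" "p < (real e + 1) / 2"
  shows "q_coeff (comp_baker_inv (strip e f) 1) k p = 2 * q_coeff (strip e f) (2 * k) (2 * p)"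
proof -
  define g where "g = strip e f"
  define I where "I = q_coeff g (2 * k) (2 * p)"
  define h where "h x = g (x, 2 * p) * cis (- 2 * pi * of_int (2 * k) * x)" for x
  let ?S = "{real e / 2..(real e + 1) / 2}"
  have g: "g \<in> flat_lines (Suc m)" unfolding g_def by (rule strip_flat_lines[OF f])
  have sg: "torus_smooth g" by (rule flat_lines_smooth[OF g])
  \<comment> \<open>The values at 0, 1/2 and 1 are needed because the integrals run over closed
    intervals while the strips are half open.\<close>
  have flat: "g (of_nat j / 2, y) = 0" for j y
  proof -
    have "real j / 2 * 2 ^ Suc m \<in> \<int>" by simp
    then have "vanishes_near g (real j / 2, y)" using g unfolding flat_lines_def by blast
    then show ?thesis by (rule vanishes_near_imp_zero)
  qed
  have e01: "e = 0 \<or> e = 1" using e by auto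
  have hI: "(h has_integral I) {0..1}"
    unfolding h_def I_def q_coeff_def
    by (rule fourier1_has_integral[OF continuous_on_section_p[OF torus_smooth_continuous[OF sg]]])
  have out: "h x = 0" if "x \<in> {0..1}" "x \<notin> ?S" for x
  proof (cases "x = 1")
    case True
    then show ?thesis using flat[of 2] by (simp add: h_def)
  next
    case False
    then have "frac x = x" using that by (auto simp: frac_eq)
    then have "(frac x < 1 / 2) \<noteq> (e = 0)" using that e01 by auto
    then show ?thesis by (auto simp: h_def g_def strip_def)
  qed
  have "((\<lambda>x. if x \<in> ?S then h x else 0) has_integral I) {0..1}"
    by (rule has_integral_eq[OF _ hI]) (use out in auto)
  moreover have "?S \<subseteq> {0..1}" using e01 by auto
  ultimately have "(h has_integral I) (cbox (real e / 2) ((real e + 1) / 2))"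
    by (simp only: has_integral_restrict cbox_interval)
  from has_integral_affinity[OF this, of "1 / 2" "real e / 2"]
  have "((\<lambda>q. h (q / 2 + real e / 2)) has_integral 2 * I) ((\<lambda>x. 2 * x - real e) ` ?S)"
    by (simp add: scaleR_conv_of_real)
  moreover have "(\<lambda>x. 2 * x - real e) ` ?S = {0..1}"
  proof (rule equalityI; rule subsetI)
    fix x :: real assume "x \<in> {0..1}"
    then show "x \<in> (\<lambda>x. 2 * x - real e) ` ?S"
      by (intro image_eqI[of _ _ "(x + real e) / 2"]) (auto simp: field_simps)
  qed auto
  ultimately have aff: "((\<lambda>q. h (q / 2 + real e / 2)) has_integral 2 * I) {0..1}" by simp
  have fp: "(if frac p < 1 / 2 then 0 else 1) = real e"
  proof -
    have "frac p = p" using p e01 by (auto simp: frac_eq)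
    then show ?thesis using p e01 by auto
  qed
  have eq: "h (q / 2 + real e / 2) = comp_baker_inv g 1 (q, p) * cis (- 2 * pi * of_int k * q)" if q: "q \<in> {0..1}" for q
  proof -
    have b: "comp_baker_inv g 1 (q, p) = g ((frac q + real e) / 2, 2 * p)"
      using sg comp_baker_inv_1[of g q p] unfolding fp by (simp add: torus_smooth_def)
    show ?thesis
    proof (cases "q = 1")
      case True
      have "g (1 / 2 + real e / 2, 2 * p) = 0" using flat[of "1 + e" "2 * p"] by (simp add: add_divide_distrib)
      moreover have "g (real e / 2, 2 * p) = 0" by (rule flat)
      ultimately show ?thesis unfolding b using True by (simp add: h_def)
    next
      case False
      then have "frac q = q" using q by (auto simp: frac_eq)
      moreover have "cis (- 2 * pi * of_int (2 * k) * (q / 2 + real e / 2)) = cis (- 2 * pi * of_int k * q)"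
      proof -
        have "- 2 * pi * of_int (2 * k) * (q / 2 + real e / 2) = - 2 * pi * of_int k * q + 2 * pi * of_int (- (k * int e))"
          by (simp add: algebra_simps)
        then have "cis (- 2 * pi * of_int (2 * k) * (q / 2 + real e / 2)) = cis (- 2 * pi * of_int k * q) * cis (2 * pi * of_int (- (k * int e)))"
          by (simp only: cis_mult)
        also have "cis (2 * pi * of_int (- (k * int e))) = 1" by (simp only: cis_2pi_eq_1_iff) simp
        finally show ?thesis by simp
      qed
      ultimately show ?thesis unfolding b h_def by (simp only: add_divide_distrib)
    qed
  qed
  have "((\<lambda>q. comp_baker_inv g 1 (q, p) * cis (- 2 * pi * of_int k * q)) has_integral 2 * I) {0..1}"
    by (rule has_integral_eq[OF _ aff]) (rule eq)
  then have "q_coeff (comp_baker_inv g 1) k p = 2 * I"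
    unfolding q_coeff_def fourier1_def by (rule integral_unique)
  then show ?thesis by (simp add: I_def g_def)
qed

lemma egorov_strip:
  assumes f: "f \<in> flat_lines (Suc m)" and e: "e < 2" and M: "M > 0"
  shows "op_bound (quantum_baker (2 * M) * weyl_op (2 * M) (strip e f) * adj (quantum_baker (2 * M))
      - weyl_op (2 * M) (comp_baker_inv (strip e f) 1))
    ((3 * mixed_norm 1 3 f + 5 / 2 * mixed_norm 3 1 f) / real (2 * M) * inv_sq_sum)"
proof -
  let ?g = "strip e f" and ?b = "comp_baker_inv (strip e f) 1"
  have g: "?g \<in> flat_lines (Suc m)" by (rule strip_flat_lines[OF f])
  have sg: "torus_smooth ?g" and sb: "torus_smooth ?b"
    by (rule flat_lines_smooth[OF g], rule comp_baker_inv_smooth[OF g])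
  have per: "torus_periodic ?g" using sg by (simp add: torus_smooth_def)
  have e01: "e = 0 \<or> e = 1" using e by auto
  have z0: "?g (q, 0) = 0" for q
    using g unfolding flat_lines_def by (intro vanishes_near_imp_zero) simp
  have half: "(frac (real i / real (2 * M)) < 1 / 2) \<longleftrightarrow> i < M" if "i < 2 * M" for i
  proof -
    have fr: "frac (real i / real (2 * M)) = real i / real (2 * M)" using that by (simp add: frac_eq)
    show ?thesis unfolding fr using M by (simp add: field_simps)
  qed
  have out: "(i < M) \<noteq> (e = 0)" if "i < 2 * M" "i \<notin> half_range M e" for i
    using that e01 by (auto simp: half_range_def)
  have "op_bound (quantum_baker (2 * M) * weyl_op (2 * M) ?g * adj (quantum_baker (2 * M)) - weyl_op (2 * M) ?b)
    ((3 * mixed_norm 1 3 ?g + 2 * mixed_norm 3 1 ?g + mixed_norm 3 1 ?b) / real (2 * M) * inv_sq_sum)"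
  proof (rule egorov_half_block[OF sg sb M e])
    fix i p assume i: "i < 2 * M" "i \<notin> half_range M e"
    show "?g (real i / real (2 * M), p) = 0"
      using out[OF i] half[OF i(1)] by (auto simp: strip_def)
  next
    show "?g (q, 0) = 0" for q by (rule z0)
    show "?b (q, 0) = 0" for q by (simp only: comp_baker_inv_1[OF per] mult_zero_right z0)
  next
    fix i and q :: real assume i: "i < 2 * M" "i \<notin> half_range M e"
    let ?\<epsilon> = "if frac (real i / real (2 * M)) < 1 / 2 then 0 else 1 :: real"
    have lt: "0 \<le> frac q" "frac q < 1" by (simp_all add: frac_lt_1)
    have fr: "frac ((frac q + ?\<epsilon>) / 2) = (frac q + ?\<epsilon>) / 2" using lt by (simp add: frac_eq)
    have aux: "(t + (if P then 0 else 1)) / 2 < 1 / 2 \<longleftrightarrow> P" if "0 \<le> t" "t < 1" for t :: real and P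
      using that by auto
    \<comment> \<open>The momentum decides the branch: the lower half comes from the left strip, the
      upper half from the right one. So for \<open>i\<close> outside half \<open>e\<close> the strip
      function is evaluated off its strip.\<close>
    have "(frac ((frac q + ?\<epsilon>) / 2) < 1 / 2) \<longleftrightarrow> i < M"
      unfolding fr by (simp only: aux[OF lt] half[OF i(1)])
    then have "?g ((frac q + ?\<epsilon>) / 2, y) = 0" for y
      using out[OF i] by (auto simp: strip_def)
    then show "?b (q, real i / real (2 * M)) = 0" by (simp only: comp_baker_inv_1[OF per])
  next
    fix r s assume rs: "r < M" "s < M"
    let ?p = "(real (r + e * M) + real (s + e * M)) / (2 * real (2 * M))"
    have p: "?p = (real r + real s) / (4 * real M) + real e / 2" using M by (simp add: field_simps)
    have "(real r + real s) / (4 * real M) < 1 / 2" using rs by (simp add: field_simps)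
    moreover have "0 \<le> (real r + real s) / (4 * real M)" by simp
    ultimately have "real e / 2 \<le> ?p" "?p < (real e + 1) / 2"
      unfolding p by (simp_all add: add_divide_distrib)
    from q_coeff_comp_baker_inv_strip[OF f e this, of "int r - int s"]
    have "q_coeff ?b (int r - int s) ?p = 2 * q_coeff ?g (2 * (int r - int s)) (2 * ?p)" .
    \<comment> \<open>The half \<open>e\<close> becomes an integer shift of the doubled momentum,
      which periodicity removes.\<close>
    also have "2 * ?p = (real r + real s) / real (2 * M) + of_int (int e)"
      unfolding p by (simp add: add_divide_distrib)
    finally show "2 * q_coeff ?g (2 * (int r - int s)) ((real r + real s) / real (2 * M)) = q_coeff ?b (int r - int s) ?p"
      by (simp only: q_coeff_periodic[OF sg])
  qed
  then show ?thesis
  proof (rule op_bound_mono)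
    have "mixed_norm 3 1 ?b = 1 / 4 * mixed_norm 3 1 ?g"
      unfolding mixed_norm_comp_baker_inv[OF g] by (simp add: power3_eq_cube)
    \<comment> \<open>The coefficient of \<open>mixed_norm 3 1\<close> is 2 + 1 / 4, rounded up to 5
      / 2.\<close>
    then have "3 * mixed_norm 1 3 ?g + 2 * mixed_norm 3 1 ?g + mixed_norm 3 1 ?b
      \<le> 3 * mixed_norm 1 3 f + 5 / 2 * mixed_norm 3 1 f"
      using mixed_norm_strip_le[OF f, of 1 3 e] mixed_norm_strip_le[OF f, of 3 1 e]
        mixed_norm_nonneg[OF sg, of 3 1] by linarith
    then show "(3 * mixed_norm 1 3 ?g + 2 * mixed_norm 3 1 ?g + mixed_norm 3 1 ?b) / real (2 * M) * inv_sq_sum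
      \<le> (3 * mixed_norm 1 3 f + 5 / 2 * mixed_norm 3 1 f) / real (2 * M) * inv_sq_sum"
      by (intro mult_right_mono divide_right_mono inv_sq_sum_nonneg) auto
  qed
qed

section \<open>Adding the two strips and iterating\<close>

lemma weyl_op_add:
  assumes f: "torus_smooth f" and g: "torus_smooth g"
  shows "weyl_op N (\<lambda>x. f x + g x) = weyl_op N f + weyl_op N g"
proof -
  have fc: "fourier_coeff (\<lambda>x. f x + g x) k = fourier_coeff f k + fourier_coeff g k" for k
  proof -
    obtain k1 k2 where k: "k = (k1, k2)" by (cases k)
    let ?c = "\<lambda>z. cis (- 2 * pi * (fst z * of_int k2 - snd z * of_int k1))"
    have int: "(\<lambda>z. h z * ?c z) integrable_on cbox (0, 0) (1, 1)" if h: "torus_smooth h" for h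
      by (rule integrable_continuous, rule continuous_on_plane_wave[OF h])
    show ?thesis
      unfolding k fourier_coeff_def
      using integral_add[OF int[OF f] int[OF g]] by (simp add: case_prod_beta' distrib_right)
  qed
  have "weyl_op N (\<lambda>x. f x + g x) $$ (i, j) = weyl_op N f $$ (i, j) + weyl_op N g $$ (i, j)"
    if ij: "i < N" "j < N" for i j
  proof -
    have "((\<lambda>k. fourier_coeff f k * weyl_translation N k $$ (i, j) + fourier_coeff g k * weyl_translation N k $$ (i, j))
      has_sum (weyl_op N f $$ (i, j) + weyl_op N g $$ (i, j))) UNIV"
      by (intro has_sum_add weyl_op_has_sum f g ij)
    then have "(\<Sum>\<^sub>\<infinity>k. fourier_coeff (\<lambda>x. f x + g x) k * weyl_translation N k $$ (i, j))
      = weyl_op N f $$ (i, j) + weyl_op N g $$ (i, j)"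
      unfolding fc distrib_right by (rule infsumI)
    then show ?thesis using ij by (simp add: weyl_op_def)
  qed
  then show ?thesis
    by (intro eq_matI) (simp_all add: carrier_matD[OF weyl_op_carrier])
qed

text \<open>Flatness keeps both restrictions of \<open>f\<close> smooth, so
  \<open>egorov_strip\<close> applies to each; the two equal bounds add up to the coefficients 6 and
  5.\<close>

lemma egorov_step:
  assumes f: "f \<in> flat_lines (Suc m)" and M: "M > 0"
  shows "op_bound (quantum_baker (2 * M) * weyl_op (2 * M) f * adj (quantum_baker (2 * M))
      - weyl_op (2 * M) (comp_baker_inv f 1))
    ((6 * mixed_norm 1 3 f + 5 * mixed_norm 3 1 f) / real (2 * M) * inv_sq_sum)"
proof -
  let ?N = "2 * M"
  define Q where "Q = quantum_baker ?N"
  define X where "X e = weyl_op ?N (strip e f)" for e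
  define Y where "Y e = weyl_op ?N (comp_baker_inv (strip e f) 1)" for e
  have c: "Q \<in> carrier_mat ?N ?N" "adj Q \<in> carrier_mat ?N ?N" "X e \<in> carrier_mat ?N ?N" "Y e \<in> carrier_mat ?N ?N" for e
    using unitary_quantum_baker[OF refl M] unfolding unitary_mat_def Q_def X_def Y_def by auto
  have cQ: "Q * X e * adj Q \<in> carrier_mat ?N ?N" for e by (intro mult_carrier_mat[of _ ?N ?N _ ?N] c)
  note g = strip_flat_lines[OF f]
  have X: "weyl_op ?N f = X 0 + X 1"
    unfolding X_def by (subst strip_add) (rule weyl_op_add[OF flat_lines_smooth[OF g] flat_lines_smooth[OF g]])
  have "comp_baker_inv f 1 = (\<lambda>x. comp_baker_inv (strip 0 f) 1 x + comp_baker_inv (strip 1 f) 1 x)"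
    unfolding comp_baker_inv_def by (subst strip_add) (rule refl)
  then have Y: "weyl_op ?N (comp_baker_inv f 1) = Y 0 + Y 1"
    unfolding Y_def by (simp only: weyl_op_add[OF comp_baker_inv_smooth[OF g] comp_baker_inv_smooth[OF g]])
  have "op_bound ((Q * X 0 * adj Q - Y 0) + (Q * X 1 * adj Q - Y 1))
    ((3 * mixed_norm 1 3 f + 5 / 2 * mixed_norm 3 1 f) / real ?N * inv_sq_sum +
     (3 * mixed_norm 1 3 f + 5 / 2 * mixed_norm 3 1 f) / real ?N * inv_sq_sum)"
    unfolding Q_def X_def Y_def
    by (intro op_bound_add[of _ ?N] egorov_strip[OF f _ M] minus_carrier_mat weyl_op_carrier) auto
  moreover have "Q * (X 0 + X 1) * adj Q - (Y 0 + Y 1) = (Q * X 0 * adj Q - Y 0) + (Q * X 1 * adj Q - Y 1)"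
  proof -
    have "Q * (X 0 + X 1) = Q * X 0 + Q * X 1" by (rule mult_add_distrib_mat[OF c(1,3,3)])
    moreover have "(Q * X 0 + Q * X 1) * adj Q = Q * X 0 * adj Q + Q * X 1 * adj Q"
      by (rule add_mult_distrib_mat[OF mult_carrier_mat[OF c(1,3)] mult_carrier_mat[OF c(1,3)] c(2)])
    moreover have "(A + A') - (B + B') = (A - B) + (A' - B')"
      if "A \<in> carrier_mat ?N ?N" "A' \<in> carrier_mat ?N ?N" "B \<in> carrier_mat ?N ?N" "B' \<in> carrier_mat ?N ?N"
      for A A' B B' :: "complex mat"
      by (rule eq_matI) (use that in auto)
    ultimately show ?thesis using cQ c by simp
  qed
  moreover have "(3 * mixed_norm 1 3 f + 5 / 2 * mixed_norm 3 1 f) / real ?N * inv_sq_sum +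
     (3 * mixed_norm 1 3 f + 5 / 2 * mixed_norm 3 1 f) / real ?N * inv_sq_sum
    = (6 * mixed_norm 1 3 f + 5 * mixed_norm 3 1 f) / real ?N * inv_sq_sum"
    by (simp add: add_divide_distrib algebra_simps)
  ultimately show ?thesis unfolding X Y Q_def[symmetric] by simp
qed

text \<open>\<open>A ^\<^sub>m Suc k\<close> puts the new factor on the right, whereas the induction
  conjugates from the outside.\<close>

lemma pow_mat_commute:
  assumes "A \<in> carrier_mat n n"
  shows "A ^\<^sub>m k * A = A * A ^\<^sub>m k"
proof (induction k)
  case (Suc k)
  have "A ^\<^sub>m Suc k * A = (A * A ^\<^sub>m k) * A" using Suc by simp
  also have "\<dots> = A * (A ^\<^sub>m k * A)" by (rule assoc_mult_mat) (use assms in auto)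
  finally show ?case by simp
qed (use assms in simp)

text \<open>The mixed norms entering the error of the \<open>k\<close>-th step are \<open>4\<^sup>k\<close> resp. \<open>4\<^bsup>-k\<^esup>\<close> times the
  initial ones, so the errors sum up geometrically.\<close>

lemma egorov_iterate:
  assumes M: "M > 0"
  shows "f \<in> flat_lines (m + k) \<Longrightarrow> comp_baker_inv f k \<in> flat_lines m \<and>
    (\<forall>i j. mixed_norm i j (comp_baker_inv f k) = ((1 / 2) ^ i * 2 ^ j) ^ k * mixed_norm i j f) \<and>
    op_bound (quantum_baker (2 * M) ^\<^sub>m k * weyl_op (2 * M) f * adj (quantum_baker (2 * M)) ^\<^sub>m k
        - weyl_op (2 * M) (comp_baker_inv f k))
      ((2 * 4 ^ k * mixed_norm 1 3 f + 7 * (1 - (1 / 4) ^ k) * mixed_norm 3 1 f) / real (2 * M) * inv_sq_sum)"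
proof (induction k arbitrary: m)
  case 0
  then have sf: "torus_smooth f" by (simp add: flat_lines_smooth)
  have f0: "comp_baker_inv f 0 = f" using sf by (intro comp_baker_inv_0) (simp add: torus_smooth_def)
  let ?N = "2 * M"
  have dQ: "dim_row (quantum_baker ?N) = ?N" "dim_col (quantum_baker ?N) = ?N"
    using unitary_quantum_baker[OF refl M] unfolding unitary_mat_def by auto
  have "quantum_baker ?N ^\<^sub>m 0 * weyl_op ?N f * adj (quantum_baker ?N) ^\<^sub>m 0 - weyl_op ?N f = 0\<^sub>m ?N ?N"
    using dQ left_mult_one_mat[OF weyl_op_carrier[of ?N f]] right_mult_one_mat[OF weyl_op_carrier[of ?N f]]
      minus_r_inv_mat[OF weyl_op_carrier[of ?N f]] by simp
  moreover have "op_bound (0\<^sub>m ?N ?N) (2 * mixed_norm 1 3 f / real ?N * inv_sq_sum)"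
    unfolding op_bound_def
  proof
    fix v :: "complex vec" assume "v \<in> carrier_vec (dim_col (0\<^sub>m ?N ?N :: complex mat))"
    then have "vec_l2_norm (0\<^sub>m ?N ?N *\<^sub>v v) = 0" by (simp add: vec_l2_norm_def L2_set_def)
    then show "vec_l2_norm (0\<^sub>m ?N ?N *\<^sub>v v) \<le> 2 * mixed_norm 1 3 f / real ?N * inv_sq_sum * vec_l2_norm v"
      using mixed_norm_nonneg[OF sf] inv_sq_sum_nonneg vec_l2_norm_nonneg by simp
  qed
  ultimately show ?case using 0 unfolding f0 by simp
next
  case (Suc k)
  let ?N = "2 * M" and ?g = "comp_baker_inv f k"
  \<comment> \<open>The coefficients majorise the accumulated errors:
    \<open>2 * 4 ^ k + 6 * 4 ^ k\<close> is \<open>2 * 4 ^ Suc k\<close>, and the sum of 5 / 4^j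
    over j < k is 20 / 3 times \<open>1 - (1 / 4) ^ k\<close>, with 20 / 3 rounded up to 7.\<close>
  define E where "E k = 2 * 4 ^ k * mixed_norm 1 3 f + 7 * (1 - (1 / 4) ^ k) * mixed_norm 3 1 f" for k :: nat
  define Q where "Q = quantum_baker ?N"
  define X where "X = weyl_op ?N f"
  define Y where "Y = weyl_op ?N ?g"
  define Z where "Z = weyl_op ?N (comp_baker_inv f (Suc k))"
  have sf: "torus_smooth f" using Suc.prems by (rule flat_lines_smooth)
  have "f \<in> flat_lines (Suc m + k)" using Suc.prems by simp
  from Suc.IH[OF this] have g: "?g \<in> flat_lines (Suc m)"
    and mn: "\<And>i j. mixed_norm i j ?g = ((1 / 2) ^ i * 2 ^ j) ^ k * mixed_norm i j f"
    and IH: "op_bound (Q ^\<^sub>m k * X * adj Q ^\<^sub>m k - Y)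
      (E k / real ?N * inv_sq_sum)"
    unfolding Q_def X_def Y_def E_def by blast+
  have uQ: "unitary_mat ?N Q" unfolding Q_def by (rule unitary_quantum_baker[OF refl M])
  then have c: "Q \<in> carrier_mat ?N ?N" "adj Q \<in> carrier_mat ?N ?N" by (auto simp: unitary_mat_def)
  have cX: "X \<in> carrier_mat ?N ?N" "Y \<in> carrier_mat ?N ?N" "Z \<in> carrier_mat ?N ?N"
    unfolding X_def Y_def Z_def by simp_all
  have cP: "Q ^\<^sub>m k \<in> carrier_mat ?N ?N" "adj Q ^\<^sub>m k \<in> carrier_mat ?N ?N" using c by (simp_all add: pow_carrier_mat)
  define W where "W = Q ^\<^sub>m k * X * adj Q ^\<^sub>m k"
  have cW: "W \<in> carrier_mat ?N ?N" unfolding W_def by (intro mult_carrier_mat[of _ ?N ?N _ ?N] cP cX)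
  have step: "op_bound (Q * Y * adj Q - Z)
      ((6 * mixed_norm 1 3 ?g + 5 * mixed_norm 3 1 ?g) / real ?N * inv_sq_sum)"
    unfolding Q_def Y_def Z_def comp_baker_inv_Suc by (rule egorov_step[OF g M])
  have B0: "0 \<le> E k / real ?N * inv_sq_sum"
    using mixed_norm_nonneg[OF sf] inv_sq_sum_nonneg power_le_one[of "1 / 4 :: real" k]
    unfolding E_def by (intro mult_nonneg_nonneg divide_nonneg_nonneg add_nonneg_nonneg) auto
  have "op_bound (Q * (W - Y) * adj Q)
      (E k / real ?N * inv_sq_sum)"
    by (rule op_bound_conj[OF c minus_carrier_mat[OF cX(2)] unitary_op_bound[OF uQ]
          unitary_op_bound[OF unitary_adj[OF uQ]] IH[folded W_def] B0])
  from op_bound_add[OF _ _ this step, of ?N]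
  have "op_bound (Q * (W - Y) * adj Q + (Q * Y * adj Q - Z))
      (E k / real ?N * inv_sq_sum
      + (6 * mixed_norm 1 3 ?g + 5 * mixed_norm 3 1 ?g) / real ?N * inv_sq_sum)"
    using minus_carrier_mat[OF cX(3)] mult_carrier_mat[OF mult_carrier_mat[OF c(1) minus_carrier_mat[OF cX(2)]] c(2)] by blast
  moreover have "Q * (W - Y) * adj Q + (Q * Y * adj Q - Z) = Q ^\<^sub>m Suc k * X * adj Q ^\<^sub>m Suc k - Z"
  proof -
    have "Q ^\<^sub>m Suc k * X * adj Q ^\<^sub>m Suc k = (Q * Q ^\<^sub>m k) * X * (adj Q ^\<^sub>m k * adj Q)"
      using pow_mat_commute[OF c(1), of k] by simp
    also have "(Q * Q ^\<^sub>m k) * X = Q * (Q ^\<^sub>m k * X)" by (rule assoc_mult_mat[OF c(1) cP(1) cX(1)])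
    also have "Q * (Q ^\<^sub>m k * X) * (adj Q ^\<^sub>m k * adj Q) = Q * (Q ^\<^sub>m k * X) * adj Q ^\<^sub>m k * adj Q"
      by (rule assoc_mult_mat[symmetric]) (use c cP cX in auto)
    also have "Q * (Q ^\<^sub>m k * X) * adj Q ^\<^sub>m k = Q * W"
      unfolding W_def by (rule assoc_mult_mat) (use c cP cX in auto)
    finally have P: "Q ^\<^sub>m Suc k * X * adj Q ^\<^sub>m Suc k = Q * W * adj Q" .
    have D: "Q * (W - Y) * adj Q = Q * W * adj Q - Q * Y * adj Q"
      unfolding mult_minus_distrib_mat[OF c(1) cW cX(2)]
      by (rule minus_mult_distrib_mat[OF mult_carrier_mat[OF c(1) cW] mult_carrier_mat[OF c(1) cX(2)] c(2)])
    have "(A - B) + (B - C) = A - C"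
      if "A \<in> carrier_mat ?N ?N" "B \<in> carrier_mat ?N ?N" "C \<in> carrier_mat ?N ?N" for A B C :: "complex mat"
      by (rule eq_matI) (use that in auto)
    then show ?thesis unfolding P D
      using mult_carrier_mat[OF mult_carrier_mat[OF c(1) cW] c(2)] mult_carrier_mat[OF mult_carrier_mat[OF c(1) cX(2)] c(2)] cX(3)
      by blast
  qed
  ultimately have "op_bound (Q ^\<^sub>m Suc k * X * adj Q ^\<^sub>m Suc k - Z)
      (E k / real ?N * inv_sq_sum
      + (6 * mixed_norm 1 3 ?g + 5 * mixed_norm 3 1 ?g) / real ?N * inv_sq_sum)" by simp
  then have bound: "op_bound (Q ^\<^sub>m Suc k * X * adj Q ^\<^sub>m Suc k - Z)
      (E (Suc k) / real ?N * inv_sq_sum)"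
  proof (rule op_bound_mono)
    have m13: "mixed_norm 1 3 ?g = 4 ^ k * mixed_norm 1 3 f"
      unfolding mn by (simp add: power3_eq_cube)
    have m31: "mixed_norm 3 1 ?g = (1 / 4) ^ k * mixed_norm 3 1 f"
      unfolding mn by (simp add: power3_eq_cube)
    \<comment> \<open>21 / 4 is 7 (1 - 1 / 4), which times \<open>(1 / 4) ^ k\<close> is the growth
      of the second coefficient of \<open>E\<close> in one step.\<close>
    have "5 * ((1 / 4) ^ k * mixed_norm 3 1 f) \<le> 21 / 4 * ((1 / 4) ^ k * mixed_norm 3 1 f)"
      using mixed_norm_nonneg[OF sf, of 3 1] by (intro mult_right_mono) auto
    then have "E k
        + (6 * mixed_norm 1 3 ?g + 5 * mixed_norm 3 1 ?g)
      \<le> E (Suc k)"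
      unfolding m13 m31 E_def by (simp add: algebra_simps)
    then have "(E k
        + (6 * mixed_norm 1 3 ?g + 5 * mixed_norm 3 1 ?g)) / real ?N * inv_sq_sum
      \<le> E (Suc k) / real ?N * inv_sq_sum"
      by (intro mult_right_mono divide_right_mono inv_sq_sum_nonneg) auto
    then show "E k / real ?N * inv_sq_sum
      + (6 * mixed_norm 1 3 ?g + 5 * mixed_norm 3 1 ?g) / real ?N * inv_sq_sum
      \<le> E (Suc k) / real ?N * inv_sq_sum"
      by (simp only: add_divide_distrib distrib_right)
  qed
  have "comp_baker_inv f (Suc k) \<in> flat_lines m"
    unfolding comp_baker_inv_Suc by (rule comp_baker_inv_flat_lines[OF g])
  moreover have "mixed_norm i j (comp_baker_inv f (Suc k)) = ((1 / 2) ^ i * 2 ^ j) ^ Suc k * mixed_norm i j f" for i j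
    unfolding comp_baker_inv_Suc mixed_norm_comp_baker_inv[OF g] mn by simp
  ultimately show ?case using bound unfolding Q_def X_def Z_def E_def by blast
qed

lemma mixed_norm_le_C_norm:
  assumes f: "torus_smooth f" and "i + j \<le> m"
  shows "mixed_norm i j f \<le> C_norm m f"
proof -
  have "finite {(i, j). i + j \<le> m}"
    by (rule finite_subset[of _ "{..m} \<times> {..m}"]) auto
  from member_le_sum[OF _ _ this, of "(i, j)" "\<lambda>(i, j). mixed_norm i j f"] show ?thesis
    using assms(2) mixed_norm_nonneg[OF f] by (auto simp: C_norm_def mixed_norm_def)
qed

theorem theorem5p12:
  shows "\<exists>C :: real. C > 0 \<and>
    (\<forall>(n :: nat) (\<delta> :: real) (\<gamma> :: real) (a :: real \<times> real \<Rightarrow> complex) (N :: nat) (\<sigma> :: real).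
      n > 0 \<longrightarrow> 0 < \<delta> \<longrightarrow> \<delta> < 1 / 2 ^ (n + 1) \<longrightarrow> 0 < \<gamma> \<longrightarrow> \<gamma> < 1 / 2 \<longrightarrow>
      torus_smooth a \<longrightarrow> plane_support a \<subseteq> good_set n \<delta> \<gamma> \<longrightarrow>
      even N \<longrightarrow> N \<ge> 2 \<longrightarrow> 4 ^ n / real N \<le> \<sigma> \<longrightarrow> \<sigma> \<le> real N \<longrightarrow>
      op_norm (quantum_baker N ^\<^sub>m n * weyl_op N a * mat_inv (quantum_baker N) ^\<^sub>m n
               - weyl_op N (comp_baker_inv a n))
      \<le> C * (C0_norm a * real N powr (5 / 4) * \<sigma> powr (1 / 4)
                * exp (- pi * real N * min (\<sigma> * \<delta>\<^sup>2) (\<gamma>\<^sup>2 / \<sigma>))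
             + 1 / real N *
                 (max \<sigma> (1 / \<sigma>) * C_norm 5 a
                  + max (\<sigma> / 4 ^ n) (4 ^ n / \<sigma>) * C_norm 5 (comp_baker_inv a n))))"
proof (intro exI[of _ "7 * inv_sq_sum + 1"] conjI allI impI)
  \<comment> \<open>\<open>inv_sq_sum\<close> is used as a nonnegative number, so 1 is added to make
    the constant positive.\<close>
  show "0 < 7 * inv_sq_sum + 1" using inv_sq_sum_nonneg by linarith
next
  fix n :: nat and \<delta> \<gamma> \<sigma> :: real and a :: "real \<times> real \<Rightarrow> complex" and N :: nat
  assume \<delta>: "0 < \<delta>" and \<gamma>: "0 < \<gamma>" and a: "torus_smooth a" and supp: "plane_support a \<subseteq> good_set n \<delta> \<gamma>"
    and N: "even N" "N \<ge> 2" and \<sigma>: "4 ^ n / real N \<le> \<sigma>"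
  let ?b = "comp_baker_inv a n" and ?Z = inv_sq_sum
  let ?E = "C0_norm a * real N powr (5 / 4) * \<sigma> powr (1 / 4) * exp (- pi * real N * min (\<sigma> * \<delta>\<^sup>2) (\<gamma>\<^sup>2 / \<sigma>))"
  let ?R = "max \<sigma> (1 / \<sigma>) * C_norm 5 a + max (\<sigma> / 4 ^ n) (4 ^ n / \<sigma>) * C_norm 5 ?b"
  obtain M where M: "N = 2 * M" "M > 0" using N by auto
  have flat: "a \<in> flat_lines (0 + n)" using plane_support_flat_lines[OF a supp \<delta> \<gamma>] by simp
  from egorov_iterate[OF M(2) flat]
  have b: "?b \<in> flat_lines 0" and mn: "mixed_norm 1 3 ?b = ((1 / 2) ^ 1 * 2 ^ 3) ^ n * mixed_norm 1 3 a"
    and bound: "op_bound (quantum_baker N ^\<^sub>m n * weyl_op N a * adj (quantum_baker N) ^\<^sub>m n - weyl_op N ?b)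
      ((2 * 4 ^ n * mixed_norm 1 3 a + 7 * (1 - (1 / 4) ^ n) * mixed_norm 3 1 a) / real N * ?Z)"
    unfolding M(1) by blast+
  have sb: "torus_smooth ?b" by (rule flat_lines_smooth[OF b])
  have mn: "4 ^ n * mixed_norm 1 3 a = mixed_norm 1 3 ?b" unfolding mn by (simp add: power3_eq_cube)
  have Cn: "0 \<le> C_norm 5 a" "0 \<le> C_norm 5 ?b"
    using mixed_norm_le_C_norm[OF a, of 0 0 5] mixed_norm_nonneg[OF a, of 0 0]
      mixed_norm_le_C_norm[OF sb, of 0 0 5] mixed_norm_nonneg[OF sb, of 0 0] by simp_all
  have "0 < 4 ^ n / real N" using N by simp
  then have \<sigma>0: "0 < \<sigma>" using \<sigma> by linarith
  \<comment> \<open>A positive number or its reciprocal is at least 1. For \<open>\<sigma>\<close>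
    and \<open>\<sigma> / 4 ^ n\<close> this shows that both weights in the claim can only enlarge
    the norms.\<close>
  have max1: "1 \<le> max t (1 / t)" if "0 < t" for t :: real
    using that by (cases "1 \<le> t") (auto simp: le_max_iff_disj)
  have R: "C_norm 5 a + C_norm 5 ?b \<le> ?R"
  proof (rule add_mono)
    show "C_norm 5 a \<le> max \<sigma> (1 / \<sigma>) * C_norm 5 a"
      using mult_right_mono[OF max1[OF \<sigma>0] Cn(1)] by simp
    show "C_norm 5 ?b \<le> max (\<sigma> / 4 ^ n) (4 ^ n / \<sigma>) * C_norm 5 ?b"
      using mult_right_mono[OF max1[of "\<sigma> / 4 ^ n"] Cn(2)] \<sigma>0 by simp
  qed
  have "0 \<le> ?R" using R Cn by linarith
  then have X: "0 \<le> 1 / real N * ?R" by (intro mult_nonneg_nonneg) simp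
  have gen: "7 * z * x \<le> (7 * z + 1) * (y + x)" if "0 \<le> z" "0 \<le> x" "0 \<le> y" for x y z :: real
    using that by (intro mult_mono) auto
  have E: "0 \<le> ?E" using C0_norm_nonneg[OF a] by simp
  have "(2 * 4 ^ n * mixed_norm 1 3 a + 7 * (1 - (1 / 4) ^ n) * mixed_norm 3 1 a) \<le> 7 * ?R"
  proof -
    \<comment> \<open>The growth \<open>4 ^ n\<close> is paid for by the evolved symbol, whose norm
      is exactly \<open>4 ^ n\<close> times that of \<open>a\<close> for this derivative.\<close>
    have "2 * 4 ^ n * mixed_norm 1 3 a \<le> 7 * C_norm 5 ?b"
      using mn mixed_norm_le_C_norm[OF sb, of 1 3 5] Cn by simp
    moreover have "(1 - (1 / 4) ^ n) * mixed_norm 3 1 a \<le> 1 * mixed_norm 3 1 a"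
      by (intro mult_right_mono mixed_norm_nonneg[OF a]) simp
    moreover have "mixed_norm 3 1 a \<le> C_norm 5 a" by (rule mixed_norm_le_C_norm[OF a]) simp
    moreover have "7 * (1 - (1 / 4) ^ n) * mixed_norm 3 1 a = 7 * ((1 - (1 / 4) ^ n) * mixed_norm 3 1 a)"
      by (simp only: mult.assoc)
    moreover have "A + B \<le> 7 * R"
      if "A \<le> 7 * y" "B' \<le> 1 * z" "z \<le> x" "B = 7 * B'" "x + y \<le> R" for A B B' x y z R :: real
      using that by linarith
    ultimately show ?thesis using R by blast
  qed
  then have "(2 * 4 ^ n * mixed_norm 1 3 a + 7 * (1 - (1 / 4) ^ n) * mixed_norm 3 1 a) / real N * ?Z
    \<le> (7 * ?R) / real N * ?Z"
    by (intro mult_right_mono divide_right_mono inv_sq_sum_nonneg) auto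
  also have "\<dots> = 7 * ?Z * (1 / real N * ?R)" by simp
  also have "\<dots> \<le> (7 * ?Z + 1) * (?E + 1 / real N * ?R)"
    by (rule gen[OF inv_sq_sum_nonneg X E])
  finally have le: "(2 * 4 ^ n * mixed_norm 1 3 a + 7 * (1 - (1 / 4) ^ n) * mixed_norm 3 1 a) / real N * ?Z
    \<le> (7 * ?Z + 1) * (?E + 1 / real N * ?R)" .
  have "0 \<le> (7 * ?Z + 1) * (?E + 1 / real N * ?R)"
    by (intro mult_nonneg_nonneg[OF _ add_nonneg_nonneg[OF E X]]) (use inv_sq_sum_nonneg in simp)
  then have "op_norm (quantum_baker N ^\<^sub>m n * weyl_op N a * adj (quantum_baker N) ^\<^sub>m n - weyl_op N ?b)
    \<le> (7 * ?Z + 1) * (?E + 1 / real N * ?R)"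
    by (rule op_norm_le[OF op_bound_mono[OF bound le]])
  then show "op_norm (quantum_baker N ^\<^sub>m n * weyl_op N a * mat_inv (quantum_baker N) ^\<^sub>m n - weyl_op N ?b)
    \<le> (7 * ?Z + 1) * (?E + 1 / real N * ?R)"
    using unitary_mat_inv[OF unitary_quantum_baker[OF M]] by simp
qed

end
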